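(* Let $\Gamma$ be a non-elementary hyperbolic group and $d\in\mathcal{D}_\Gamma$. Then there exists a constant $\delta_1>0$ satisfying the following. Let $\delta>\delta_1$ and let $\mu_l$ be the uniform probability measure supported on $S_l=\{g\in\Gamma: l-\delta<d(o,g)\le l\}$. Then $S_l$ generates $\Gamma$ for $l$ large enough, and $[d_{\mu_l}]$ converges to $[d]$ in $(\mathscr{D}_\Gamma,\Delta)$ as $l\to\infty$.
   Context: $o$ is the identity of $\Gamma$. $\mathcal{D}_\Gamma$ is the set of functions $d:\Gamma\times\Gamma\to[0,\infty)$ that are pseudometrics ($d(x,x)=0$, triangle inequality, possibly $d(x,y)=0$ for $x\ne y$), symmetric, left-invariant, Gromov hyperbolic (there is $\delta\geq 0$ with $(x|z)_w\ge\min\{(x|y)_w,(y|z)_w\}-\delta$ for all $x,y,z,w$, where $(x|y)_w=\frac12(d(x,w)+d(w,y)-d(x,y))$), and quasi-isometric via the identity map to a word metric for a finite symmetric generating set. $\mathscr{D}_\Gamma$ is the set of classes $[d]$ of $d\in\mathcal{D}_\Gamma$ under rough similarity: $d\sim d'$ iff $\sup_g|d(o,g)-\lambda d'(o,g)|<\infty$ for some $\lambda>0$. With $[\Gamma]'$ the non-torsion conjugacy classes and $\ell_d[g]=\lim_k d(o,g^k)/k$, the metric on $\mathscr{D}_\Gamma$ is $\Delta([d_1],[d_2])=\log(\mathrm{Dil}(d_1,d_2)\mathrm{Dil}(d_2,d_1))$ where $\mathrm{Dil}(d_1,d_2)=\sup_{[g]\in[\Gamma]'}\ell_{d_1}[g]/\ell_{d_2}[g]$.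 For a probability measure $\mu$ on $\Gamma$ whose support generates $\Gamma$ as a semigroup, let $Z_k$ be the product of $k$ independent $\mu$-distributed elements ($Z_0=o$). When this random walk is transient, the Green metric is $d_\mu(g,h)=-\log\mathbb{P}(\exists k\ge0:\ gZ_k=h)$. For $\mu$ symmetric, finitely supported with support generating $\Gamma$, one has $d_\mu\in\mathcal{D}_\Gamma$. *)

theory Defs
  imports "HOL-Algebra.Multiplicative_Group" "HOL-Algebra.Generated_Groups" "HOL-Probability.Probability"
begin

section \<open>Word metrics and hyperbolic groups\<close>

definition sym_generating :: "('a, 'b) monoid_scheme \<Rightarrow> 'a set \<Rightarrow> bool" where
  "sym_generating G S \<longleftrightarrow>
     S \<subseteq> carrier G \<and> finite S \<and> (\<forall>s\<in>S. inv\<^bsub>G\<^esub> s \<in> S) \<and> generate G S = carrier G"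

definition word_length :: "('a, 'b) monoid_scheme \<Rightarrow> 'a set \<Rightarrow> 'a \<Rightarrow> nat" where
  "word_length G S g =
     (LEAST n. \<exists>ws. set ws \<subseteq> S \<and> length ws = n \<and> foldr (\<lambda>x y. x \<otimes>\<^bsub>G\<^esub> y) ws \<one>\<^bsub>G\<^esub> = g)"

definition word_metric :: "('a, 'b) monoid_scheme \<Rightarrow> 'a set \<Rightarrow> 'a \<Rightarrow> 'a \<Rightarrow> real" where
  "word_metric G S g h = real (word_length G S (inv\<^bsub>G\<^esub> g \<otimes>\<^bsub>G\<^esub> h))"

definition gromov_product :: "('a \<Rightarrow> 'a \<Rightarrow> real) \<Rightarrow> 'a \<Rightarrow> 'a \<Rightarrow> 'a \<Rightarrow> real" where
  "gromov_product d w x y = (d x w + d w y - d x y) / 2"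

definition gromov_hyperbolic :: "'a set \<Rightarrow> ('a \<Rightarrow> 'a \<Rightarrow> real) \<Rightarrow> bool" where
  "gromov_hyperbolic A d \<longleftrightarrow>
     (\<exists>\<delta>\<ge>0. \<forall>x\<in>A. \<forall>y\<in>A. \<forall>z\<in>A. \<forall>w\<in>A.
        gromov_product d w x z \<ge> min (gromov_product d w x y) (gromov_product d w y z) - \<delta>)"

definition hyperbolic_group :: "('a, 'b) monoid_scheme \<Rightarrow> bool" where
  "hyperbolic_group G \<longleftrightarrow>
     group G \<and> (\<exists>S. sym_generating G S \<and> gromov_hyperbolic (carrier G) (word_metric G S))"

text \<open>Finite groups are virtually cyclic: the trivial subgroup is cyclic.\<close>

definition virtually_cyclic :: "('a, 'b) monoid_scheme \<Rightarrow> bool" where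
  "virtually_cyclic G \<longleftrightarrow> (\<exists>g\<in>carrier G. finite (rcosets\<^bsub>G\<^esub> (generate G {g})))"

definition nonelementary_hyperbolic_group :: "('a, 'b) monoid_scheme \<Rightarrow> bool" where
  "nonelementary_hyperbolic_group G \<longleftrightarrow> hyperbolic_group G \<and> \<not> virtually_cyclic G"

section \<open>The space of hyperbolic metrics up to rough similarity\<close>

definition quasi_isometric_id ::
    "'a set \<Rightarrow> ('a \<Rightarrow> 'a \<Rightarrow> real) \<Rightarrow> ('a \<Rightarrow> 'a \<Rightarrow> real) \<Rightarrow> bool" where
  "quasi_isometric_id A d d' \<longleftrightarrow>
     (\<exists>a\<ge>1. \<exists>b\<ge>0. \<forall>x\<in>A. \<forall>y\<in>A. d' x y / a - b \<le> d x y \<and> d x y \<le> a * d' x y + b)"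

definition hyp_metrics :: "('a, 'b) monoid_scheme \<Rightarrow> ('a \<Rightarrow> 'a \<Rightarrow> real) set" where
  "hyp_metrics G = {d.
     (\<forall>x\<in>carrier G. \<forall>y\<in>carrier G. 0 \<le> d x y) \<and>
     (\<forall>x\<in>carrier G. d x x = 0) \<and>
     (\<forall>x\<in>carrier G. \<forall>y\<in>carrier G. d x y = d y x) \<and>
     (\<forall>x\<in>carrier G. \<forall>y\<in>carrier G. \<forall>z\<in>carrier G. d x z \<le> d x y + d y z) \<and>
     (\<forall>g\<in>carrier G. \<forall>x\<in>carrier G. \<forall>y\<in>carrier G. d (g \<otimes>\<^bsub>G\<^esub> x) (g \<otimes>\<^bsub>G\<^esub> y) = d x y) \<and>
     gromov_hyperbolic (carrier G) d \<and>
     (\<exists>S. sym_generating G S \<and> quasi_isometric_id (carrier G) d (word_metric G S))}"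

text \<open>
  Elements of \<^term>\<open>hyp_metrics G\<close> are constrained on \<^term>\<open>carrier G\<close> only, and
  functions that agree there are roughly similar.
\<close>

definition rough_sim_rel ::
    "('a, 'b) monoid_scheme \<Rightarrow> (('a \<Rightarrow> 'a \<Rightarrow> real) \<times> ('a \<Rightarrow> 'a \<Rightarrow> real)) set" where
  "rough_sim_rel G = {(d, d'). d \<in> hyp_metrics G \<and> d' \<in> hyp_metrics G \<and>
     (\<exists>c>0. bdd_above ((\<lambda>g. \<bar>d \<one>\<^bsub>G\<^esub> g - c * d' \<one>\<^bsub>G\<^esub> g\<bar>) ` carrier G))}"

definition metric_classes :: "('a, 'b) monoid_scheme \<Rightarrow> ('a \<Rightarrow> 'a \<Rightarrow> real) set set" where
  "metric_classes G = hyp_metrics G // rough_sim_rel G"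

text \<open>
  This is empty, hence not an element of \<^term>\<open>metric_classes G\<close>, if \<open>d\<close> is not in
  \<^term>\<open>hyp_metrics G\<close>.
\<close>

definition metric_class ::
    "('a, 'b) monoid_scheme \<Rightarrow> ('a \<Rightarrow> 'a \<Rightarrow> real) \<Rightarrow> ('a \<Rightarrow> 'a \<Rightarrow> real) set" where
  "metric_class G d = rough_sim_rel G `` {d}"

definition conj_class :: "('a, 'b) monoid_scheme \<Rightarrow> 'a \<Rightarrow> 'a set" where
  "conj_class G g = {x \<otimes>\<^bsub>G\<^esub> g \<otimes>\<^bsub>G\<^esub> inv\<^bsub>G\<^esub> x | x. x \<in> carrier G}"

text \<open>The order \<^term>\<open>group.ord G g\<close> is \<open>0\<close> iff \<open>g\<close> has infinite order.\<close>

definition nontorsion_classes :: "('a, 'b) monoid_scheme \<Rightarrow> 'a set set" where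
  "nontorsion_classes G = conj_class G ` {g \<in> carrier G. group.ord G g = 0}"

definition stable_length ::
    "('a, 'b) monoid_scheme \<Rightarrow> ('a \<Rightarrow> 'a \<Rightarrow> real) \<Rightarrow> 'a \<Rightarrow> real" where
  "stable_length G d g = lim (\<lambda>k. d \<one>\<^bsub>G\<^esub> (g [^]\<^bsub>G\<^esub> k) / real k)"

text \<open>
  For \<open>d\<close> in \<^term>\<open>hyp_metrics G\<close> the stable length is invariant under conjugation, so the
  choice of a representative is immaterial. The same holds below for \<open>Delta\<close>: replacing \<open>d\<close>
  by a roughly similar metric multiplies its stable length by a constant, which cancels in
  \<open>Dil d1 d2 * Dil d2 d1\<close>.
\<close>

definition class_stable_length ::
    "('a, 'b) monoid_scheme \<Rightarrow> ('a \<Rightarrow> 'a \<Rightarrow> real) \<Rightarrow> 'a set \<Rightarrow> real" where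
  "class_stable_length G d c = stable_length G d (SOME g. g \<in> c)"

text \<open>
  Any two elements of \<^term>\<open>hyp_metrics G\<close> are quasi-isometric, so the set of ratios is bounded.
\<close>

definition Dil ::
    "('a, 'b) monoid_scheme \<Rightarrow> ('a \<Rightarrow> 'a \<Rightarrow> real) \<Rightarrow> ('a \<Rightarrow> 'a \<Rightarrow> real) \<Rightarrow> real" where
  "Dil G d1 d2 =
     (SUP c\<in>nontorsion_classes G. class_stable_length G d1 c / class_stable_length G d2 c)"

definition Delta ::
    "('a, 'b) monoid_scheme \<Rightarrow> ('a \<Rightarrow> 'a \<Rightarrow> real) set \<Rightarrow> ('a \<Rightarrow> 'a \<Rightarrow> real) set \<Rightarrow> real" where
  "Delta G D1 D2 =
     (let d1 = (SOME d. d \<in> D1); d2 = (SOME d. d \<in> D2) in ln (Dil G d1 d2 * Dil G d2 d1))"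

section \<open>Random walks and Green metrics\<close>

primrec walk :: "('a, 'b) monoid_scheme \<Rightarrow> (nat \<Rightarrow> 'a) \<Rightarrow> nat \<Rightarrow> 'a" where
  "walk G \<omega> 0 = \<one>\<^bsub>G\<^esub>"
| "walk G \<omega> (Suc k) = walk G \<omega> k \<otimes>\<^bsub>G\<^esub> \<omega> k"

text \<open>
  The condition \<open>\<omega> i \<in> set_pmf \<mu>\<close> for all \<open>i\<close> has probability one. It is included because
  \<open>\<lambda>\<omega>. walk G \<omega> k\<close> need not be measurable for the product of the discrete sigma-algebras if the
  type \<open>'a\<close> is uncountable, whereas on the countable set \<^term>\<open>set_pmf \<mu>\<close> there is no such problem.
\<close>

definition hitting_prob :: "('a, 'b) monoid_scheme \<Rightarrow> 'a pmf \<Rightarrow> 'a \<Rightarrow> 'a \<Rightarrow> real" where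
  "hitting_prob G \<mu> g h =
     measure (\<Pi>\<^sub>M i\<in>(UNIV :: nat set). measure_pmf \<mu>)
       {\<omega>. (\<forall>i. \<omega> i \<in> set_pmf \<mu>) \<and> (\<exists>k. g \<otimes>\<^bsub>G\<^esub> walk G \<omega> k = h)}"

text \<open>
  The hitting probabilities are positive when the support of \<open>\<mu>\<close> generates \<open>G\<close> as a semigroup,
  so that the convention \<^prop>\<open>ln 0 = (0::real)\<close> plays no role then.
\<close>

definition green_metric :: "('a, 'b) monoid_scheme \<Rightarrow> 'a pmf \<Rightarrow> 'a \<Rightarrow> 'a \<Rightarrow> real" where
  "green_metric G \<mu> g h = - ln (hitting_prob G \<mu> g h)"

definition annulus ::
    "('a, 'b) monoid_scheme \<Rightarrow> ('a \<Rightarrow> 'a \<Rightarrow> real) \<Rightarrow> real \<Rightarrow> real \<Rightarrow> 'a set" where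
  "annulus G d \<delta> l = {g \<in> carrier G. l - \<delta> < d \<one>\<^bsub>G\<^esub> g \<and> d \<one>\<^bsub>G\<^esub> g \<le> l}"

end

theory Submission
  imports Defs "HOL-Real_Asymp.Real_Asymp"
begin

text \<open>
  Let \<open>v\<close> be the exponential growth rate of the balls of \<open>d\<close>; it is positive since a group that
  is not virtually cyclic contains a free semigroup. For \<open>v / 2 < \<alpha> < v\<close> and large \<open>l\<close> the step
  operator of \<open>\<mu>\<^sub>l\<close> contracts \<open>exp (- \<alpha> * d x z)\<close> by the factor \<open>1 / 2\<close>: the annulus has about
  \<open>exp (v * l)\<close> elements, of which only \<open>exp (v * (l - j))\<close> have Gromov product at least \<open>j\<close> with
  a given element. Hence the Green function is at most \<open>2 * exp (- \<alpha> * d x z)\<close>, so the Green metric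
  is at least \<open>\<alpha> * d - ln 2\<close>. Conversely an element is, up to a bounded factor, a product of about
  \<open>d o g / l\<close> elements of the annulus, so that the Green metric is at most \<open>\<beta> * d + C\<close> where
  \<open>\<beta>\<close> is about \<open>ln (card S\<^sub>l) / l\<close>, which tends to \<open>v\<close>. Comparing stable lengths,
  \<open>\<Delta>\<close> is at most \<open>ln (\<beta> / \<alpha>)\<close>.

  The Green metric is hyperbolic by Ancona's inequality: the Green function is multiplicative up to
  a constant along geodesics of \<open>d\<close>. A path that avoids a ball of radius \<open>r\<close> around a point of a
  geodesic has length exponential in \<open>r\<close>, hence a weight that is doubly exponentially small. With radii
  logarithmic in the distance to the intermediate point one can halve this distance repeatedly, at
  the price of a summable error.
\<close>

section \<open>Hyperbolic pseudometrics\<close>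

text \<open>The bounds on \<alpha> come from counting by Gromov products. Up to the factor exp (-
  \<alpha> * (l + d o g)), the elements of the annulus with product about j with g contribute exp (2
  * \<alpha> * j + v * (l - j)). If 2 * \<alpha> > v, the terms with j near l dominate and leave exp
  (\<alpha> * l), which for \<alpha> < v is small against the exp (v * l) elements of the annulus.
  Growth is needed only up to an arbitrarily small loss in the exponent: v is an infimum of rates,
  so neither a limit nor a Patterson-Sullivan measure is used. The contraction also takes over the
  work of stopping times: it makes every subharmonic function below a multiple of exp (- \<alpha> *
  d x z) nonpositive, and this maximum principle yields domination by superharmonic functions and
  the formula for hitting probabilities. The obstacle throughout is that d is a pseudometric without
  geodesics. Points on geodesics are therefore replaced by functions, or by group elements found on
  word geodesics, at the price of a bounded error.\<close>

locale hyp_space =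
  fixes X :: "'a set" and d :: "'a \<Rightarrow> 'a \<Rightarrow> real" and \<eta> :: real
  assumes d_nonneg: "x \<in> X \<Longrightarrow> y \<in> X \<Longrightarrow> 0 \<le> d x y"
    and d_refl: "x \<in> X \<Longrightarrow> d x x = 0"
    and d_sym: "x \<in> X \<Longrightarrow> y \<in> X \<Longrightarrow> d x y = d y x"
    and d_tri: "x \<in> X \<Longrightarrow> y \<in> X \<Longrightarrow> z \<in> X \<Longrightarrow> d x z \<le> d x y + d y z"
    and eta_nonneg: "0 \<le> \<eta>"
    and gp_hyp: "x \<in> X \<Longrightarrow> y \<in> X \<Longrightarrow> z \<in> X \<Longrightarrow> w \<in> X \<Longrightarrow>
      min (gromov_product d w x y) (gromov_product d w y z) - \<eta> \<le> gromov_product d w x z"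
begin

abbreviation gp where "gp \<equiv> gromov_product d"

lemma gp_cases:
  assumes "x \<in> X" "y \<in> X" "z \<in> X" "w \<in> X"
  shows "gp w x y \<le> gp w x z + \<eta> \<or> gp w y z \<le> gp w x z + \<eta>"
  using gp_hyp[OF assms] by linarith

lemma gp_sym: "x \<in> X \<Longrightarrow> y \<in> X \<Longrightarrow> w \<in> X \<Longrightarrow> gp w x y = gp w y x"
  unfolding gromov_product_def by (simp add: d_sym)

lemma gp_nonneg: "x \<in> X \<Longrightarrow> y \<in> X \<Longrightarrow> w \<in> X \<Longrightarrow> 0 \<le> gp w x y"
  unfolding gromov_product_def using d_tri[of x w y] by simp

lemma gp_le: "x \<in> X \<Longrightarrow> y \<in> X \<Longrightarrow> w \<in> X \<Longrightarrow> gp w x y \<le> d w x"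
  unfolding gromov_product_def using d_tri[of w x y] d_sym[of w x] by simp

lemma gp_compl: "x \<in> X \<Longrightarrow> y \<in> X \<Longrightarrow> w \<in> X \<Longrightarrow> gp w x y + gp x w y = d w x"
  unfolding gromov_product_def using d_sym[of w x] d_sym[of w y] d_sym[of x y]
  by (simp add: field_simps)

lemma gp_self: "x \<in> X \<Longrightarrow> w \<in> X \<Longrightarrow> gp w x x = d w x"
  unfolding gromov_product_def using d_sym[of w x] d_refl[of x] by simp

section \<open>Virtual points and stability of quasi-geodesics\<close>

lemma four_point:
  assumes "x \<in> X" "y \<in> X" "z \<in> X" "w \<in> X"
  shows "d x z + d y w \<le> max (d x y + d z w) (d y z + d x w) + 2 * \<eta>"
  using gp_cases[OF assms] assms d_sym[of x w] d_sym[of y w] d_sym[of z w]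
  unfolding gromov_product_def max_def by (auto simp: field_simps)

text \<open>A function satisfying this inequality behaves like the distance to an additional point of
  the space. As maxima of such functions are again of this kind, the missing points on geodesics
  can be replaced by the functions \<open>along\<close> below.\<close>

definition virtual :: "('a \<Rightarrow> real) \<Rightarrow> bool" where
  "virtual f \<longleftrightarrow> (\<forall>x\<in>X. \<forall>y\<in>X. \<forall>z\<in>X. d x z + f y \<le> max (d x y + f z) (d y z + f x) + 2 * \<eta>)"

text \<open>In a tree this is the distance from \<open>z\<close> to the point of the segment from
  \<open>u\<close> to \<open>w\<close> at distance \<open>t\<close> from \<open>u\<close>, for
  \<open>t\<close> between 0 and \<open>d u w\<close>.\<close>

definition along :: "'a \<Rightarrow> 'a \<Rightarrow> real \<Rightarrow> 'a \<Rightarrow> real" where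
  "along u w t z = max (d u z - t) (d z w - (d u w - t))"

lemma virtual_along:
  assumes "u \<in> X" "w \<in> X"
  shows "virtual (along u w t)"
  unfolding virtual_def
proof (intro ballI)
  fix x y z assume xyz: "x \<in> X" "y \<in> X" "z \<in> X"
  have a: "d x z + d u y \<le> max (d x y + d u z) (d y z + d u x) + 2 * \<eta>"
    using four_point[of x y z u] d_sym[of u y] d_sym[of u z] d_sym[of u x] xyz assms by simp
  have b: "d x z + d y w \<le> max (d x y + d z w) (d y z + d x w) + 2 * \<eta>"
    using four_point[of x y z w] xyz assms by simp
  show "d x z + along u w t y \<le> max (d x y + along u w t z) (d y z + along u w t x) + 2 * \<eta>"
    using a b unfolding along_def by (simp add: max_def split: if_splits)
qed

text \<open>Bisection: at a midpoint the inequality defining \<open>virtual\<close> bounds the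
  doubled Gromov product \<open>f (x p) + f (x q) - d (x p) (x q)\<close> below by the smaller one
  of the two halves, up to \<open>2 * \<eta>\<close>, and \<open>k\<close> halvings reach single
  steps. Hence a path that keeps \<open>f\<close> above \<open>r\<close> and joins points with small
  doubled product has length exponential in \<open>r\<close>.\<close>

lemma virtual_path:
  assumes "virtual f" "p \<le> q" "q - p \<le> 2 ^ k" "0 \<le> c"
    and "\<And>i. p \<le> i \<Longrightarrow> i \<le> q \<Longrightarrow> x i \<in> X"
    and "\<And>i. p \<le> i \<Longrightarrow> i \<le> q \<Longrightarrow> r \<le> f (x i)"
    and "\<And>i. p \<le> i \<Longrightarrow> i < q \<Longrightarrow> d (x i) (x (Suc i)) \<le> c"
  shows "2 * r - c - 2 * real k * \<eta> \<le> f (x p) + f (x q) - d (x p) (x q)"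
  using assms(2-)
proof (induction k arbitrary: p q)
  case 0
  show ?case
  proof (cases "p = q")
    case True
    then show ?thesis using 0(4)[of p] 0(5)[of p] 0(3) d_refl by simp
  next
    case False
    then have q: "q = Suc p" using 0 by simp
    then show ?thesis using 0(5)[of p] 0(5)[of q] 0(6)[of p] by simp
  qed
next
  case (Suc k)
  define m where "m = (p + q) div 2"
  have m: "p \<le> m" "m \<le> q" "m - p \<le> 2 ^ k" "q - m \<le> 2 ^ k"
    using Suc(2,3) unfolding m_def by auto
  have 1: "2 * r - c - 2 * real k * \<eta> \<le> f (x p) + f (x m) - d (x p) (x m)"
    using Suc.prems m by (intro Suc.IH) auto
  have 2: "2 * r - c - 2 * real k * \<eta> \<le> f (x m) + f (x q) - d (x m) (x q)"
    using Suc.prems m by (intro Suc.IH) auto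
  have X: "x p \<in> X" "x m \<in> X" "x q \<in> X" using Suc.prems m by auto
  have "d (x p) (x q) + f (x m) \<le> max (d (x p) (x m) + f (x q)) (d (x m) (x q) + f (x p)) + 2 * \<eta>"
    using assms(1) X unfolding virtual_def by blast
  then show ?case using 1 2 by (simp add: algebra_simps max_def split: if_splits)
qed

text \<open>If all points \<open>along u w t\<close> are within \<open>D\<close> of the path but one of them is not within \<open>D - 1\<close>, then
  a part of the path of length linear in \<open>D\<close> joins points at distance about \<open>2 * D\<close> on both sides of
  the latter while staying away from it; by \<open>virtual_path\<close> its length is exponential in \<open>D\<close>.\<close>

lemma rough_geodesic_step:
  assumes u: "u \<in> X" and w: "w \<in> X" and c: "0 \<le> c" and "0 < A" "1 \<le> D"
    and x: "\<And>i. i \<le> n \<Longrightarrow> x i \<in> X" "x 0 = u" "x n = w"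
    and step: "\<And>i. i < n \<Longrightarrow> d (x i) (x (Suc i)) \<le> c"
    and qg: "\<And>i j. i \<le> j \<Longrightarrow> j \<le> n \<Longrightarrow> real (j - i) \<le> A * d (x i) (x j) + B"
    and k: "A * (6 * D + 2 * \<eta>) + B \<le> 2 ^ k" "c + 2 * real k * \<eta> + 4 * \<eta> < 2 * (D - 1)"
    and P: "\<And>t. 0 \<le> t \<Longrightarrow> t \<le> d u w \<Longrightarrow> \<exists>i\<le>n. along u w t (x i) \<le> D"
    and t: "0 \<le> t" "t \<le> d u w"
  shows "\<exists>i\<le>n. along u w t (x i) \<le> D - 1"
proof (rule ccontr)
  assume "\<not> ?thesis"
  then have far: "\<And>i. i \<le> n \<Longrightarrow> D - 1 < along u w t (x i)" by (meson not_le)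
  define f where "f = along u w t"
  have virt: "virtual f" unfolding f_def using u w by (rule virtual_along)
  have fu: "f u = t" "f w = d u w - t"
    unfolding f_def along_def using d_refl[OF u] d_refl[OF w] t by auto
  let ?prod = "\<lambda>a b. f a + f b - d a b"
  \<comment> \<open>Hyperbolicity for the doubled Gromov products \<open>?prod\<close> seen from the
    virtual point \<open>f\<close>.\<close>
  have V: "?prod a b \<le> ?prod a c' + 2 * \<eta> \<or> ?prod b c' \<le> ?prod a c' + 2 * \<eta>"
    if "a \<in> X" "b \<in> X" "c' \<in> X" for a b c'
  proof -
    have "d a c' + f b \<le> max (d a b + f c') (d b c' + f a) + 2 * \<eta>"
      using virt that unfolding virtual_def by blast
    then show ?thesis by (auto simp: max_def split: if_splits)
  qed
  \<comment> \<open>\<open>x i\<close> is a path point near position \<open>t - 2 * D\<close>, or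
    the start if there is no such position. In the first case its doubled product with
    \<open>u\<close> is at least \<open>2 * (D - 1)\<close>, so \<open>x i\<close> can stand in for
    \<open>u\<close>. The point \<open>x j\<close> below does the same for \<open>w\<close>.\<close>
  have "\<exists>i\<le>n. d u (x i) \<le> max 0 (t - 2 * D) + D \<and> d (x i) w \<le> d u w - max 0 (t - 2 * D) + D
     \<and> (\<forall>b\<in>X. ?prod u b \<ge> min (?prod (x i) b) (2 * (D - 1)) - 2 * \<eta>)"
  proof (cases "t < 2 * D")
    case True
    have "\<forall>b\<in>X. ?prod u b \<ge> min (?prod (x 0) b) (2 * (D - 1)) - 2 * \<eta>"
      using x eta_nonneg by (auto simp: min_def)
    then show ?thesis using True x d_refl[OF u] \<open>1 \<le> D\<close> by (intro exI[of _ 0]) auto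
  next
    case False
    then obtain i where i: "i \<le> n" "along u w (t - 2 * D) (x i) \<le> D"
      using P[of "t - 2 * D"] t \<open>1 \<le> D\<close> by auto
    have i2: "d u (x i) \<le> t - 2 * D + D" "d (x i) w \<le> d u w - (t - 2 * D) + D"
      using i(2) unfolding along_def by auto
    have "2 * (D - 1) \<le> ?prod u (x i)" using far[OF i(1)] i2 fu unfolding f_def by auto
    then have "\<forall>b\<in>X. ?prod u b \<ge> min (?prod (x i) b) (2 * (D - 1)) - 2 * \<eta>"
      using V[OF u x(1)[OF i(1)]] by (fastforce simp: min_def)
    then show ?thesis using False i i2 by (intro exI[of _ i]) auto
  qed
  then obtain i where i: "i \<le> n" "d u (x i) \<le> max 0 (t - 2 * D) + D"
     "d (x i) w \<le> d u w - max 0 (t - 2 * D) + D"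
     "\<And>b. b \<in> X \<Longrightarrow> ?prod u b \<ge> min (?prod (x i) b) (2 * (D - 1)) - 2 * \<eta>" by blast
  let ?t = "min (d u w) (t + 2 * D)"
  have "\<exists>j\<le>n. d u (x j) \<le> ?t + D \<and> d (x j) w \<le> d u w - ?t + D
     \<and> (\<forall>b\<in>X. ?prod b w \<ge> min (?prod b (x j)) (2 * (D - 1)) - 2 * \<eta>)"
  proof (cases "d u w < t + 2 * D")
    case True
    have "\<forall>b\<in>X. ?prod b w \<ge> min (?prod b (x n)) (2 * (D - 1)) - 2 * \<eta>"
      using x eta_nonneg by (auto simp: min_def)
    then show ?thesis using True x d_refl[OF w] \<open>1 \<le> D\<close> by (intro exI[of _ n]) auto
  next
    case False
    then obtain i where i: "i \<le> n" "along u w (t + 2 * D) (x i) \<le> D"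
      using P[of "t + 2 * D"] t \<open>1 \<le> D\<close> by auto
    have i2: "d u (x i) \<le> t + 2 * D + D" "d (x i) w \<le> d u w - (t + 2 * D) + D"
      using i(2) unfolding along_def by auto
    have "2 * (D - 1) \<le> ?prod (x i) w" using far[OF i(1)] i2 fu unfolding f_def by auto
    then have "\<forall>b\<in>X. ?prod b w \<ge> min (?prod b (x i)) (2 * (D - 1)) - 2 * \<eta>"
      using V[OF _ x(1)[OF i(1)] w] by (fastforce simp: min_def)
    then show ?thesis using False i i2 by (intro exI[of _ i]) auto
  qed
  then obtain j where j: "j \<le> n" "d u (x j) \<le> ?t + D" "d (x j) w \<le> d u w - ?t + D"
     "\<And>b. b \<in> X \<Longrightarrow> ?prod b w \<ge> min (?prod b (x j)) (2 * (D - 1)) - 2 * \<eta>" by blast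
  have X: "x i \<in> X" "x j \<in> X" using x i j by auto
  have "d u w + d (x i) (x j) \<le> max (d u (x i) + d (x j) w) (d u (x j) + d (x i) w) + 2 * \<eta>"
    using four_point[of u "x i" w "x j"] X u w d_sym[of w "x j"] by (simp add: add.commute)
  \<comment> \<open>The positions belonging to \<open>x i\<close> and \<open>x j\<close> are at most
    \<open>4 * D\<close> apart, with errors \<open>D\<close> at both ends; \<open>qg\<close> then
    bounds the number of steps between the two points by \<open>2 ^ k\<close>.\<close>
  then have dist: "d (x i) (x j) \<le> 6 * D + 2 * \<eta>"
    using i(2,3) j(2,3) t \<open>1 \<le> D\<close> by (auto simp: max_def min_def split: if_splits)
  have len: "q - p \<le> 2 ^ k" if "p \<le> q" "q \<le> n" "d (x p) (x q) \<le> 6 * D + 2 * \<eta>" for p q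
  proof -
    have "real (q - p) \<le> A * d (x p) (x q) + B" using that by (intro qg)
    also have "\<dots> \<le> A * (6 * D + 2 * \<eta>) + B" using that \<open>0 < A\<close> by simp
    also have "\<dots> \<le> real (2 ^ k)" using k(1) by simp
    finally show ?thesis by (simp only: of_nat_le_iff)
  qed
  have path: "2 * (D - 1) - c - 2 * real k * \<eta> \<le> ?prod (x p) (x q)"
    if "p \<le> q" "q \<le> n" "d (x p) (x q) \<le> 6 * D + 2 * \<eta>" for p q
  proof (rule virtual_path[OF virt that(1) len[OF that] c])
    show "\<And>i. p \<le> i \<Longrightarrow> i \<le> q \<Longrightarrow> x i \<in> X" using x that by auto
    show "\<And>i. p \<le> i \<Longrightarrow> i \<le> q \<Longrightarrow> D - 1 \<le> f (x i)" using far that less_imp_le unfolding f_def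
      by (meson order_trans)
    show "\<And>i. p \<le> i \<Longrightarrow> i < q \<Longrightarrow> d (x i) (x (Suc i)) \<le> c" using step that by auto
  qed
  have ij: "2 * (D - 1) - c - 2 * real k * \<eta> \<le> ?prod (x i) (x j)"
  proof (cases "i \<le> j")
    case True
    then show ?thesis using path[of i j] i j dist by blast
  next
    case False
    then have "2 * (D - 1) - c - 2 * real k * \<eta> \<le> ?prod (x j) (x i)"
      using path[of j i] i j dist d_sym[OF X] by simp
    then show ?thesis using d_sym[OF X] by simp
  qed
  \<comment> \<open>Seen from a point of the segment, the ends have product 0. Passing to
    \<open>x i\<close> and \<open>x j\<close> loses only \<open>4 * \<eta>\<close>, while the path
    between them forces a larger product.\<close>
  have "?prod u w = 0" using fu by simp
  moreover have "?prod u w \<ge> min (?prod (x i) w) (2 * (D - 1)) - 2 * \<eta>" using i(4)[OF w] .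
  moreover have "?prod (x i) w \<ge> min (?prod (x i) (x j)) (2 * (D - 1)) - 2 * \<eta>" using j(4)[OF X(1)] .
  moreover have "0 \<le> 2 * real k * \<eta>" using eta_nonneg by simp
  ultimately show False using ij k(2) c eta_nonneg by linarith
qed

text \<open>With \<open>k\<close> about \<open>D / (2 * \<eta> + 1)\<close> the loss
  \<open>2 * k * \<eta>\<close> is at most \<open>D\<close>, while \<open>2 ^ k\<close> outgrows
  every linear function of \<open>D\<close>. The radii in Ancona's inequality are chosen by the same
  lemma.\<close>

lemma rough_geodesic_const:
  assumes "0 < A" "0 \<le> c"
  shows "\<exists>D0\<ge>1. \<forall>D\<ge>D0. \<exists>k. A * (6 * D + 2 * \<eta>) + B \<le> 2 ^ k \<and> c + 2 * real k * \<eta> + 4 * \<eta> < 2 * (D - 1)"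
proof -
  define H where "H = 2 * \<eta> + 1"
  have H: "H > 0" unfolding H_def using eta_nonneg by simp
  have "\<forall>\<^sub>F D in at_top. A * (6 * D + 2 * \<eta>) + B \<le> 2 powr (D / H - 1)"
    using H assms by real_asymp
  moreover have "\<forall>\<^sub>F D in at_top. c + 4 * \<eta> + 2 < D" by (rule eventually_gt_at_top)
  ultimately have "\<forall>\<^sub>F D in at_top. A * (6 * D + 2 * \<eta>) + B \<le> 2 powr (D / H - 1) \<and> c + 4 * \<eta> + 2 < D"
    by (rule eventually_conj)
  then obtain N where N: "\<And>D. D \<ge> N \<Longrightarrow> A * (6 * D + 2 * \<eta>) + B \<le> 2 powr (D / H - 1) \<and> c + 4 * \<eta> + 2 < D"
    by (auto simp: eventually_at_top_linorder)
  show ?thesis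
  proof (intro exI[of _ "max 1 N"] conjI allI impI)
    fix D assume "max 1 N \<le> D"
    then have D: "1 \<le> D" "N \<le> D" by auto
    define k where "k = nat \<lfloor>D / H\<rfloor>"
    have k: "real k \<le> D / H" "D / H - 1 \<le> real k" unfolding k_def using D H by auto
    have "2 powr (D / H - 1) \<le> 2 powr real k" using k by simp
    then have 1: "A * (6 * D + 2 * \<eta>) + B \<le> 2 ^ k" using N[OF D(2)] by (simp add: powr_realpow)
    have "2 * real k * \<eta> \<le> real k * H" unfolding H_def by (simp add: algebra_simps)
    also have "\<dots> \<le> D" using k(1) H by (simp add: field_simps)
    finally show "\<exists>k. A * (6 * D + 2 * \<eta>) + B \<le> 2 ^ k \<and> c + 2 * real k * \<eta> + 4 * \<eta> < 2 * (D - 1)"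
      using 1 N[OF D(2)] by (intro exI[of _ k]) auto
  qed simp
qed

text \<open>The half of the Morse lemma that finds path points near each position of the segment.
  The bound \<open>D0 + m\<close> with \<open>m\<close> at least \<open>d u w\<close> holds
  trivially at the start of the path, and \<open>rough_geodesic_step\<close> lowers it by 1 until
  \<open>D0\<close> is reached, which is independent of the path.\<close>

lemma rough_geodesic:
  assumes "0 < A" "0 \<le> c"
  shows "\<exists>D0\<ge>0. \<forall>u w n x. u \<in> X \<longrightarrow> w \<in> X \<longrightarrow> (\<forall>i\<le>n. x i \<in> X) \<longrightarrow> x 0 = u \<longrightarrow> x n = w \<longrightarrow>
    (\<forall>i<n. d (x i) (x (Suc i)) \<le> c) \<longrightarrow>
    (\<forall>i j. i \<le> j \<longrightarrow> j \<le> n \<longrightarrow> real (j - i) \<le> A * d (x i) (x j) + B) \<longrightarrow>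
    (\<forall>t. 0 \<le> t \<longrightarrow> t \<le> d u w \<longrightarrow> (\<exists>i\<le>n. along u w t (x i) \<le> D0))"
proof -
  obtain D0 where D0: "D0 \<ge> 1" "\<And>D. D \<ge> D0 \<Longrightarrow> \<exists>k. A * (6 * D + 2 * \<eta>) + B \<le> 2 ^ k \<and>
      c + 2 * real k * \<eta> + 4 * \<eta> < 2 * (D - 1)"
    using rough_geodesic_const[OF assms] by blast
  show ?thesis
  proof (intro exI[of _ D0] conjI allI impI)
    fix u w n x t
    assume A: "u \<in> X" "w \<in> X" "\<forall>i\<le>n. x i \<in> X" "x 0 = u" "x n = w" "\<forall>i<n. d (x i) (x (Suc i)) \<le> c"
      "\<forall>i j. i \<le> j \<longrightarrow> j \<le> n \<longrightarrow> real (j - i) \<le> A * d (x i) (x j) + B"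
      and t: "0 \<le> t" "t \<le> d u w"
    have *: "\<forall>t. 0 \<le> t \<longrightarrow> t \<le> d u w \<longrightarrow> (\<exists>i\<le>n. along u w t (x i) \<le> D0)"
      if "\<forall>t. 0 \<le> t \<longrightarrow> t \<le> d u w \<longrightarrow> (\<exists>i\<le>n. along u w t (x i) \<le> D0 + real m)" for m
      using that
    proof (induction m)
      case (Suc m)
      obtain k where k: "A * (6 * (D0 + real (Suc m)) + 2 * \<eta>) + B \<le> 2 ^ k"
        "c + 2 * real k * \<eta> + 4 * \<eta> < 2 * (D0 + real (Suc m) - 1)" using D0(2)[of "D0 + real (Suc m)"] by auto
      have "\<forall>t. 0 \<le> t \<longrightarrow> t \<le> d u w \<longrightarrow> (\<exists>i\<le>n. along u w t (x i) \<le> D0 + real (Suc m) - 1)"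
        using rough_geodesic_step[OF A(1,2) assms(2,1), where D = "D0 + real (Suc m)" and n = n and x = x and B = B and k = k]
          D0(1) A k Suc.prems by auto
      then show ?case using Suc.IH by simp
    qed simp
    obtain m :: nat where m: "d u w \<le> real m" using real_arch_simple by blast
    have "\<forall>t. 0 \<le> t \<longrightarrow> t \<le> d u w \<longrightarrow> (\<exists>i\<le>n. along u w t (x i) \<le> D0 + real m)"
    proof (intro allI impI exI[of _ 0] conjI)
      fix t assume "0 \<le> t" "t \<le> d u w"
      then show "along u w t (x 0) \<le> D0 + real m"
        unfolding along_def using A m D0(1) d_refl by auto
    qed simp
    then show "\<exists>i\<le>n. along u w t (x i) \<le> D0" using * t by blast
  qed (use D0 in auto)
qed

end

section \<open>Word metrics and rough geodesics\<close>

context group begin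

abbreviation wprod :: "'a list \<Rightarrow> 'a" where
  "wprod ws \<equiv> foldr (\<lambda>x y. x \<otimes> y) ws \<one>"

lemma wprod_closed [simp]: "set ws \<subseteq> carrier G \<Longrightarrow> wprod ws \<in> carrier G"
  by (induction ws) auto

lemma wprod_append: "set us \<subseteq> carrier G \<Longrightarrow> set ws \<subseteq> carrier G \<Longrightarrow> wprod (us @ ws) = wprod us \<otimes> wprod ws"
proof (induction us)
  case (Cons u us)
  then have "u \<in> carrier G" "wprod us \<in> carrier G" "wprod ws \<in> carrier G" by auto
  then show ?case using Cons by (simp add: m_assoc)
qed simp

lemma generate_wprod:
  assumes "S \<subseteq> carrier G" "\<And>s. s \<in> S \<Longrightarrow> inv s \<in> S" "g \<in> generate G S"
  shows "\<exists>ws. set ws \<subseteq> S \<and> wprod ws = g"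
  using assms(3)
proof (induction rule: generate.induct)
  case one
  then show ?case by (intro exI[of _ "[]"]) simp
next
  case (incl s)
  then show ?case using assms by (intro exI[of _ "[s]"]) auto
next
  case (inv s)
  then show ?case using assms by (intro exI[of _ "[inv s]"]) auto
next
  case (eng g h)
  then obtain us ws where "set us \<subseteq> S" "wprod us = g" "set ws \<subseteq> S" "wprod ws = h" by blast
  then show ?case using assms(1) wprod_append[of us ws] by (intro exI[of _ "us @ ws"]) auto
qed

lemma word_length_le: "set ws \<subseteq> S \<Longrightarrow> wprod ws = g \<Longrightarrow> word_length G S g \<le> length ws"
  unfolding word_length_def by (rule Least_le) blast

lemma word_length_word:
  assumes "sym_generating G S" "g \<in> carrier G"
  obtains ws where "set ws \<subseteq> S" "length ws = word_length G S g" "wprod ws = g"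
proof -
  have "\<exists>ws. set ws \<subseteq> S \<and> wprod ws = g"
    using assms unfolding sym_generating_def by (intro generate_wprod) auto
  then have "\<exists>n ws. set ws \<subseteq> S \<and> length ws = n \<and> wprod ws = g" by blast
  from LeastI_ex[OF this] show thesis using that unfolding word_length_def by blast
qed

end

locale hyp_group = group G + hyp_space "carrier G" d \<eta>
  for G :: "('a, 'b) monoid_scheme" (structure) and d :: "'a \<Rightarrow> 'a \<Rightarrow> real" and \<eta> :: real +
  fixes S :: "'a set" and a b :: real
  assumes d_inv: "g \<in> carrier G \<Longrightarrow> x \<in> carrier G \<Longrightarrow> y \<in> carrier G \<Longrightarrow> d (g \<otimes> x) (g \<otimes> y) = d x y"
    and S_gen: "sym_generating G S"
    and a_ge_1: "1 \<le> a" and b_nonneg: "0 \<le> b"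
    and qi_lower: "x \<in> carrier G \<Longrightarrow> y \<in> carrier G \<Longrightarrow> word_metric G S x y / a - b \<le> d x y"
    and qi_upper: "x \<in> carrier G \<Longrightarrow> y \<in> carrier G \<Longrightarrow> d x y \<le> a * word_metric G S x y + b"
begin

abbreviation len :: "'a \<Rightarrow> real" where "len g \<equiv> d \<one> g"

lemma S_carrier: "S \<subseteq> carrier G" and S_finite: "finite S" and S_inv: "s \<in> S \<Longrightarrow> inv s \<in> S"
  and S_generate: "generate G S = carrier G"
  using S_gen unfolding sym_generating_def by auto

lemma d_len: "x \<in> carrier G \<Longrightarrow> y \<in> carrier G \<Longrightarrow> d x y = len (inv x \<otimes> y)"
  using d_inv[of "inv x" x y] by simp

lemma len_inv: "x \<in> carrier G \<Longrightarrow> len (inv x) = len x"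
  using d_len[of x \<one>] d_sym[of \<one> x] by simp

lemma len_one: "len \<one> = 0" by (simp add: d_refl)

lemma len_nonneg: "x \<in> carrier G \<Longrightarrow> 0 \<le> len x" by (simp add: d_nonneg)

lemma d_mult_right: "x \<in> carrier G \<Longrightarrow> y \<in> carrier G \<Longrightarrow> d x (x \<otimes> y) = len y"
  using d_inv[of x \<one> y] by simp

lemma len_mult: "x \<in> carrier G \<Longrightarrow> y \<in> carrier G \<Longrightarrow> len (x \<otimes> y) \<le> len x + len y"
  using d_tri[of \<one> x "x \<otimes> y"] d_mult_right[of x y] by simp

lemma gp_translate:
  "g \<in> carrier G \<Longrightarrow> x \<in> carrier G \<Longrightarrow> y \<in> carrier G \<Longrightarrow> w \<in> carrier G \<Longrightarrow>
    gp (g \<otimes> w) (g \<otimes> x) (g \<otimes> y) = gp w x y"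
  unfolding gromov_product_def by (simp add: d_inv)

lemma len_gen: "s \<in> S \<Longrightarrow> len s \<le> a + b"
proof -
  assume s: "s \<in> S"
  then have sc: "s \<in> carrier G" using S_carrier by auto
  have "word_length G S s \<le> length [s]" using s sc by (intro word_length_le) auto
  then have "word_metric G S \<one> s \<le> 1" unfolding word_metric_def using sc by simp
  then have "a * word_metric G S \<one> s \<le> a * 1" using a_ge_1 by (intro mult_left_mono) auto
  then show "len s \<le> a + b" using qi_upper[of \<one> s] sc by simp
qed

text \<open>The path runs through the prefixes of a shortest word. Replacing the part between two
  prefixes by a shortest word for their quotient again spells \<open>g\<close>, so minimality bounds
  \<open>j - i\<close> by the word metric and hence in terms of \<open>d\<close>.\<close>

lemma word_path:
  assumes "g \<in> carrier G"
  shows "\<exists>n x. (\<forall>i. x i \<in> carrier G) \<and> x 0 = \<one> \<and> x n = g \<and> (\<forall>i<n. d (x i) (x (Suc i)) \<le> a + b) \<and>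
    (\<forall>i j. i \<le> j \<longrightarrow> j \<le> n \<longrightarrow> real (j - i) \<le> a * d (x i) (x j) + a * b)"
proof -
  obtain ws where ws: "set ws \<subseteq> S" "length ws = word_length G S g" "wprod ws = g"
    using word_length_word[OF S_gen assms] by blast
  define x where "x i = wprod (take i ws)" for i
  have sub: "set (take i ws) \<subseteq> carrier G" "set (drop i ws) \<subseteq> carrier G" for i
    using ws(1) S_carrier set_take_subset[of i ws] set_drop_subset[of i ws] by auto
  have xc: "x i \<in> carrier G" for i unfolding x_def using sub by simp
  have step: "d (x i) (x (Suc i)) \<le> a + b" if "i < length ws" for i
  proof -
    have s: "ws ! i \<in> S" using that ws(1) by auto
    then have "ws ! i \<in> carrier G" using S_carrier by auto
    then have "x (Suc i) = x i \<otimes> ws ! i"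
      using that wprod_append[of "take i ws" "[ws ! i]"] sub[of i] unfolding x_def
      by (simp add: take_Suc_conv_app_nth)
    then show ?thesis using d_mult_right[OF xc, of "ws ! i"] len_gen[OF s] \<open>ws ! i \<in> carrier G\<close> by simp
  qed
  have qg: "real (j - i) \<le> a * d (x i) (x j) + a * b" if "i \<le> j" "j \<le> length ws" for i j
  proof -
    have c: "inv (x i) \<otimes> x j \<in> carrier G" using xc by simp
    obtain vs where vs: "set vs \<subseteq> S" "length vs = word_length G S (inv (x i) \<otimes> x j)"
      "wprod vs = inv (x i) \<otimes> x j"
      using word_length_word[OF S_gen c] by blast
    have vsc: "set vs \<subseteq> carrier G" using vs S_carrier by auto
    have "wprod (take i ws @ vs @ drop j ws) = x i \<otimes> (inv (x i) \<otimes> x j \<otimes> wprod (drop j ws))"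
      using sub vsc vs(3) by (simp add: wprod_append x_def del: foldr_append)
    also have "\<dots> = x j \<otimes> wprod (drop j ws)"
      using xc sub by (simp add: m_assoc[symmetric])
    also have "\<dots> = g" using wprod_append[of "take j ws" "drop j ws"] sub ws(3) unfolding x_def by simp
    finally have "word_length G S g \<le> length (take i ws @ vs @ drop j ws)"
      using vs(1) ws(1) set_take_subset[of i ws] set_drop_subset[of j ws] by (intro word_length_le) auto
    then have "j - i \<le> length vs" using that ws(2) by simp
    then have "real (j - i) \<le> word_metric G S (x i) (x j)" unfolding word_metric_def vs(2)[symmetric] by simp
    moreover have "word_metric G S (x i) (x j) \<le> a * d (x i) (x j) + a * b"
      using qi_lower[OF xc xc, of i j] a_ge_1 by (simp add: field_simps)
    ultimately show ?thesis by simp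
  qed
  show ?thesis
    using xc step qg ws(3) by (intro exI[of _ "length ws"] exI[of _ x]) (auto simp: x_def)
qed

lemma finite_ball: "finite {g \<in> carrier G. len g \<le> r}"
proof (rule finite_subset)
  show "{g \<in> carrier G. len g \<le> r} \<subseteq> wprod ` {ws. set ws \<subseteq> S \<and> length ws \<le> nat \<lfloor>a * (r + b)\<rfloor>}"
  proof
    fix g assume g: "g \<in> {g \<in> carrier G. len g \<le> r}"
    then obtain ws where ws: "set ws \<subseteq> S" "length ws = word_length G S g" "wprod ws = g"
      using word_length_word[OF S_gen, of g] by blast
    have "real (length ws) = word_metric G S \<one> g" unfolding word_metric_def using g ws by simp
    also have "\<dots> \<le> a * (len g + b)" using qi_lower[of \<one> g] g a_ge_1 by (simp add: field_simps)
    also have "\<dots> \<le> a * (r + b)" using g a_ge_1 by simp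
    finally have "length ws \<le> nat \<lfloor>a * (r + b)\<rfloor>" by linarith
    then show "g \<in> wprod ` {ws. set ws \<subseteq> S \<and> length ws \<le> nat \<lfloor>a * (r + b)\<rfloor>}" using ws by blast
  qed
  show "finite (wprod ` {ws. set ws \<subseteq> S \<and> length ws \<le> nat \<lfloor>a * (r + b)\<rfloor>})"
    using S_finite by (intro finite_imageI finite_lists_length_le)
qed

text \<open>A word geodesic from \<open>\<one>\<close> is a quasi-geodesic of \<open>d\<close>, and
  \<open>rough_geodesic\<close> finds one of its points near every position; left translation treats
  other starting points.\<close>

lemma rough_geodesic_exists:
  "\<exists>D0\<ge>0. \<forall>x\<in>carrier G. \<forall>y\<in>carrier G. \<forall>t. 0 \<le> t \<longrightarrow> t \<le> d x y \<longrightarrow>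
    (\<exists>p\<in>carrier G. d x p \<le> t + D0 \<and> d p y \<le> d x y - t + D0)"
proof -
  obtain D0 where D0: "D0 \<ge> 0" "\<forall>u w n x. u \<in> carrier G \<longrightarrow> w \<in> carrier G \<longrightarrow> (\<forall>i\<le>n. x i \<in> carrier G) \<longrightarrow>
    x 0 = u \<longrightarrow> x n = w \<longrightarrow> (\<forall>i<n. d (x i) (x (Suc i)) \<le> a + b) \<longrightarrow>
    (\<forall>i j. i \<le> j \<longrightarrow> j \<le> n \<longrightarrow> real (j - i) \<le> a * d (x i) (x j) + a * b) \<longrightarrow>
    (\<forall>t. 0 \<le> t \<longrightarrow> t \<le> d u w \<longrightarrow> (\<exists>i\<le>n. along u w t (x i) \<le> D0))"
    using rough_geodesic[of a "a + b" "a * b"] a_ge_1 b_nonneg by auto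
  have 1: "\<exists>p\<in>carrier G. d \<one> p \<le> t + D0 \<and> d p g \<le> d \<one> g - t + D0"
    if g: "g \<in> carrier G" and t: "0 \<le> t" "t \<le> d \<one> g" for g t
  proof -
    obtain n x where x: "\<forall>i. x i \<in> carrier G" "x 0 = \<one>" "x n = g" "\<forall>i<n. d (x i) (x (Suc i)) \<le> a + b"
      "\<forall>i j. i \<le> j \<longrightarrow> j \<le> n \<longrightarrow> real (j - i) \<le> a * d (x i) (x j) + a * b"
      using word_path[OF g] by blast
    then obtain i where i: "i \<le> n" "along \<one> g t (x i) \<le> D0"
      using D0(2)[rule_format, of \<one> g n x t] g t by auto
    then show ?thesis using x(1) unfolding along_def by (intro bexI[of _ "x i"]) auto
  qed
  show ?thesis
  proof (intro exI[of _ D0] conjI ballI allI impI)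
    fix x y t assume xy: "x \<in> carrier G" "y \<in> carrier G" and t: "0 \<le> t" "t \<le> d x y"
    then obtain p where p: "p \<in> carrier G" "d \<one> p \<le> t + D0" "d p (inv x \<otimes> y) \<le> d x y - t + D0"
      using 1[of "inv x \<otimes> y" t] d_len[of x y] by auto
    have "d (x \<otimes> p) y = d p (inv x \<otimes> y)"
      using d_inv[of x p "inv x \<otimes> y"] p xy by (simp add: m_assoc[symmetric])
    then show "\<exists>p\<in>carrier G. d x p \<le> t + D0 \<and> d p y \<le> d x y - t + D0"
      using p xy d_mult_right[of x p] by (intro bexI[of _ "x \<otimes> p"]) auto
  qed (use D0 in auto)
qed

text \<open>The additive error of rough geodesics, fixed once so that later constants, among them
  the width of the annulus, can refer to it.\<close>

definition rg :: real where
  "rg = (SOME D0. D0 \<ge> 0 \<and> (\<forall>x\<in>carrier G. \<forall>y\<in>carrier G. \<forall>t. 0 \<le> t \<longrightarrow> t \<le> d x y \<longrightarrow>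
    (\<exists>p\<in>carrier G. d x p \<le> t + D0 \<and> d p y \<le> d x y - t + D0)))"

lemma rg_nonneg: "0 \<le> rg"
  and rg_point: "x \<in> carrier G \<Longrightarrow> y \<in> carrier G \<Longrightarrow> 0 \<le> t \<Longrightarrow> t \<le> d x y \<Longrightarrow>
    \<exists>p\<in>carrier G. d x p \<le> t + rg \<and> d p y \<le> d x y - t + rg"
  using someI_ex[OF rough_geodesic_exists] unfolding rg_def[symmetric] by auto

end

lemma hyp_group_exists:
  assumes "group G" "d \<in> hyp_metrics G"
  shows "\<exists>\<eta> S a b. hyp_group G d \<eta> S a b"
proof -
  obtain \<eta> where \<eta>: "\<eta> \<ge> 0" "\<forall>x\<in>carrier G. \<forall>y\<in>carrier G. \<forall>z\<in>carrier G. \<forall>w\<in>carrier G.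
        gromov_product d w x z \<ge> min (gromov_product d w x y) (gromov_product d w y z) - \<eta>"
    using assms(2) unfolding hyp_metrics_def gromov_hyperbolic_def by blast
  obtain S where S: "sym_generating G S" "quasi_isometric_id (carrier G) d (word_metric G S)"
    using assms(2) unfolding hyp_metrics_def by blast
  then obtain a b where "a \<ge> 1" "b \<ge> 0" "\<forall>x\<in>carrier G. \<forall>y\<in>carrier G.
    word_metric G S x y / a - b \<le> d x y \<and> d x y \<le> a * word_metric G S x y + b"
    unfolding quasi_isometric_id_def by blast
  then have "hyp_group G d \<eta> S a b"
    using assms \<eta> S(1) unfolding hyp_metrics_def
    by (intro hyp_group.intro hyp_space.intro hyp_group_axioms.intro) auto
  then show ?thesis by blast
qed

section \<open>Loxodromic elements and free semigroups\<close>

lemma (in group) infinite_carrier: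
  assumes "\<not> virtually_cyclic G"
  shows "infinite (carrier G)"
proof
  assume fin: "finite (carrier G)"
  have "rcosets (generate G {\<one>}) \<subseteq> (\<lambda>y. generate G {\<one>} #> y) ` carrier G" unfolding RCOSETS_def by auto
  then have "finite (rcosets (generate G {\<one>}))" using fin finite_subset by blast
  then show False using assms unfolding virtually_cyclic_def by blast
qed

context hyp_group begin

section \<open>Ping-pong and free semigroups\<close>

lemma len_mult_eq:
  "x \<in> carrier G \<Longrightarrow> y \<in> carrier G \<Longrightarrow> len (x \<otimes> y) = len x + len y - 2 * gp \<one> (inv x) y"
  using d_len[of "inv x" y] d_sym[of \<one> "inv x"] len_inv[of x] by (simp add: gromov_product_def field_simps)

text \<open>Translation by \<open>x\<close> moves the base point from \<open>\<one>\<close> to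
  \<open>x\<close>, and the products based at the two ends of a segment add up to its length. Little
  cancellation in \<open>x \<otimes> y\<close> thus means that the product keeps pointing towards
  \<open>x\<close>.\<close>

lemma gp_prefix:
  assumes "x \<in> carrier G" "y \<in> carrier G"
  shows "gp \<one> x (x \<otimes> y) = len x - gp \<one> (inv x) y"
proof -
  have "gp (x \<otimes> \<one>) (x \<otimes> inv x) (x \<otimes> y) = gp \<one> (inv x) y"
    using gp_translate[of x "inv x" y \<one>] assms by simp
  then have "gp x \<one> (x \<otimes> y) = gp \<one> (inv x) y" using assms by simp
  then show ?thesis using gp_compl[of x "x \<otimes> y" \<one>] assms by simp
qed

lemma pow_eq_wprod: "g \<in> carrier G \<Longrightarrow> g [^] (n::nat) = wprod (replicate n g)"
proof (induction n)
  case (Suc n)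
  then show ?case using nat_pow_Suc2[of g n] by (simp del: nat_pow_Suc)
qed simp

text \<open>Local-to-global principle. By induction \<open>wprod (t # ws)\<close> shares more than
  \<open>K + \<eta>\<close> with its first letter \<open>t\<close>, so its product with
  \<open>inv s\<close> exceeds that of \<open>t\<close> by at most \<open>\<eta>\<close>. The loss
  is \<open>\<eta>\<close> once, not once per letter.\<close>

lemma chain_gp:
  assumes A: "A \<subseteq> carrier G"
    and K: "\<And>s t. s \<in> A \<Longrightarrow> t \<in> A \<Longrightarrow> gp \<one> (inv s) t \<le> K"
    and L: "\<And>s. s \<in> A \<Longrightarrow> 2 * K + 2 * \<eta> < len s"
    and "ws \<noteq> []" "set ws \<subseteq> A" "s \<in> A"
  shows "gp \<one> (inv s) (wprod ws) \<le> K + \<eta>"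
  using assms(4-)
proof (induction ws arbitrary: s)
  case (Cons t ws)
  have c: "s \<in> carrier G" "t \<in> carrier G" "t \<in> A" "set ws \<subseteq> carrier G" using Cons.prems A by auto
  show ?case
  proof (cases "ws = []")
    case True
    then show ?thesis using K[of s t] Cons.prems c eta_nonneg by simp
  next
    case False
    have "gp \<one> (inv t) (wprod ws) \<le> K + \<eta>" using Cons.prems by (intro Cons.IH False) auto
    then have "K + \<eta> < gp \<one> t (t \<otimes> wprod ws)" using gp_prefix[of t "wprod ws"] c L[of t] by simp
    moreover have "gp \<one> t (t \<otimes> wprod ws) = gp \<one> (t \<otimes> wprod ws) t" using c by (intro gp_sym) auto
    moreover have "gp \<one> (inv s) t \<le> K" using K Cons.prems c by simp
    ultimately show ?thesis using gp_cases[of "inv s" "t \<otimes> wprod ws" t \<one>] c by simp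
  qed
qed simp

lemma chain_first:
  assumes A: "A \<subseteq> carrier G"
    and K: "\<And>s t. s \<in> A \<Longrightarrow> t \<in> A \<Longrightarrow> gp \<one> (inv s) t \<le> K"
    and L: "\<And>s. s \<in> A \<Longrightarrow> 2 * K + 2 * \<eta> < len s"
    and ws: "set ws \<subseteq> A" "s \<in> A"
  shows "len s - K - \<eta> \<le> gp \<one> (wprod (s # ws)) s"
proof -
  have c: "s \<in> carrier G" "wprod ws \<in> carrier G" using ws A by auto
  have K0: "0 \<le> K" using K[OF ws(2,2)] gp_nonneg[of "inv s" s \<one>] c by simp
  have *: "gp \<one> (wprod (s # ws)) s = len s - gp \<one> (inv s) (wprod ws)"
    using gp_prefix[of s "wprod ws"] c by (simp add: gp_sym)
  show ?thesis
  proof (cases "ws = []")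
    case True
    have "gp \<one> (inv s) \<one> = 0" unfolding gromov_product_def using c by (simp add: d_refl)
    then show ?thesis using * True K0 eta_nonneg by simp
  next
    case False
    then show ?thesis using * chain_gp[OF A K L False ws] by simp
  qed
qed

text \<open>A word shares more than \<open>K + \<eta>\<close> with its first letter, so equal words
  with different first letters would give \<open>g\<close> and \<open>h\<close> a product above
  \<open>K\<close>; equal first letters cancel. Comparing words of equal length suffices for
  counting.\<close>

lemma free_semigroup:
  assumes ab: "g \<in> carrier G" "h \<in> carrier G"
    and K: "\<And>s t. s \<in> {g, h} \<Longrightarrow> t \<in> {g, h} \<Longrightarrow> gp \<one> (inv s) t \<le> K"
    and L: "\<And>s. s \<in> {g, h} \<Longrightarrow> 2 * K + 2 * \<eta> < len s"
    and gh: "gp \<one> g h < K"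
    and "length us = length ws" "set us \<subseteq> {g, h}" "set ws \<subseteq> {g, h}" "wprod us = wprod ws"
  shows "us = ws"
  using assms(6-)
proof (induction us ws rule: list_induct2)
  case (Cons s us t ws)
  have "set us \<subseteq> carrier G" "set ws \<subseteq> carrier G" using Cons.prems ab by auto
  then have c: "s \<in> carrier G" "t \<in> carrier G" "wprod us \<in> carrier G" "wprod ws \<in> carrier G"
    using Cons.prems ab by auto
  have "s = t"
  proof (rule ccontr)
    assume "s \<noteq> t"
    then have "{s, t} = {g, h}" using Cons.prems by auto
    then have st: "gp \<one> s t < K" using gh gp_sym[of g h \<one>] ab by (auto simp: doubleton_eq_iff)
    have A: "{g, h} \<subseteq> carrier G" using ab by simp
    have *: "K + \<eta> < len s - K - \<eta>" "K + \<eta> < len t - K - \<eta>"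
      using L[of s] L[of t] Cons.prems by auto
    have "len s - K - \<eta> \<le> gp \<one> (wprod (s # us)) s"
      using Cons.prems by (intro chain_first[OF A K L]) auto
    moreover have "len t - K - \<eta> \<le> gp \<one> (wprod (t # ws)) t"
      using Cons.prems by (intro chain_first[OF A K L]) auto
    ultimately show False
      using gp_cases[of s "s \<otimes> wprod us" t \<one>] gp_sym[of s "s \<otimes> wprod us" \<one>] c Cons.prems(3) st *
      by auto
  qed
  then have "wprod us = wprod ws" using Cons.prems c by simp
  then show ?case using Cons \<open>s = t\<close> by auto
qed simp

lemma exp_growth_free_semigroup:
  assumes ab: "g \<in> carrier G" "h \<in> carrier G"
    and K: "\<And>s t. s \<in> {g, h} \<Longrightarrow> t \<in> {g, h} \<Longrightarrow> gp \<one> (inv s) t \<le> K"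
    and L: "\<And>s. s \<in> {g, h} \<Longrightarrow> 2 * K + 2 * \<eta> < len s"
    and gh: "gp \<one> g h < K"
  shows "\<exists>M>0. \<forall>k. 2 ^ k \<le> card {x \<in> carrier G. len x \<le> real k * M}"
proof -
  define M where "M = max (len g) (len h)"
  have K0: "0 \<le> K" using K[of g g] gp_nonneg[of "inv g" g \<one>] ab by simp
  have M: "M > 0" using L[of g] K0 eta_nonneg unfolding M_def by simp
  have "g \<noteq> h" using gh gp_self[of g \<one>] L[of g] K0 eta_nonneg ab by auto
  have "2 ^ k \<le> card {x \<in> carrier G. len x \<le> real k * M}" for k
  proof -
    let ?W = "{ws. set ws \<subseteq> {g, h} \<and> length ws = k}"
    have inj: "inj_on wprod ?W"
      by (rule inj_onI) (use free_semigroup[OF ab K L gh] in auto)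
    have len: "len (wprod ws) \<le> real (length ws) * M" if "set ws \<subseteq> {g, h}" for ws
      using that
    proof (induction ws)
      case (Cons s ws)
      have "set ws \<subseteq> carrier G" using Cons.prems ab by auto
      then have "s \<in> carrier G" "wprod ws \<in> carrier G" using Cons.prems ab by auto
      then have "len (wprod (s # ws)) \<le> len s + len (wprod ws)" using len_mult by simp
      also have "\<dots> \<le> M + real (length ws) * M" using Cons unfolding M_def by (intro add_mono) auto
      finally show ?case by (simp add: algebra_simps)
    qed (simp add: len_one)
    have "wprod ` ?W \<subseteq> {x \<in> carrier G. len x \<le> real k * M}"
    proof
      fix y assume "y \<in> wprod ` ?W"
      then obtain ws where ws: "set ws \<subseteq> {g, h}" "length ws = k" "y = wprod ws" by auto
      then have "set ws \<subseteq> carrier G" using ab by auto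
      then show "y \<in> {x \<in> carrier G. len x \<le> real k * M}" using len[OF ws(1)] ws by simp
    qed
    then have "card (wprod ` ?W) \<le> card {x \<in> carrier G. len x \<le> real k * M}"
      by (intro card_mono finite_ball)
    moreover have "card (wprod ` ?W) = 2 ^ k"
      using card_image[OF inj] card_lists_length_eq[of "{g, h}" k] \<open>g \<noteq> h\<close>
      by (simp add: numeral_2_eq_2)
    ultimately show ?thesis by simp
  qed
  then show ?thesis using M by blast
qed

text \<open>A checkable condition that makes \<open>g\<close> loxodromic: \<open>chain_gp\<close>
  bounds the cancellation between powers, so their lengths grow linearly. The margin
  \<open>4 * \<eta>\<close>, larger than in \<open>chain_gp\<close>, serves to separate positive
  from negative powers in \<open>lox_opposite\<close>.\<close>

definition lox :: "'a \<Rightarrow> real \<Rightarrow> bool" where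
  "lox g K \<longleftrightarrow> g \<in> carrier G \<and> gp \<one> (inv g) g \<le> K \<and> 2 * K + 4 * \<eta> < len g"

lemma lox_inv: "lox g K \<Longrightarrow> lox (inv g) K"
  unfolding lox_def by (auto simp: len_inv gp_sym)

lemma lox_nonneg: "lox g K \<Longrightarrow> 0 \<le> K"
  unfolding lox_def using gp_nonneg[of "inv g" g \<one>] by auto

lemma lox_closed: "lox g K \<Longrightarrow> g \<in> carrier G"
  unfolding lox_def by simp

lemma lox_gp_pow:
  assumes "lox g K"
  shows "gp \<one> (inv g) (g [^] (n::nat)) \<le> K + \<eta>"
proof (cases "n = 0")
  case True
  have "gp \<one> (inv g) \<one> = 0" unfolding gromov_product_def using lox_closed[OF assms] by (simp add: d_refl)
  then show ?thesis using lox_nonneg[OF assms] eta_nonneg True by simp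
next
  case False
  have "gp \<one> (inv g) (wprod (replicate n g)) \<le> K + \<eta>"
    using assms eta_nonneg False unfolding lox_def by (intro chain_gp[where A = "{g}"]) auto
  then show ?thesis using pow_eq_wprod[of g n] assms unfolding lox_def by simp
qed

lemma lox_pow_linear:
  assumes "lox g K"
  shows "\<exists>c>0. \<forall>n. c * real n \<le> len (g [^] (n::nat))"
proof (intro exI conjI allI)
  show pos: "0 < len g - 2 * K - 2 * \<eta>" using assms eta_nonneg unfolding lox_def by simp
  have g: "g \<in> carrier G" using assms by (rule lox_closed)
  fix n :: nat
  show "(len g - 2 * K - 2 * \<eta>) * real n \<le> len (g [^] n)"
  proof (induction n)
    case (Suc n)
    have "len (g [^] Suc n) = len g + len (g [^] n) - 2 * gp \<one> (inv g) (g [^] n)"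
      using nat_pow_Suc2[of g n] len_mult_eq[of g "g [^] n"] g by simp
    then show ?case using Suc lox_gp_pow[OF assms, of n] by (simp add: algebra_simps)
  qed (simp add: len_one)
qed

lemma lox_opposite:
  assumes "lox g K"
  shows "gp \<one> (g [^] (n::nat)) (inv g [^] (m::nat)) \<le> K + 2 * \<eta>"
proof (cases "m = 0")
  case True
  have "gp \<one> (g [^] n) \<one> = 0" unfolding gromov_product_def using lox_closed[OF assms] by (simp add: d_refl)
  then show ?thesis using lox_nonneg[OF assms] eta_nonneg True by simp
next
  case False
  then obtain k where k: "m = Suc k" using not0_implies_Suc by blast
  have g: "g \<in> carrier G" using assms by (rule lox_closed)
  have "gp \<one> (inv g) (inv g \<otimes> inv g [^] k) = len g - gp \<one> g (inv g [^] k)"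
    using gp_prefix[of "inv g" "inv g [^] k"] g by (simp add: len_inv)
  also have "\<dots> \<ge> len g - K - \<eta>" using lox_gp_pow[OF lox_inv[OF assms], of k] g by simp
  finally have "K + 2 * \<eta> < gp \<one> (inv g) (inv g [^] m)"
    using nat_pow_Suc2[of "inv g" k] assms eta_nonneg k g unfolding lox_def by simp
  then show ?thesis
    using gp_cases[of "inv g" "inv g [^] m" "g [^] n" \<one>] gp_sym[of "inv g [^] m" "g [^] n" \<one>]
      lox_gp_pow[OF assms, of n] g by simp
qed

lemma lox_gp_pow_pow:
  assumes "lox g K" "(j::nat) \<le> k"
  shows "len (g [^] j) - K - 2 * \<eta> \<le> gp \<one> (g [^] j) (g [^] k)"
proof -
  have g: "g \<in> carrier G" using assms(1) by (rule lox_closed)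
  have "g [^] k = g [^] j \<otimes> g [^] (k - j)" using assms(2) g by (simp add: nat_pow_mult)
  then have "gp \<one> (g [^] j) (g [^] k) = len (g [^] j) - gp \<one> (inv (g [^] j)) (g [^] (k - j))"
    using gp_prefix[of "g [^] j" "g [^] (k - j)"] g by simp
  moreover have "gp \<one> (inv (g [^] j)) (g [^] (k - j)) \<le> K + 2 * \<eta>"
    using lox_opposite[OF assms(1), of "k - j" j] g by (simp add: nat_pow_inv gp_sym)
  ultimately show ?thesis by simp
qed

text \<open>If the product \<open>T\<close> of \<open>x\<close> with \<open>g [^] k\<close> were
  large, the first power \<open>g [^] j\<close> of length at least \<open>T\<close> would lie near
  the geodesic to \<open>x\<close>. It would then be closer to \<open>x\<close> than the identity by
  about \<open>T\<close>, but at most 1 is allowed.\<close>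

lemma lox_projection:
  assumes "lox g K" "x \<in> carrier G" "\<And>j::nat. len x \<le> d (g [^] j) x + 1"
  shows "gp \<one> x (g [^] (k::nat)) \<le> len g + 2 * K + 6 * \<eta> + 1"
proof -
  have g: "g \<in> carrier G" using assms(1) by (rule lox_closed)
  define T where "T = gp \<one> x (g [^] k)"
  have "T \<le> len (g [^] k)" unfolding T_def using gp_le[of "g [^] k" x \<one>] gp_sym[of x "g [^] k" \<one>] g assms(2) by simp
  define j where "j = (LEAST j::nat. T \<le> len (g [^] j))"
  have j: "T \<le> len (g [^] j)" "j \<le> k"
    unfolding j_def by (rule LeastI, fact) (rule Least_le, fact)
  show ?thesis
  proof (cases "j = 0")
    case True
    then have "T \<le> 0" using j by (simp add: len_one)
    then show ?thesis using lox_nonneg[OF assms(1)] eta_nonneg len_nonneg[OF g] unfolding T_def by simp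
  next
    case False
    then obtain i where i: "j = Suc i" using not0_implies_Suc by blast
    then have "len (g [^] i) < T" using not_less_Least[of i "\<lambda>j. T \<le> len (g [^] j)"] unfolding j_def by simp
    then have le: "len (g [^] j) \<le> T + len g" using len_mult[of "g [^] i" g] g i by simp
    have "T - K - 2 * \<eta> \<le> gp \<one> (g [^] j) (g [^] k)" using lox_gp_pow_pow[OF assms(1) j(2)] j(1) by simp
    then have "T - K - 3 * \<eta> \<le> gp \<one> x (g [^] j)"
      using gp_cases[of x "g [^] k" "g [^] j" \<one>] gp_sym[of "g [^] j" "g [^] k" \<one>] g assms(2)
        lox_nonneg[OF assms(1)] eta_nonneg unfolding T_def by auto
    moreover have "d (g [^] j) x = len x + len (g [^] j) - 2 * gp \<one> x (g [^] j)"
      unfolding gromov_product_def using g assms(2) d_sym[of x \<one>] d_sym[of x "g [^] j"]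
      by (simp add: field_simps)
    ultimately show ?thesis using assms(3)[of j] le unfolding T_def[symmetric] by simp
  qed
qed

section \<open>Existence of loxodromic elements and exponential growth\<close>

lemma unbounded_len:
  assumes "infinite (carrier G)"
  shows "\<exists>x\<in>carrier G. r < len x"
proof (rule ccontr)
  assume "\<not> ?thesis"
  then have "carrier G \<subseteq> {g \<in> carrier G. len g \<le> r}" by (auto simp: not_less)
  then show False using finite_ball[of r] assms finite_subset by blast
qed

text \<open>If no element is loxodromic then \<open>g\<close> and \<open>inv g\<close> always point in the same direction.
  If \<open>g\<close> and \<open>h\<close> are long with small Gromov product, this fails for \<open>inv g \<otimes> h\<close>.\<close>

lemma lox_exists:
  assumes "infinite (carrier G)"
  shows "\<exists>g K. lox g K"
proof (rule ccontr)
  assume "\<not> ?thesis"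
  then have nolox: "(len f - 4 * \<eta>) / 2 \<le> gp \<one> (inv f) f" if "f \<in> carrier G" for f
    using that unfolding lox_def by (fastforce simp: not_less field_simps)
  define n where "n = 2 * rg + 10 * \<eta> + 1"
  \<comment> \<open>\<open>p\<close> is a rough midpoint of a long element \<open>x\<close>.
    Translating \<open>p\<close> to the identity turns the ends \<open>\<one>\<close> and
    \<open>x\<close> into \<open>g\<close> and \<open>h\<close>. Both are long, and their product is
    at most \<open>rg\<close> because \<open>p\<close> lies on a rough geodesic.\<close>
  obtain x where x: "x \<in> carrier G" "2 * n + 2 * rg < len x" using unbounded_len[OF assms] by blast
  then obtain p where p: "p \<in> carrier G" "d \<one> p \<le> len x / 2 + rg" "d p x \<le> len x - len x / 2 + rg"
    using rg_point[of \<one> x "len x / 2"] len_nonneg[of x] by auto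
  define g where "g = inv p"
  define h where "h = inv p \<otimes> x"
  have c: "g \<in> carrier G" "h \<in> carrier G" unfolding g_def h_def using p x by auto
  have lg: "len g = len p" unfolding g_def using p by (simp add: len_inv)
  have lh: "len h = d p x" unfolding h_def using p x by (simp add: d_len[symmetric])
  have "d g h = len x" unfolding g_def h_def using d_inv[of "inv p" \<one> x] p x by simp
  then have gh: "gp \<one> g h \<le> rg" unfolding gromov_product_def using lg lh p d_sym[of g \<one>] c by simp
  have n: "n \<le> len g" "n \<le> len h"
    using lg lh p x d_tri[of \<one> p x] by auto
  \<comment> \<open>By \<open>nolox\<close> the pairs \<open>g\<close>, \<open>inv g\<close> and
    \<open>h\<close>, \<open>inv h\<close> have large products, so the small product of
    \<open>g\<close> and \<open>h\<close> passes to the inverses.\<close>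
  have 1: "gp \<one> (inv g) (inv h) \<le> rg + 2 * \<eta>"
    using gp_cases[of g "inv g" h \<one>] gp_cases[of "inv g" "inv h" h \<one>] gh nolox[OF c(1)] nolox[OF c(2)] n c
      gp_sym[of g "inv g" \<one>] rg_nonneg eta_nonneg unfolding n_def by auto
  define f where "f = inv g \<otimes> h"
  have f: "f \<in> carrier G" "inv f = inv h \<otimes> g" unfolding f_def using c by (auto simp: inv_mult_group)
  have 2: "n - rg \<le> gp \<one> (inv g) f"
    using gp_prefix[of "inv g" h] c gh n unfolding f_def by (simp add: len_inv)
  have 3: "n - rg \<le> gp \<one> (inv h) (inv f)"
    using gp_prefix[of "inv h" g] c gh n gp_sym[of g h \<one>] unfolding f(2) by (simp add: len_inv)
  \<comment> \<open>\<open>f\<close> points like \<open>inv g\<close> and \<open>inv f\<close> like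
    \<open>inv h\<close>, so their product is small although \<open>f\<close> is long, against
    \<open>nolox\<close>.\<close>
  have 4: "gp \<one> f (inv f) \<le> rg + 4 * \<eta>"
    using gp_cases[of "inv g" f "inv h" \<one>] gp_cases[of f "inv f" "inv h" \<one>] 1 2 3 c f(1)
      gp_sym[of "inv f" "inv h" \<one>] rg_nonneg eta_nonneg unfolding n_def by auto
  have "len f = len g + len h - 2 * gp \<one> g h"
    unfolding f_def using len_mult_eq[of "inv g" h] c by (simp add: len_inv)
  then show False using nolox[OF f(1)] 4 gh n gp_sym[of f "inv f" \<one>] f(1) eta_nonneg rg_nonneg
    unfolding n_def by auto
qed

text \<open>Cosets of elements within \<open>R\<close> of \<open>H\<close> have representatives in a
  ball, which is finite, so infinite index gives an element far from \<open>H\<close>. Translating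
  an almost nearest point of \<open>H\<close> to the identity does the rest; the slack 1 avoids
  having to attain the infimum.\<close>

lemma far_from_subgroup:
  assumes H: "subgroup H G" and inf: "infinite (rcosets H)"
  shows "\<exists>x\<in>carrier G. R \<le> len x \<and> (\<forall>h\<in>H. len x \<le> d h x + 1)"
proof -
  have Hc: "h \<in> carrier G" if "h \<in> H" for h by (rule subgroup.mem_carrier[OF H that])
  have "\<exists>x\<in>carrier G. \<forall>h\<in>H. R \<le> d h x"
  proof (rule ccontr)
    assume "\<not> ?thesis"
    then have near: "\<And>x. x \<in> carrier G \<Longrightarrow> \<exists>h\<in>H. d h x < R" by (meson not_le)
    have "rcosets H \<subseteq> (\<lambda>y. H #> y) ` {g \<in> carrier G. len g \<le> R}"
    proof
      fix C assume "C \<in> rcosets H"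
      then obtain x where x: "x \<in> carrier G" "C = H #> x" unfolding RCOSETS_def by blast
      obtain h where h: "h \<in> H" "d h x < R" using near x by blast
      define y where "y = inv h \<otimes> x"
      have y: "y \<in> carrier G" "len y \<le> R" unfolding y_def using h x Hc d_len[of h x] by auto
      have "y \<in> H #> x" unfolding y_def r_coset_def using subgroup.m_inv_closed[OF H h(1)] by blast
      then have "H #> x = H #> y" using repr_independence[OF _ x(1) H] by blast
      then show "C \<in> (\<lambda>y. H #> y) ` {g \<in> carrier G. len g \<le> R}" using x y by blast
    qed
    then show False using inf finite_ball finite_subset by blast
  qed
  then obtain x where x: "x \<in> carrier G" "\<And>h. h \<in> H \<Longrightarrow> R \<le> d h x" by blast
  have one: "\<one> \<in> H" using H subgroup.one_closed by blast
  define m where "m = (INF h\<in>H. d h x)"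
  have bdd: "bdd_below ((\<lambda>h. d h x) ` H)" using Hc x d_nonneg by (intro bdd_belowI[of _ 0]) auto
  have "\<exists>h\<in>H. d h x < m + 1"
    using cInf_lessD[of "(\<lambda>h. d h x) ` H" "m + 1"] one unfolding m_def by auto
  then obtain h where h: "h \<in> H" "d h x < m + 1" by blast
  have *: "d h x \<le> d h' x + 1" if "h' \<in> H" for h'
    using cINF_lower[OF bdd that] h(2) unfolding m_def by simp
  define y where "y = inv h \<otimes> x"
  have y: "y \<in> carrier G" "len y = d h x" unfolding y_def using h x Hc d_len[of h x] by auto
  have "len y \<le> d k y + 1" if "k \<in> H" for k
  proof -
    have "d (h \<otimes> k) x = d k y"
      using d_inv[of h k y] y that h Hc x unfolding y_def by (simp add: m_assoc[symmetric])
    then show ?thesis using *[of "h \<otimes> k"] y(2) subgroup.m_closed[OF H h(1) that] by simp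
  qed
  then show ?thesis using y x(2)[OF h(1)] by (intro bexI[of _ y]) auto
qed

text \<open>The elements \<open>g [^] n\<close> and \<open>x \<otimes> g [^] n\<close> generate a free semigroup for large \<open>n\<close>.\<close>

lemma exp_growth_aux:
  assumes g: "lox g K" and x: "x \<in> carrier G"
    and Q: "K + 3 * \<eta> \<le> Q" "2 * Q + \<eta> < len x"
      "\<And>k::nat. gp \<one> x (g [^] k) \<le> Q" "\<And>k::nat. gp \<one> x (inv g [^] k) \<le> Q"
      "\<And>k::nat. gp \<one> (inv x) (g [^] k) \<le> Q"
  shows "\<exists>M>0. \<forall>k. 2 ^ k \<le> card {x \<in> carrier G. len x \<le> real k * M}"
proof -
  have gc: "g \<in> carrier G" using g by (rule lox_closed)
  have Q0: "0 \<le> Q" using Q(1) lox_nonneg[OF g] eta_nonneg by simp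
  obtain c where c: "c > 0" "\<And>n. c * real n \<le> len (g [^] (n::nat))" using lox_pow_linear[OF g] by blast
  obtain n :: nat where n: "2 * Q + 10 * \<eta> + 10 < c * real n"
    using reals_Archimedean3[OF c(1)] by (metis mult.commute)
  define u where "u = g [^] n"
  define w where "w = x \<otimes> u"
  have uc: "u \<in> carrier G" "w \<in> carrier G" unfolding u_def w_def using gc x by auto
  have iu: "inv u = inv g [^] n" unfolding u_def using gc by (simp add: nat_pow_inv)
  have lu: "2 * Q + 10 * \<eta> + 10 < len u" unfolding u_def using n c(2)[of n] by simp
  have xu: "gp \<one> (inv x) u \<le> Q" unfolding u_def by (rule Q)
  have lw: "2 * Q + 10 * \<eta> + 10 < len w"
    using len_mult_eq[of x u] xu lu Q uc x eta_nonneg unfolding w_def by simp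
  have xw: "Q + \<eta> < gp \<one> w x"
    using gp_prefix[of x u] xu Q(2) uc x gp_sym[of w x \<one>] unfolding w_def by simp
  have p1: "gp \<one> u w \<le> Q + \<eta>"
    using gp_cases[of u w x \<one>] xw Q(3)[of n] gp_sym[of x u \<one>] uc x unfolding u_def[symmetric] by auto
  have p2: "gp \<one> (inv u) u \<le> Q"
    using lox_opposite[OF g, of n n] Q(1) eta_nonneg uc gp_sym[of u "inv u" \<one>]
    unfolding iu[symmetric] u_def[symmetric] by simp
  have p3: "gp \<one> (inv u) w \<le> Q + \<eta>"
    using gp_cases[of "inv u" w x \<one>] xw Q(4)[of n] gp_sym[of x "inv u" \<one>] uc x
    unfolding iu[symmetric] by auto
  have iw: "inv w = inv u \<otimes> inv x" unfolding w_def using uc x by (simp add: inv_mult_group)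
  have p4: "Q + 2 * \<eta> < gp \<one> (inv w) (inv u)"
    using gp_prefix[of "inv u" "inv x"] uc x xu lu gp_sym[of u "inv x" \<one>] gp_sym[of "inv w" "inv u" \<one>] eta_nonneg
    unfolding iw[symmetric] by (simp add: len_inv)
  have p5: "gp \<one> (inv w) u \<le> Q + \<eta>"
    using gp_cases[of u "inv w" "inv u" \<one>] p2 p4 uc eta_nonneg
      gp_sym[of u "inv w" \<one>] gp_sym[of u "inv u" \<one>] by auto
  have p6: "gp \<one> (inv w) w \<le> Q + 2 * \<eta>"
    using gp_cases[of w "inv w" "inv u" \<one>] p3 p4 uc
      gp_sym[of w "inv w" \<one>] gp_sym[of w "inv u" \<one>] by auto
  show ?thesis
  proof (rule exp_growth_free_semigroup[where g = u and h = w and K = "Q + 2 * \<eta> + 1"])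
    show "gp \<one> (inv s) t \<le> Q + 2 * \<eta> + 1" if "s \<in> {u, w}" "t \<in> {u, w}" for s t
      using that p2 p3 p5 p6 eta_nonneg by auto
    show "2 * (Q + 2 * \<eta> + 1) + 2 * \<eta> < len s" if "s \<in> {u, w}" for s
      using that lu lw eta_nonneg by auto
    show "gp \<one> u w < Q + 2 * \<eta> + 1" using p1 eta_nonneg by simp
  qed (use uc in auto)
qed

text \<open>The assumption enters through the infinite index of the subgroup generated by a
  loxodromic \<open>g\<close>. It gives a long \<open>x\<close> for which the identity is almost a
  nearest point of this subgroup, and \<open>lox_projection\<close> bounds the products of
  \<open>x\<close> with all powers of \<open>g\<close> and \<open>inv g\<close>.\<close>

lemma exp_growth:
  assumes "\<not> virtually_cyclic G"
  shows "\<exists>M>0. \<forall>k. 2 ^ k \<le> card {x \<in> carrier G. len x \<le> real k * M}"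
    and "\<exists>g K. lox g K"
proof -
  have "infinite (carrier G)" using assms by (rule infinite_carrier)
  then obtain g K where g: "lox g K" using lox_exists by blast
  then show "\<exists>g K. lox g K" by blast
  have gc: "g \<in> carrier G" using g by (rule lox_closed)
  define H where "H = generate G {g}"
  have H: "subgroup H G" unfolding H_def using gc by (intro generate_is_subgroup) auto
  have gH: "g \<in> H" "inv g \<in> H" unfolding H_def by (auto intro: generate.intros)
  have pH: "h [^] (n::nat) \<in> H" if "h \<in> H" for h n
    using that H by (induction n) (auto intro: subgroup.one_closed subgroup.m_closed)
  define Q where "Q = len g + 2 * K + 6 * \<eta> + 1"
  have "infinite (rcosets H)" using assms gc unfolding virtually_cyclic_def H_def by blast
  then obtain x where x: "x \<in> carrier G" "2 * Q + \<eta> + 1 \<le> len x" "\<And>h. h \<in> H \<Longrightarrow> len x \<le> d h x + 1"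
    using far_from_subgroup[OF H] by blast
  have K: "K + 3 * \<eta> \<le> Q" unfolding Q_def using lox_nonneg[OF g] eta_nonneg len_nonneg[OF gc] by simp
  have q1: "gp \<one> x (g [^] (k::nat)) \<le> Q" for k
    unfolding Q_def using x pH[OF gH(1)] by (intro lox_projection[OF g]) auto
  have q2: "gp \<one> x (inv g [^] (k::nat)) \<le> Q" for k
    using lox_projection[OF lox_inv[OF g] x(1), of k] x(3) pH[OF gH(2)] gc unfolding Q_def by (simp add: len_inv)
  show "\<exists>M>0. \<forall>k. 2 ^ k \<le> card {x \<in> carrier G. len x \<le> real k * M}"
  \<comment> \<open>\<open>inv x\<close> may share a long way with one direction of
    \<open>g\<close>, but by \<open>lox_opposite\<close> not with both. If it does so with the
    positive powers, \<open>inv g\<close> takes the role of \<open>g\<close>.\<close>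
  proof (cases "\<forall>k::nat. gp \<one> (inv x) (g [^] k) \<le> K + 3 * \<eta>")
    case True
    then show ?thesis using x(2) K q1 q2 by (intro exp_growth_aux[OF g x(1) K]) (auto intro: order_trans)
  next
    case False
    then obtain n :: nat where n: "K + 3 * \<eta> < gp \<one> (inv x) (g [^] n)" by (meson not_le)
    have "gp \<one> (inv x) (inv g [^] (k::nat)) \<le> Q" for k
      using gp_cases[of "g [^] n" "inv x" "inv g [^] k" \<one>] gp_sym[of "inv x" "g [^] n" \<one>] n K
        lox_opposite[OF g, of n k] x(1) gc by simp
    then show ?thesis using x(2) K q1 q2 gc
      by (intro exp_growth_aux[OF lox_inv[OF g] x(1) K]) auto
  qed
qed

end

section \<open>Growth and contraction\<close>

lemma geometric_sum_le:
  fixes q :: real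
  assumes "1 < q"
  shows "(\<Sum>j\<le>m. q ^ j) \<le> q / (q - 1) * q ^ m"
proof -
  have "(\<Sum>j\<le>m. q ^ j) = (q ^ Suc m - 1) / (q - 1)"
    using assms by (simp only: lessThan_Suc_atMost[symmetric] geometric_sum)
  also have "\<dots> \<le> q ^ Suc m / (q - 1)" using assms by (intro divide_right_mono) auto
  finally show ?thesis by simp
qed

locale nonelem_hyp_group = hyp_group +
  assumes not_virtually_cyclic: "\<not> virtually_cyclic G"
begin

section \<open>Growth rate of balls and annuli\<close>

definition lball where "lball r = {g \<in> carrier G. len g \<le> r}"

lemma ball_finite: "finite (lball r)"
  unfolding lball_def by (rule finite_ball)

lemma ball_mono: "r \<le> r' \<Longrightarrow> lball r \<subseteq> lball r'"
  unfolding lball_def by auto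

lemma card_ball_mono: "r \<le> r' \<Longrightarrow> card (lball r) \<le> card (lball r')"
  by (intro card_mono ball_finite ball_mono)

lemma one_in_ball: "0 \<le> r \<Longrightarrow> \<one> \<in> lball r"
  unfolding lball_def by (simp add: len_one)

lemma card_ball_pos: "0 \<le> r \<Longrightarrow> 1 \<le> card (lball r)"
  using card_mono[OF ball_finite, of "{\<one>}" r] one_in_ball by auto

abbreviation ann where "ann \<equiv> annulus G d"

lemma ann_carrier: "ann \<delta> l \<subseteq> carrier G" and ann_ball: "ann \<delta> l \<subseteq> lball l"
  unfolding annulus_def lball_def by auto

lemma ann_finite: "finite (ann \<delta> l)"
  by (rule finite_subset[OF ann_ball ball_finite])

lemma ann_inv: "s \<in> ann \<delta> l \<Longrightarrow> inv s \<in> ann \<delta> l"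
  unfolding annulus_def by (simp add: len_inv)

text \<open>\<open>s\<close> is the rough geodesic point at position \<open>l - rg\<close>. Its
  length is at most \<open>l\<close>, and at least \<open>l - 2 * rg\<close> by the triangle
  inequality, so the width \<open>\<delta>\<close> has to exceed \<open>2 * rg\<close>.\<close>

lemma ann_decompose:
  assumes "2 * rg < \<delta>" "rg \<le> l" "g \<in> carrier G" "l - rg \<le> len g"
  shows "\<exists>s\<in>ann \<delta> l. len (inv s \<otimes> g) \<le> len g - (l - 2 * rg)"
proof -
  obtain p where p: "p \<in> carrier G" "len p \<le> l - rg + rg" "d p g \<le> len g - (l - rg) + rg"
    using rg_point[of \<one> g "l - rg"] assms by auto
  have "len g \<le> len p + d p g" using p assms by (intro d_tri) auto
  then have "p \<in> ann \<delta> l" unfolding annulus_def using p assms by simp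
  then show ?thesis using p assms d_len[of p g] by (intro bexI[of _ p]) auto
qed

lemma card_ball_step:
  assumes "2 * rg < \<delta>" "2 * rg \<le> l" "l \<le> r"
  shows "card (lball (r + (l - 2 * rg))) \<le> (card (ann \<delta> l) + 1) * card (lball r)"
proof -
  have "lball (r + (l - 2 * rg)) \<subseteq> (\<lambda>(s, h). s \<otimes> h) ` (ann \<delta> l \<times> lball r) \<union> lball r"
  proof
    fix g assume g: "g \<in> lball (r + (l - 2 * rg))"
    then have gc: "g \<in> carrier G" unfolding lball_def by simp
    show "g \<in> (\<lambda>(s, h). s \<otimes> h) ` (ann \<delta> l \<times> lball r) \<union> lball r"
    proof (cases "g \<in> lball r")
      case False
      then have "l - rg \<le> len g" using gc assms rg_nonneg unfolding lball_def by simp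
      then obtain s where s: "s \<in> ann \<delta> l" "len (inv s \<otimes> g) \<le> len g - (l - 2 * rg)"
        using ann_decompose[of \<delta> l g] assms rg_nonneg gc by auto
      have sc: "s \<in> carrier G" using s ann_carrier by blast
      have "inv s \<otimes> g \<in> lball r" using s(2) g sc gc unfolding lball_def by simp
      moreover have "g = s \<otimes> (inv s \<otimes> g)" using sc gc by (simp add: m_assoc[symmetric])
      ultimately have "g \<in> (\<lambda>(s, h). s \<otimes> h) ` (ann \<delta> l \<times> lball r)"
        using s(1) by (intro image_eqI[of _ _ "(s, inv s \<otimes> g)"]) auto
      then show ?thesis by simp
    qed simp
  qed
  then have "card (lball (r + (l - 2 * rg))) \<le> card ((\<lambda>(s, h). s \<otimes> h) ` (ann \<delta> l \<times> lball r) \<union> lball r)"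
    by (intro card_mono finite_UnI finite_imageI finite_cartesian_product ann_finite ball_finite)
  also have "\<dots> \<le> card ((\<lambda>(s, h). s \<otimes> h) ` (ann \<delta> l \<times> lball r)) + card (lball r)" by (rule card_Un_le)
  also have "\<dots> \<le> card (ann \<delta> l \<times> lball r) + card (lball r)"
    by (intro add_right_mono card_image_le finite_cartesian_product ann_finite ball_finite)
  finally show ?thesis by (simp add: card_cartesian_product)
qed

text \<open>Exponents of upper bounds for the growth. With \<open>v\<close> as their infimum, every
  exponent above \<open>v\<close> bounds the growth of balls, and the lower bound for annuli follows
  since \<open>rate_ann\<close> turns the size of each annulus into a member of
  \<open>rates\<close>.\<close>

definition rates :: "real set" where
  "rates = {u. \<exists>C. \<forall>r\<ge>0. real (card (lball r)) \<le> C * exp (u * r)}"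

definition v :: real where "v = Inf rates"

text \<open>Iteration of \<open>card_ball_step\<close>: enlarging the radius by
  \<open>l - 2 * rg\<close> costs a factor \<open>card (ann \<delta> l) + 1\<close>, where the
  summand 1 counts the elements that already lie in the smaller ball.\<close>

lemma rate_ann:
  assumes "2 * rg < \<delta>" "2 * rg < l"
  shows "ln (real (card (ann \<delta> l)) + 1) / (l - 2 * rg) \<in> rates"
proof -
  define N where "N = real (card (ann \<delta> l)) + 1"
  define m where "m = l - 2 * rg"
  have m: "m > 0" unfolding m_def using assms by simp
  have N: "N \<ge> 1" unfolding N_def by simp
  have pow: "real (card (lball (l + real k * m))) \<le> N ^ k * card (lball l)" for k
  proof (induction k)
    case (Suc k)
    have "card (lball (l + real k * m + (l - 2 * rg))) \<le> (card (ann \<delta> l) + 1) * card (lball (l + real k * m))"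
      using assms m by (intro card_ball_step) auto
    then have "real (card (lball (l + real k * m + (l - 2 * rg)))) \<le> N * real (card (lball (l + real k * m)))"
      unfolding N_def by (metis of_nat_1 of_nat_add of_nat_le_iff of_nat_mult)
    also have "\<dots> \<le> N * (N ^ k * card (lball l))" using Suc N by (intro mult_left_mono) auto
    finally show ?case unfolding m_def by (simp add: algebra_simps)
  qed simp
  have "real (card (lball r)) \<le> (N * card (lball l)) * exp (ln N / m * r)" if "r \<ge> 0" for r
  proof -
    define k where "k = nat \<lceil>r / m\<rceil>"
    have k: "r / m \<le> real k" "real k \<le> r / m + 1" unfolding k_def using that m
      by (auto simp: of_nat_nat)
    have l: "0 \<le> l" using assms rg_nonneg by simp
    have "real (card (lball r)) \<le> real (card (lball (l + real k * m)))"
      using k(1) m l by (intro of_nat_mono card_ball_mono) (simp add: field_simps)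
    also have "\<dots> \<le> N ^ k * card (lball l)" by (rule pow)
    also have "N ^ k = exp (ln N * real k)" using N by (simp add: exp_of_nat_mult mult.commute)
    also have "\<dots> \<le> exp (ln N * (r / m + 1))" using k(2) N by (intro iffD2[OF exp_le_cancel_iff] mult_left_mono) auto
    also have "\<dots> = N * exp (ln N / m * r)" using N by (simp add: exp_add algebra_simps)
    finally show ?thesis by (simp add: algebra_simps mult_right_mono)
  qed
  then show ?thesis unfolding rates_def N_def m_def by blast
qed

lemma rates_lower: "\<exists>c>0. \<forall>u\<in>rates. c \<le> u"
proof -
  obtain M where M: "M > 0" "\<And>k. 2 ^ k \<le> card (lball (real k * M))"
    using exp_growth(1)[OF not_virtually_cyclic] unfolding lball_def by blast
  have "ln 2 / M \<le> u" if u: "u \<in> rates" for u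
  proof (rule ccontr)
    assume "\<not> ?thesis"
    then have pos: "0 < ln 2 - u * M" using M(1) by (simp add: field_simps)
    obtain C where C: "\<And>r. r \<ge> 0 \<Longrightarrow> real (card (lball r)) \<le> C * exp (u * r)"
      using u by (auto simp: rates_def)
    have C1: "1 \<le> C" using C[of 0] card_ball_pos[of 0] by simp
    have "real k * (ln 2 - u * M) \<le> ln C" for k
    proof -
      have "(2::real) ^ k \<le> real (card (lball (real k * M)))" using M(2)[of k]
        by (metis of_nat_le_iff of_nat_numeral of_nat_power)
      also have "\<dots> \<le> C * exp (u * (real k * M))" using M(1) by (intro C) simp
      finally have "ln ((2::real) ^ k) \<le> ln (C * exp (u * (real k * M)))" using C1 by (subst ln_le_cancel_iff) auto
      then show ?thesis using C1 by (simp add: ln_mult ln_realpow algebra_simps)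
    qed
    then show False using reals_Archimedean3[OF pos, rule_format, of "ln C"] by (meson not_le)
  qed
  then show ?thesis using M(1) by (intro exI[of _ "ln 2 / M"]) auto
qed

lemma rates_nonempty: "rates \<noteq> {}"
  using rate_ann[of "2 * rg + 1" "2 * rg + 1"] by auto

lemma v_pos: "0 < v"
proof -
  obtain c where "c > 0" "\<forall>u\<in>rates. c \<le> u" using rates_lower by blast
  then have "c \<le> v" unfolding v_def using rates_nonempty by (intro cInf_greatest) auto
  then show ?thesis using \<open>c > 0\<close> by simp
qed

lemma v_le: "u \<in> rates \<Longrightarrow> v \<le> u"
  unfolding v_def using rates_lower by (intro cInf_lower) (auto simp: bdd_below_def)

lemma card_ball_upper:
  assumes "v < u"
  shows "\<exists>C\<ge>0. \<forall>r\<ge>0. real (card (lball r)) \<le> C * exp (u * r)"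
proof -
  obtain u' where u: "u' \<in> rates" "u' < u"
    using cInf_lessD[OF rates_nonempty assms[unfolded v_def]] by blast
  then obtain C where C: "\<And>r. r \<ge> 0 \<Longrightarrow> real (card (lball r)) \<le> C * exp (u' * r)"
    by (auto simp: rates_def)
  have C1: "1 \<le> C" using C[of 0] card_ball_pos[of 0] by simp
  have "real (card (lball r)) \<le> C * exp (u * r)" if "r \<ge> 0" for r
  proof -
    have "u' * r \<le> u * r" using u(2) that by (intro mult_right_mono) auto
    then have "C * exp (u' * r) \<le> C * exp (u * r)" using C1 by (intro mult_left_mono) auto
    then show ?thesis using C[OF that] by simp
  qed
  then show ?thesis using C1 by (intro exI[of _ C]) auto
qed

text \<open>A smaller annulus would produce, by \<open>rate_ann\<close>, a rate below the infimum
  \<open>v\<close>.\<close>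

lemma card_ann_lower:
  assumes "2 * rg < \<delta>" "2 * rg < l"
  shows "exp (v * (l - 2 * rg)) - 1 \<le> real (card (ann \<delta> l))"
proof -
  have "v \<le> ln (real (card (ann \<delta> l)) + 1) / (l - 2 * rg)" by (intro v_le rate_ann assms)
  then have "v * (l - 2 * rg) \<le> ln (real (card (ann \<delta> l)) + 1)" using assms by (simp add: field_simps)
  then have "exp (v * (l - 2 * rg)) \<le> exp (ln (real (card (ann \<delta> l)) + 1))"
    by (simp only: exp_le_cancel_iff)
  also have "\<dots> = real (card (ann \<delta> l)) + 1" by simp
  finally show ?thesis by simp
qed

text \<open>All these \<open>s\<close> pass near the point \<open>p\<close> at position
  \<open>j\<close> on the way to \<open>g\<close>. The remaining distance from \<open>p\<close> to
  \<open>s\<close> is about \<open>l - j\<close>, so translation by \<open>inv p\<close> embeds the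
  set into a ball of that radius.\<close>

lemma card_shadow:
  assumes C: "0 \<le> C" "\<And>r. 0 \<le> r \<Longrightarrow> real (card (lball r)) \<le> C * exp (u * r)"
    and g: "g \<in> carrier G" and j: "real j \<le> l"
  shows "real (card {s \<in> ann \<delta> l. real j \<le> gp \<one> s g}) \<le> C * exp (u * (l - real j + rg + 2 * \<eta>))"
proof (cases "real j \<le> len g")
  case False
  have "{s \<in> ann \<delta> l. real j \<le> gp \<one> s g} = {}"
  proof -
    have "gp \<one> s g \<le> len g" if "s \<in> ann \<delta> l" for s
      using gp_le[of g s \<one>] gp_sym[of g s \<one>] g that ann_carrier by auto
    then show ?thesis using False by fastforce
  qed
  then have "real (card {s \<in> ann \<delta> l. real j \<le> gp \<one> s g}) = 0" by (simp only: card.empty of_nat_0)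
  then show ?thesis using C(1) by simp
next
  case True
  then obtain p where p: "p \<in> carrier G" "len p \<le> real j + rg" "d p g \<le> len g - real j + rg"
    using rg_point[of \<one> g "real j"] g by auto
  let ?E = "{s \<in> ann \<delta> l. real j \<le> gp \<one> s g}"
  let ?R = "l - real j + rg + 2 * \<eta>"
  have E: "s \<in> carrier G" "len s \<le> l" if "s \<in> ?E" for s using that unfolding annulus_def by auto
  have inj: "inj_on (\<lambda>s. inv p \<otimes> s) ?E" 
  proof (rule inj_onI)
    fix s t assume "s \<in> ?E" "t \<in> ?E" "inv p \<otimes> s = inv p \<otimes> t"
    then show "s = t" using E(1)[of s] E(1)[of t] p(1) by simp
  qed
  have "(\<lambda>s. inv p \<otimes> s) ` ?E \<subseteq> lball ?R"
  proof
    fix y assume "y \<in> (\<lambda>s. inv p \<otimes> s) ` ?E"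
    then obtain s where s: "s \<in> ?E" "y = inv p \<otimes> s" by auto
    have "d p s + len g \<le> max (d p \<one> + d s g) (len s + d p g) + 2 * \<eta>"
      using four_point[of p \<one> s g] p g E(1)[OF s(1)] by simp
    moreover have "d s g = len s + len g - 2 * gp \<one> s g"
      unfolding gromov_product_def using d_sym[of s \<one>] E(1)[OF s(1)] by (simp add: field_simps)
    ultimately have "d p s \<le> ?R" using p E(2)[OF s(1)] s(1) d_sym[of p \<one>] by (auto simp: max_def split: if_splits)
    then show "y \<in> lball ?R" unfolding lball_def using s p E(1)[OF s(1)] d_len[of p s] by simp
  qed
  then have "card ((\<lambda>s. inv p \<otimes> s) ` ?E) \<le> card (lball ?R)" by (intro card_mono ball_finite)
  then have "card ?E \<le> card (lball ?R)" by (simp only: card_image[OF inj])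
  then have "real (card ?E) \<le> real (card (lball ?R))" by simp
  also have "real (card (lball ?R)) \<le> C * exp (u * ?R)" using C j rg_nonneg eta_nonneg by (intro C(2)) simp
  finally show ?thesis .
qed

lemma sum_exp_ann:
  assumes C: "0 \<le> C" "\<And>r. 0 \<le> r \<Longrightarrow> real (card (lball r)) \<le> C * exp (u * r)"
    and g: "g \<in> carrier G" and au: "0 \<le> \<alpha>" "u < 2 * \<alpha>" and l: "0 \<le> l"
  defines "q \<equiv> exp (2 * \<alpha> - u)"
  shows "(\<Sum>s\<in>ann \<delta> l. exp (- \<alpha> * d s g)) \<le>
    C * exp (\<alpha> * \<delta> + 2 * \<alpha> + u * (rg + 2 * \<eta>)) * (q / (q - 1)) * exp (\<alpha> * l) * exp (- \<alpha> * len g)"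
proof -
  define m where "m = nat \<lfloor>l\<rfloor>"
  have m: "real m \<le> l" unfolding m_def using l by simp
  have q: "1 < q" unfolding q_def using au by simp
  let ?T = "\<lambda>s. gp \<one> s g"
  \<comment> \<open>The term for the integer part of the product is bounded by the sum over all
    smaller \<open>j\<close>. This makes the condition on \<open>s\<close> cumulative, as
    \<open>card_shadow\<close> requires, and costs only a factor of a geometric series.\<close>
  have pt: "exp (- \<alpha> * d s g) \<le> exp (- \<alpha> * (l - \<delta> + len g)) *
      (\<Sum>j\<le>m. if real j \<le> ?T s then exp (2 * \<alpha> * (real j + 1)) else 0)" if s: "s \<in> ann \<delta> l" for s
  proof -
    have sc: "s \<in> carrier G" "l - \<delta> < len s" "len s \<le> l" using s unfolding annulus_def by auto
    define j where "j = nat \<lfloor>?T s\<rfloor>"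
    have T: "0 \<le> ?T s" "?T s \<le> l" using gp_nonneg[of s g \<one>] gp_le[of s g \<one>] sc g by auto
    then have j: "real j \<le> ?T s" "?T s \<le> real j + 1" "j \<le> m"
      unfolding j_def m_def by (auto intro: nat_mono floor_mono)
    have "d s g = len s + len g - 2 * ?T s"
      unfolding gromov_product_def using d_sym[of s \<one>] sc by (simp add: field_simps)
    then have "l - \<delta> + len g - 2 * (real j + 1) \<le> d s g" using sc j by simp
    then have "- \<alpha> * d s g \<le> - \<alpha> * (l - \<delta> + len g) + 2 * \<alpha> * (real j + 1)"
      using mult_left_mono[of "l - \<delta> + len g - 2 * (real j + 1)" "d s g" \<alpha>] au by (simp add: algebra_simps)
    then have "exp (- \<alpha> * d s g) \<le> exp (- \<alpha> * (l - \<delta> + len g)) * exp (2 * \<alpha> * (real j + 1))"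
      by (simp add: exp_add[symmetric])
    also have "exp (2 * \<alpha> * (real j + 1)) \<le> (\<Sum>j\<le>m. if real j \<le> ?T s then exp (2 * \<alpha> * (real j + 1)) else 0)"
      using member_le_sum[of j "{..m}" "\<lambda>j. if real j \<le> ?T s then exp (2 * \<alpha> * (real j + 1)) else 0"] j by simp
    finally show ?thesis by simp
  qed
  have "(\<Sum>s\<in>ann \<delta> l. exp (- \<alpha> * d s g)) \<le> (\<Sum>s\<in>ann \<delta> l. exp (- \<alpha> * (l - \<delta> + len g)) *
      (\<Sum>j\<le>m. if real j \<le> ?T s then exp (2 * \<alpha> * (real j + 1)) else 0))"
    by (intro sum_mono pt)
  also have "\<dots> = exp (- \<alpha> * (l - \<delta> + len g)) *
      (\<Sum>j\<le>m. \<Sum>s\<in>ann \<delta> l. if real j \<le> ?T s then exp (2 * \<alpha> * (real j + 1)) else 0)"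
    by (subst sum.swap) (simp add: sum_distrib_left)
  also have "(\<Sum>j\<le>m. \<Sum>s\<in>ann \<delta> l. if real j \<le> ?T s then exp (2 * \<alpha> * (real j + 1)) else 0) =
      (\<Sum>j\<le>m. exp (2 * \<alpha> * (real j + 1)) * real (card {s \<in> ann \<delta> l. real j \<le> ?T s}))"
    using ann_finite by (intro sum.cong refl) (simp add: sum.If_cases Int_def)
  also have "\<dots> \<le> (\<Sum>j\<le>m. exp (2 * \<alpha> * (real j + 1)) * (C * exp (u * (l - real j + rg + 2 * \<eta>))))"
    using m by (intro sum_mono mult_left_mono card_shadow C g) auto
  also have "\<dots> = (\<Sum>j\<le>m. C * exp (2 * \<alpha> + u * (l + rg + 2 * \<eta>)) * q ^ j)"
    unfolding q_def exp_of_nat_mult[symmetric]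
    by (intro sum.cong refl) (simp add: exp_add[symmetric] algebra_simps)
  also have "\<dots> = C * exp (2 * \<alpha> + u * (l + rg + 2 * \<eta>)) * (\<Sum>j\<le>m. q ^ j)" by (simp add: sum_distrib_left)
  also have "\<dots> \<le> C * exp (2 * \<alpha> + u * (l + rg + 2 * \<eta>)) * (q / (q - 1) * exp ((2 * \<alpha> - u) * l))"
  proof (intro mult_left_mono)
    have "q ^ m = exp ((2 * \<alpha> - u) * real m)" unfolding q_def by (simp add: exp_of_nat_mult[symmetric] mult.commute)
    also have "\<dots> \<le> exp ((2 * \<alpha> - u) * l)" using m au by simp
    finally have "q / (q - 1) * q ^ m \<le> q / (q - 1) * exp ((2 * \<alpha> - u) * l)" using q by (intro mult_left_mono) auto
    then show "(\<Sum>j\<le>m. q ^ j) \<le> q / (q - 1) * exp ((2 * \<alpha> - u) * l)" using geometric_sum_le[OF q, of m] by simp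
  qed (use C in auto)
  finally have "(\<Sum>s\<in>ann \<delta> l. exp (- \<alpha> * d s g)) \<le> exp (- \<alpha> * (l - \<delta> + len g)) *
    (C * exp (2 * \<alpha> + u * (l + rg + 2 * \<eta>)) * (q / (q - 1) * exp ((2 * \<alpha> - u) * l)))" by simp
  also have "\<dots> = C * (q / (q - 1)) * (exp (- \<alpha> * (l - \<delta> + len g)) *
    exp (2 * \<alpha> + u * (l + rg + 2 * \<eta>)) * exp ((2 * \<alpha> - u) * l))" by (simp add: algebra_simps)
  also have "exp (- \<alpha> * (l - \<delta> + len g)) * exp (2 * \<alpha> + u * (l + rg + 2 * \<eta>)) * exp ((2 * \<alpha> - u) * l) =
     exp (\<alpha> * \<delta> + 2 * \<alpha> + u * (rg + 2 * \<eta>)) * exp (\<alpha> * l) * exp (- \<alpha> * len g)"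
    unfolding exp_add[symmetric] by (simp add: algebra_simps)
  finally show ?thesis by (simp add: algebra_simps)
qed

lemma contraction:
  assumes "2 * rg < \<delta>" and \<alpha>: "v / 2 < \<alpha>" "\<alpha> < v"
  shows "\<forall>\<^sub>F l in at_top. \<forall>g\<in>carrier G.
    (\<Sum>s\<in>ann \<delta> l. exp (- \<alpha> * d s g)) \<le> real (card (ann \<delta> l)) * exp (- \<alpha> * len g) / 2"
proof -
  \<comment> \<open>\<open>u > v\<close> bounds the size of balls, and
    \<open>u < 2 * \<alpha>\<close> makes the ratio \<open>q\<close> of the geometric series exceed
    1.\<close>
  define u where "u = (v + 2 * \<alpha>) / 2"
  have u: "v < u" "u < 2 * \<alpha>" unfolding u_def using \<alpha> by auto
  obtain C where C: "0 \<le> C" "\<And>r. 0 \<le> r \<Longrightarrow> real (card (lball r)) \<le> C * exp (u * r)"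
    using card_ball_upper[OF u(1)] by blast
  define q where "q = exp (2 * \<alpha> - u)"
  define B where "B = C * exp (\<alpha> * \<delta> + 2 * \<alpha> + u * (rg + 2 * \<eta>)) * (q / (q - 1))"
  have "\<forall>\<^sub>F l in at_top. B * exp (\<alpha> * l) \<le> (exp (v * (l - 2 * rg)) - 1) / 2"
  proof -
    define e where "e = v - \<alpha>"
    define \<kappa> where "\<kappa> = exp (- 2 * v * rg)"
    have "e > 0" "\<kappa> > 0" unfolding e_def \<kappa>_def using \<alpha> by auto
    then have "\<forall>\<^sub>F l in at_top. 2 * B + 1 \<le> \<kappa> * exp (e * l)" by real_asymp
    moreover have "\<forall>\<^sub>F l in at_top. (0::real) \<le> l" by (rule eventually_ge_at_top)
    ultimately show ?thesis
    proof eventually_elim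
      case (elim l)
      have "exp (\<alpha> * l) * (2 * B + 1) \<le> exp (\<alpha> * l) * (\<kappa> * exp (e * l))"
        using elim by (intro mult_left_mono) auto
      also have "\<dots> = exp (v * (l - 2 * rg))"
        unfolding \<kappa>_def e_def exp_add[symmetric] by (simp add: algebra_simps)
      finally have "exp (\<alpha> * l) * (2 * B + 1) \<le> exp (v * (l - 2 * rg))" .
      moreover have "1 \<le> exp (\<alpha> * l)" using elim \<alpha> v_pos by simp
      moreover have "B * X \<le> (Y - 1) / 2" if "X * (2 * B + 1) \<le> Y" "1 \<le> X" for X Y
        using that by (simp add: algebra_simps)
      ultimately show ?case by blast
    qed
  qed
  moreover have "\<forall>\<^sub>F l in at_top. 2 * rg < l" by (rule eventually_gt_at_top)
  ultimately show ?thesis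
  proof eventually_elim
    case (elim l)
    show ?case
    proof
      fix g assume g: "g \<in> carrier G"
      have "(\<Sum>s\<in>ann \<delta> l. exp (- \<alpha> * d s g)) \<le> B * exp (\<alpha> * l) * exp (- \<alpha> * len g)"
        unfolding B_def q_def using \<alpha> v_pos u elim rg_nonneg
        by (intro sum_exp_ann C g) auto
      also have "\<dots> \<le> real (card (ann \<delta> l)) / 2 * exp (- \<alpha> * len g)"
        using elim card_ann_lower[OF assms(1) elim(2)] by (intro mult_right_mono) auto
      finally show "(\<Sum>s\<in>ann \<delta> l. exp (- \<alpha> * d s g)) \<le> real (card (ann \<delta> l)) * exp (- \<alpha> * len g) / 2" by simp
    qed
  qed
qed

end

section \<open>The Green function\<close>

context group begin

lemma word_length_mult:
  assumes "sym_generating G T" "x \<in> carrier G" "y \<in> carrier G"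
  shows "word_length G T (x \<otimes> y) \<le> word_length G T x + word_length G T y"
proof -
  obtain us where us: "set us \<subseteq> T" "length us = word_length G T x" "wprod us = x"
    using word_length_word[OF assms(1,2)] by blast
  obtain ws where ws: "set ws \<subseteq> T" "length ws = word_length G T y" "wprod ws = y"
    using word_length_word[OF assms(1,3)] by blast
  have "T \<subseteq> carrier G" using assms(1) unfolding sym_generating_def by blast
  then have "wprod (us @ ws) = x \<otimes> y" using us ws wprod_append[of us ws] by auto
  then show ?thesis using word_length_le[of "us @ ws" T "x \<otimes> y"] us ws by simp
qed

lemma word_length_compare:
  assumes T: "sym_generating G T" and S: "sym_generating G S"
  shows "\<exists>M. \<forall>g\<in>carrier G. word_length G T g \<le> M * word_length G S g"
proof -
  have Sc: "S \<subseteq> carrier G" "finite S" using S unfolding sym_generating_def by auto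
  define M where "M = Max (insert 0 (word_length G T ` S))"
  have M: "word_length G T s \<le> M" if "s \<in> S" for s
    unfolding M_def using that Sc by (intro Max_ge) auto
  have *: "word_length G T (wprod ws) \<le> M * length ws" if "set ws \<subseteq> S" for ws
    using that
  proof (induction ws)
    case Nil
    show ?case using word_length_le[of "[]" T \<one>] by simp
  next
    case (Cons s ws)
    have "set ws \<subseteq> carrier G" "s \<in> carrier G" "s \<in> S" using Cons.prems Sc by auto
    then show ?case using word_length_mult[OF T, of s "wprod ws"] M[of s] Cons by simp
  qed
  show ?thesis
  proof (intro exI[of _ M] ballI)
    fix g assume "g \<in> carrier G"
    then obtain ws where "set ws \<subseteq> S" "length ws = word_length G S g" "wprod ws = g"
      using word_length_word[OF S] by blast
    then show "word_length G T g \<le> M * word_length G S g" using *[of ws] by simp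
  qed
qed

end

text \<open>The annulus enters only through these properties. \<open>contract\<close> is the
  contraction at the identity; left invariance extends it to all points in
  \<open>P_\<phi>\<close>.\<close>

locale green_group = hyp_group +
  fixes T :: "'a set" and \<alpha> :: real and \<rho> :: real
  assumes T_gen: "sym_generating G T" and T_nonempty: "T \<noteq> {}"
    and T_len: "s \<in> T \<Longrightarrow> len s \<le> \<rho>"
    and \<alpha>_pos: "0 < \<alpha>"
    and contract: "g \<in> carrier G \<Longrightarrow> (\<Sum>s\<in>T. exp (- \<alpha> * d s g)) \<le> real (card T) * exp (- \<alpha> * len g) / 2"
begin

lemma T_carrier: "T \<subseteq> carrier G" and T_finite: "finite T" and T_inv: "s \<in> T \<Longrightarrow> inv s \<in> T"
  using T_gen unfolding sym_generating_def by auto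

lemma T_closed [simp]: "s \<in> T \<Longrightarrow> s \<in> carrier G"
  using T_carrier by blast

definition N :: real where "N = real (card T)"

lemma N_ge_1: "1 \<le> N"
  unfolding N_def using T_nonempty T_finite by (simp add: Suc_le_eq card_gt_0_iff)

lemma rho_nonneg: "0 \<le> \<rho>"
  using T_nonempty T_len T_closed len_nonneg by (metis all_not_in_conv order_trans)

section \<open>The step operator and its maximum principle\<close>

definition P :: "('a \<Rightarrow> real) \<Rightarrow> 'a \<Rightarrow> real" where
  "P u x = (\<Sum>s\<in>T. u (x \<otimes> s)) / N"

definition \<phi> where "\<phi> z x = exp (- \<alpha> * d x z)"

lemma \<phi>_le_1: "x \<in> carrier G \<Longrightarrow> z \<in> carrier G \<Longrightarrow> \<phi> z x \<le> 1"
  unfolding \<phi>_def using \<alpha>_pos d_nonneg by simp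

lemma P_mono_T: "(\<And>s. s \<in> T \<Longrightarrow> u (x \<otimes> s) \<le> w (x \<otimes> s)) \<Longrightarrow> P u x \<le> P w x"
  unfolding P_def using N_ge_1 by (intro divide_right_mono sum_mono) auto

lemma P_mono:
  assumes "x \<in> carrier G" "\<And>y. y \<in> carrier G \<Longrightarrow> u y \<le> w y"
  shows "P u x \<le> P w x"
  using assms by (intro P_mono_T) auto

lemma P_nonneg: "x \<in> carrier G \<Longrightarrow> (\<And>y. y \<in> carrier G \<Longrightarrow> 0 \<le> u y) \<Longrightarrow> 0 \<le> P u x"
  unfolding P_def using N_ge_1 by (intro divide_nonneg_nonneg sum_nonneg) auto

lemma P_cmult: "P (\<lambda>y. c * u y) x = c * P u x"
  unfolding P_def by (simp add: sum_distrib_left)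

lemma P_add: "P (\<lambda>y. u y + w y) x = P u x + P w x"
  unfolding P_def by (simp add: sum.distrib add_divide_distrib)

lemma P_diff: "P (\<lambda>y. u y - w y) x = P u x - P w x"
  unfolding P_def by (simp add: sum_subtractf diff_divide_distrib)

lemma P_\<phi>:
  assumes "x \<in> carrier G" "z \<in> carrier G"
  shows "P (\<phi> z) x \<le> \<phi> z x / 2"
proof -
  have "d (x \<otimes> s) z = d s (inv x \<otimes> z)" if "s \<in> T" for s
    using d_inv[of "inv x" "x \<otimes> s" z] assms that by (simp add: m_assoc[symmetric])
  then have "(\<Sum>s\<in>T. \<phi> z (x \<otimes> s)) = (\<Sum>s\<in>T. exp (- \<alpha> * d s (inv x \<otimes> z)))"
    unfolding \<phi>_def by (intro sum.cong) auto
  also have "\<dots> \<le> N * exp (- \<alpha> * len (inv x \<otimes> z)) / 2"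
    unfolding N_def using assms by (intro contract) auto
  also have "len (inv x \<otimes> z) = d x z" using assms by (simp add: d_len[symmetric])
  finally show ?thesis unfolding P_def \<phi>_def using N_ge_1 by (simp add: field_simps)
qed

lemma P_pow_le:
  assumes z: "z \<in> carrier G" and u: "\<And>y. y \<in> carrier G \<Longrightarrow> u y \<le> C * \<phi> z y" and C: "0 \<le> C"
    and x: "x \<in> carrier G"
  shows "(P ^^ k) u x \<le> C * (1 / 2) ^ k * \<phi> z x"
  using x
proof (induction k arbitrary: x)
  case (Suc k)
  have "(P ^^ Suc k) u x \<le> P (\<lambda>y. (C * (1 / 2) ^ k) * \<phi> z y) x"
    using Suc by (simp add: P_mono)
  also have "\<dots> = (C * (1 / 2) ^ k) * P (\<phi> z) x" by (rule P_cmult)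
  also have "\<dots> \<le> (C * (1 / 2) ^ k) * (\<phi> z x / 2)" using C by (intro mult_left_mono P_\<phi> Suc.prems z) auto
  finally show ?case by simp
qed (use u in simp)

text \<open>Maximum principle: iterating \<open>sub\<close> gives \<open>u \<le> (P ^^ k) u\<close>,
  and \<open>P\<close> halves \<open>\<phi> z\<close> at each iteration, so the right-hand side is
  squeezed to at most 0.\<close>

lemma subharmonic_nonpos:
  assumes z: "z \<in> carrier G" and u: "\<And>y. y \<in> carrier G \<Longrightarrow> u y \<le> C * \<phi> z y"
    and sub: "\<And>y. y \<in> carrier G \<Longrightarrow> u y \<le> P u y" and x: "x \<in> carrier G"
  shows "u x \<le> 0"
proof -
  have "u y \<le> max C 0 * \<phi> z y" if "y \<in> carrier G" for y
  proof -
    have "C * \<phi> z y \<le> max C 0 * \<phi> z y" unfolding \<phi>_def by (intro mult_right_mono) auto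
    then show ?thesis using u[OF that] by simp
  qed
  then have 1: "(P ^^ k) u x \<le> max C 0 * (1 / 2) ^ k * \<phi> z x" for k
    using x z by (intro P_pow_le) auto
  have 2: "u y \<le> (P ^^ k) u y" if "y \<in> carrier G" for k y
    using that
  proof (induction k arbitrary: y)
    case (Suc k)
    have "P u y \<le> P ((P ^^ k) u) y" using Suc by (intro P_mono) auto
    then show ?case using sub[OF Suc.prems] by simp
  qed simp
  have "(\<lambda>k. max C 0 * (1 / 2) ^ k * \<phi> z x) \<longlonglongrightarrow> max C 0 * 0 * \<phi> z x"
    by (intro tendsto_intros LIMSEQ_realpow_zero) auto
  then show ?thesis using order_trans[OF 2[OF x] 1] by (intro LIMSEQ_le_const) auto
qed

text \<open>The target \<open>z\<close> precedes the starting point \<open>x\<close>, so that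
  \<open>step_prob k z\<close> is a function on which \<open>P\<close> acts.\<close>

primrec step_prob :: "nat \<Rightarrow> 'a \<Rightarrow> 'a \<Rightarrow> real" where
  "step_prob 0 z x = (if x = z then 1 else 0)"
| "step_prob (Suc k) z x = P (step_prob k z) x"

lemma step_prob_nonneg: "x \<in> carrier G \<Longrightarrow> 0 \<le> step_prob k z x"
  by (induction k arbitrary: x) (auto intro: P_nonneg)

lemma step_prob_pow: "step_prob k z = (P ^^ k) (step_prob 0 z)"
  by (induction k) auto

lemma step_prob_le: "z \<in> carrier G \<Longrightarrow> x \<in> carrier G \<Longrightarrow> step_prob k z x \<le> (1 / 2) ^ k * \<phi> z x"
  unfolding step_prob_pow[of k] using P_pow_le[of z "step_prob 0 z" 1 x k] by (auto simp: \<phi>_def d_refl)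

lemma step_prob_left:
  "g \<in> carrier G \<Longrightarrow> x \<in> carrier G \<Longrightarrow> z \<in> carrier G \<Longrightarrow> step_prob k (g \<otimes> z) (g \<otimes> x) = step_prob k z x"
proof (induction k arbitrary: x)
  case (Suc k)
  then show ?case unfolding step_prob.simps P_def by (auto simp: m_assoc intro!: sum.cong)
qed simp

lemma sum_T_inv: "(\<Sum>s\<in>T. f (inv s)) = (\<Sum>s\<in>T. f s)"
  by (rule sum.reindex_bij_witness[of _ "\<lambda>s. inv s" "\<lambda>s. inv s"]) (auto intro: T_inv)

text \<open>The recursion splits off the first step, this lemma the last one. The symmetry of
  \<open>T\<close> enters in the base case, and comparing both recursions gives
  \<open>step_prob_sym\<close>.\<close>

lemma step_prob_right:
  "x \<in> carrier G \<Longrightarrow> z \<in> carrier G \<Longrightarrow> step_prob (Suc k) z x = (\<Sum>s\<in>T. step_prob k (z \<otimes> s) x) / N"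
proof (induction k arbitrary: x)
  case 0
  have "x \<otimes> inv s = z \<longleftrightarrow> x = z \<otimes> s" if "s \<in> T" for s
    using that 0 by (auto simp: m_assoc)
  then have "(\<Sum>s\<in>T. step_prob 0 z (x \<otimes> inv s)) = (\<Sum>s\<in>T. step_prob 0 (z \<otimes> s) x)"
    by (intro sum.cong) auto
  then show ?case unfolding step_prob.simps(2) P_def using sum_T_inv[of "\<lambda>s. step_prob 0 z (x \<otimes> s)"] by simp
next
  case (Suc k)
  have "step_prob (Suc (Suc k)) z x = (\<Sum>s\<in>T. (\<Sum>t\<in>T. step_prob k (z \<otimes> t) (x \<otimes> s)) / N) / N"
    unfolding step_prob.simps(2)[of "Suc k"] P_def[of "step_prob (Suc k) z"] using Suc by (intro arg_cong2[of _ _ _ _ "(/)"] sum.cong) auto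
  also have "\<dots> = (\<Sum>t\<in>T. (\<Sum>s\<in>T. step_prob k (z \<otimes> t) (x \<otimes> s)) / N) / N"
    by (simp add: sum_divide_distrib[symmetric]) (subst sum.swap, simp)
  finally show ?case by (simp add: P_def)
qed

lemma step_prob_sym: "x \<in> carrier G \<Longrightarrow> z \<in> carrier G \<Longrightarrow> step_prob k z x = step_prob k x z"
proof (induction k arbitrary: x)
  case (Suc k)
  then show ?case unfolding step_prob_right[OF Suc.prems(2,1)] by (simp add: P_def)
qed auto

section \<open>The Green function and its elementary bounds\<close>

definition green_fun :: "'a \<Rightarrow> 'a \<Rightarrow> real" where "green_fun x z = (\<Sum>k. step_prob k z x)"

lemma step_prob_summable:
  assumes "x \<in> carrier G" "z \<in> carrier G"
  shows "summable (\<lambda>k. step_prob k z x)"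
proof (rule summable_comparison_test')
  show "summable (\<lambda>k. (1 / 2) ^ k * \<phi> z x)" by (intro summable_mult2 summable_geometric) simp
  show "norm (step_prob k z x) \<le> (1 / 2) ^ k * \<phi> z x" if "k \<ge> 0" for k
    using step_prob_le[OF assms(2,1), of k] step_prob_nonneg[OF assms(1), of k z] by simp
qed

lemma green_fun_le_\<phi>:
  assumes "x \<in> carrier G" "z \<in> carrier G"
  shows "green_fun x z \<le> 2 * \<phi> z x"
proof -
  have s: "(\<lambda>k. (1 / 2) ^ k * \<phi> z x) sums (1 / (1 - 1 / 2) * \<phi> z x)"
    by (intro sums_mult2 geometric_sums) simp
  have "green_fun x z \<le> (\<Sum>k. (1 / 2) ^ k * \<phi> z x)" unfolding green_fun_def
    using assms s by (intro suminf_le step_prob_le step_prob_summable) (auto simp: sums_iff)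
  also have "\<dots> = 2 * \<phi> z x" using s by (simp add: sums_iff)
  finally show ?thesis .
qed

lemma green_fun_nonneg: "x \<in> carrier G \<Longrightarrow> z \<in> carrier G \<Longrightarrow> 0 \<le> green_fun x z"
  unfolding green_fun_def by (intro suminf_nonneg step_prob_summable step_prob_nonneg)

lemma green_fun_sym: "x \<in> carrier G \<Longrightarrow> z \<in> carrier G \<Longrightarrow> green_fun x z = green_fun z x"
  unfolding green_fun_def by (simp add: step_prob_sym)

lemma green_fun_left:
  "g \<in> carrier G \<Longrightarrow> x \<in> carrier G \<Longrightarrow> z \<in> carrier G \<Longrightarrow> green_fun (g \<otimes> x) (g \<otimes> z) = green_fun x z"
  unfolding green_fun_def by (simp add: step_prob_left)

lemma green_fun_diag: "x \<in> carrier G \<Longrightarrow> green_fun x x = green_fun \<one> \<one>"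
  using green_fun_left[of x \<one> \<one>] by simp

lemma green_fun_eq:
  assumes "x \<in> carrier G" "z \<in> carrier G"
  shows "green_fun x z = (if x = z then 1 else 0) + P (\<lambda>y. green_fun y z) x"
proof -
  have "green_fun x z = (\<Sum>k. step_prob (Suc k) z x) + step_prob 0 z x"
    unfolding green_fun_def using suminf_split_head[OF step_prob_summable[OF assms]] by simp
  also have "(\<Sum>k. step_prob (Suc k) z x) = (\<Sum>k. \<Sum>s\<in>T. step_prob k z (x \<otimes> s)) / N"
    unfolding step_prob.simps P_def using assms
    by (intro suminf_divide summable_sum step_prob_summable) auto
  also have "\<dots> = P (\<lambda>y. green_fun y z) x"
    unfolding P_def green_fun_def using assms
    by (intro arg_cong2[of _ _ _ _ "(/)"] refl suminf_sum step_prob_summable) auto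
  finally show ?thesis by simp
qed

lemma green_fun_super: "x \<in> carrier G \<Longrightarrow> z \<in> carrier G \<Longrightarrow> P (\<lambda>y. green_fun y z) x \<le> green_fun x z"
  using green_fun_eq[of x z] by simp

lemma green_fun_one_ge_1: "1 \<le> green_fun \<one> \<one>"
  using green_fun_eq[of \<one> \<one>] P_nonneg[of \<one> "\<lambda>y. green_fun y \<one>"] green_fun_nonneg by simp

text \<open>Domination principle. The positive part of \<open>c * green_fun x z - u x\<close> is
  subharmonic away from \<open>z\<close>, vanishes at \<open>z\<close> by \<open>cz\<close>, and
  lies below a multiple of \<open>\<phi> z\<close>, so the maximum principle applies.\<close>

lemma dominate:
  assumes z: "z \<in> carrier G" and x: "x \<in> carrier G" and c: "0 \<le> c"
    and u: "\<And>y. y \<in> carrier G \<Longrightarrow> 0 \<le> u y" "\<And>y. y \<in> carrier G \<Longrightarrow> P u y \<le> u y"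
    and cz: "c * green_fun z z \<le> u z"
  shows "c * green_fun x z \<le> u x"
proof -
  define h where "h x = max 0 (c * green_fun x z - u x)" for x
  have "h x \<le> 0"
  proof (rule subharmonic_nonpos[OF z _ _ x, where C = "2 * c"])
    fix y assume y: "y \<in> carrier G"
    have "c * green_fun y z \<le> c * (2 * \<phi> z y)" using c by (intro mult_left_mono green_fun_le_\<phi> y z)
    then show "h y \<le> 2 * c * \<phi> z y" unfolding h_def using u(1)[OF y] c by (auto simp: \<phi>_def)
    have Ph: "0 \<le> P h y" using y by (intro P_nonneg) (auto simp: h_def)
    show "h y \<le> P h y"
    proof (cases "y = z")
      case True
      then show ?thesis using cz Ph unfolding h_def by simp
    next
      case False
      then have "c * green_fun y z - u y \<le> c * P (\<lambda>y. green_fun y z) y - P u y" using green_fun_eq[OF y z] u(2)[OF y] by simp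
      also have "\<dots> = P (\<lambda>y. c * green_fun y z - u y) y" by (simp add: P_diff P_cmult)
      also have "\<dots> \<le> P h y" using y by (intro P_mono) (auto simp: h_def)
      finally show ?thesis using Ph unfolding h_def by simp
    qed
  qed
  then show ?thesis unfolding h_def by simp
qed

lemma green_fun_triangle:
  assumes "x \<in> carrier G" "y \<in> carrier G" "z \<in> carrier G"
  shows "green_fun x y * green_fun y z \<le> green_fun \<one> \<one> * green_fun x z"
proof -
  have "green_fun y z * green_fun x y \<le> green_fun \<one> \<one> * green_fun x z"
  proof (rule dominate[OF assms(2,1)])
    show "0 \<le> green_fun y z" using assms green_fun_nonneg by simp
    show "0 \<le> green_fun \<one> \<one> * green_fun w z" if "w \<in> carrier G" for w
      using that assms green_fun_one_ge_1 green_fun_nonneg by simp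
    show "P (\<lambda>w. green_fun \<one> \<one> * green_fun w z) w \<le> green_fun \<one> \<one> * green_fun w z" if "w \<in> carrier G" for w
      unfolding P_cmult using that assms green_fun_one_ge_1 by (intro mult_left_mono green_fun_super) auto
    show "green_fun y z * green_fun y y \<le> green_fun \<one> \<one> * green_fun y z" using green_fun_diag[OF assms(2)] by simp
  qed
  then show ?thesis by (simp add: mult.commute)
qed

lemma green_fun_step:
  assumes "x \<in> carrier G" "z \<in> carrier G" "s \<in> T"
  shows "green_fun (x \<otimes> s) z / N \<le> green_fun x z"
proof -
  have "green_fun (x \<otimes> s) z \<le> (\<Sum>s\<in>T. green_fun (x \<otimes> s) z)"
    using assms T_finite green_fun_nonneg by (intro member_le_sum) auto
  then have "green_fun (x \<otimes> s) z / N \<le> P (\<lambda>y. green_fun y z) x" unfolding P_def using N_ge_1 by (intro divide_right_mono) auto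
  then show ?thesis using green_fun_super[OF assms(1,2)] by simp
qed

lemma green_fun_word:
  assumes "x \<in> carrier G" "z \<in> carrier G" "set ws \<subseteq> T"
  shows "green_fun (x \<otimes> wprod ws) z / N ^ length ws \<le> green_fun x z"
  using assms
proof (induction ws arbitrary: x)
  case (Cons s ws)
  have c: "set ws \<subseteq> carrier G" "s \<in> carrier G" "s \<in> T" using Cons.prems T_carrier by auto
  have "green_fun (x \<otimes> s \<otimes> wprod ws) z / N ^ length ws \<le> green_fun (x \<otimes> s) z" using Cons c by (intro Cons.IH) auto
  then have "green_fun (x \<otimes> s \<otimes> wprod ws) z / N ^ length ws / N \<le> green_fun (x \<otimes> s) z / N"
    using N_ge_1 by (intro divide_right_mono) auto
  also have "\<dots> \<le> green_fun x z" using Cons c by (intro green_fun_step) auto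
  finally show ?case using c Cons.prems by (simp add: m_assoc mult.commute)
qed simp

lemma green_fun_word_lower:
  assumes "x \<in> carrier G" "set ws \<subseteq> T"
  shows "green_fun \<one> \<one> / N ^ length ws \<le> green_fun x (x \<otimes> wprod ws)"
proof -
  have "set ws \<subseteq> carrier G" using assms T_carrier by auto
  then show ?thesis using green_fun_word[OF assms(1) _ assms(2), of "x \<otimes> wprod ws"] assms green_fun_diag[of "x \<otimes> wprod ws"] by simp
qed

lemma green_fun_lower_wm:
  assumes "x \<in> carrier G" "z \<in> carrier G"
  shows "green_fun \<one> \<one> * exp (- ln N * word_metric G T x z) \<le> green_fun x z"
proof -
  obtain ws where ws: "set ws \<subseteq> T" "length ws = word_length G T (inv x \<otimes> z)" "wprod ws = inv x \<otimes> z"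
    using word_length_word[OF T_gen, of "inv x \<otimes> z"] assms by auto
  have "x \<otimes> wprod ws = z" using assms ws(3) by (simp add: m_assoc[symmetric])
  then have "green_fun \<one> \<one> / N ^ length ws \<le> green_fun x z" using green_fun_word_lower[OF assms(1) ws(1)] by simp
  moreover have "N ^ length ws = exp (ln N * word_metric G T x z)"
    unfolding word_metric_def ws(2)[symmetric] using N_ge_1 by (simp add: exp_of_nat2_mult)
  ultimately show ?thesis by (simp add: exp_minus divide_inverse)
qed

lemma T_S_compare: "\<exists>M\<ge>0. \<forall>x\<in>carrier G. \<forall>z\<in>carrier G. word_metric G T x z \<le> M * word_metric G S x z"
proof -
  obtain M where M: "\<forall>g\<in>carrier G. word_length G T g \<le> M * word_length G S g"
    using word_length_compare[OF T_gen S_gen] by blast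
  have "word_metric G T x z \<le> real M * word_metric G S x z" if "x \<in> carrier G" "z \<in> carrier G" for x z
    unfolding word_metric_def using M[rule_format, of "inv x \<otimes> z"] that by (simp flip: of_nat_mult)
  then show ?thesis by (intro exI[of _ "real M"]) auto
qed

text \<open>A Harnack bound whose rate may be much worse than \<alpha>. It gives positivity, and in
  Ancona's inequality it only has to beat doubly exponentially small errors.\<close>

lemma green_fun_lower: "\<exists>c\<^sub>1\<ge>0. \<exists>c\<^sub>2\<ge>0. \<forall>x\<in>carrier G. \<forall>z\<in>carrier G. exp (- (c\<^sub>1 * d x z + c\<^sub>2)) \<le> green_fun x z"
proof -
  obtain M where M: "M \<ge> 0" "\<And>x z. x \<in> carrier G \<Longrightarrow> z \<in> carrier G \<Longrightarrow>
    word_metric G T x z \<le> M * word_metric G S x z" using T_S_compare by blast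
  define c1 where "c1 = ln N * M * a"
  define c2 where "c2 = ln N * M * a * b"
  have "exp (- (c1 * d x z + c2)) \<le> green_fun x z" if "x \<in> carrier G" "z \<in> carrier G" for x z
  proof -
    have "word_metric G S x z \<le> a * (d x z + b)" using qi_lower[OF that] a_ge_1 by (simp add: field_simps)
    then have "M * word_metric G S x z \<le> M * (a * (d x z + b))" using M(1) by (intro mult_left_mono)
    then have "word_metric G T x z \<le> M * (a * (d x z + b))" using M(2)[OF that] by simp
    then have "ln N * word_metric G T x z \<le> ln N * (M * (a * (d x z + b)))" using N_ge_1 by (intro mult_left_mono) auto
    then have "exp (- (c1 * d x z + c2)) \<le> exp (- ln N * word_metric G T x z)"
      unfolding c1_def c2_def by (simp add: algebra_simps)
    also have "\<dots> \<le> green_fun \<one> \<one> * exp (- ln N * word_metric G T x z)" using green_fun_one_ge_1 by simp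
    also have "\<dots> \<le> green_fun x z" using that by (rule green_fun_lower_wm)
    finally show ?thesis .
  qed
  moreover have "c1 \<ge> 0" "c2 \<ge> 0" unfolding c1_def c2_def using N_ge_1 M a_ge_1 b_nonneg by auto
  ultimately show ?thesis by (intro exI[of _ c1] exI[of _ c2] conjI ballI) auto
qed

lemma green_fun_pos: "x \<in> carrier G \<Longrightarrow> z \<in> carrier G \<Longrightarrow> 0 < green_fun x z"
  using green_fun_lower by (metis exp_gt_zero order_less_le_trans)

lemma green_fun_le_diag:
  assumes "x \<in> carrier G" "z \<in> carrier G"
  shows "green_fun x z \<le> green_fun \<one> \<one>"
proof -
  have "green_fun x z * green_fun z x \<le> green_fun \<one> \<one> * green_fun x x" by (rule green_fun_triangle[OF assms assms(1)])
  then have "(green_fun x z)\<^sup>2 \<le> (green_fun \<one> \<one>)\<^sup>2"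
    unfolding green_fun_sym[OF assms(2,1)] green_fun_diag[OF assms(1)] power2_eq_square .
  moreover have "0 \<le> green_fun \<one> \<one>" using green_fun_one_ge_1 by simp
  ultimately show ?thesis by (rule power2_le_imp_le)
qed

end

section \<open>Ancona's inequality\<close>

context green_group begin

text \<open>Seen from the virtual point at position \<open>t\<close>, the ends of the segment have
  product 0. By \<open>virtual_path\<close> a path with at most \<open>2 ^ K\<close> steps that
  stayed farther away than the stated radius would give them a positive one.\<close>

lemma T_path_hits:
  assumes x: "x \<in> carrier G" and z: "z \<in> carrier G" and t: "0 \<le> t" "t \<le> d x z"
    and p: "p 0 = x" "p q = z" "\<And>i. i < q \<Longrightarrow> \<exists>s\<in>T. p (Suc i) = p i \<otimes> s" and q: "q \<le> 2 ^ K"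
  shows "\<exists>i\<le>q. along x z t (p i) \<le> \<rho> / 2 + real K * \<eta> + 1"
proof (rule ccontr)
  assume "\<not> ?thesis"
  then have far: "\<rho> / 2 + real K * \<eta> + 1 \<le> along x z t (p i)" if "i \<le> q" for i using that by fastforce
  have pc: "p i \<in> carrier G" if "i \<le> q" for i
    using that
  proof (induction i)
    case (Suc i)
    then obtain s where "s \<in> T" "p (Suc i) = p i \<otimes> s" using p(3)[of i] by auto
    then show ?case using Suc by simp
  qed (use p x in simp)
  have "2 * (\<rho> / 2 + real K * \<eta> + 1) - \<rho> - 2 * real K * \<eta> \<le>
      along x z t (p 0) + along x z t (p q) - d (p 0) (p q)"
  proof (rule virtual_path[OF virtual_along[OF x z]])
    show "d (p i) (p (Suc i)) \<le> \<rho>" if i: "0 \<le> i" "i < q" for i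
    proof -
      obtain s where "s \<in> T" "p (Suc i) = p i \<otimes> s" using p(3)[OF i(2)] by blast
      then show ?thesis using d_mult_right[OF pc[of i], of s] i T_len[of s] by simp
    qed
  qed (use q far pc rho_nonneg in auto)
  moreover have "along x z t (p 0) + along x z t (p q) - d (p 0) (p q) = 0"
    unfolding p along_def using t d_refl[OF x] d_refl[OF z] by simp
  ultimately show False by simp
qed

text \<open>Paths from \<open>x\<close> to \<open>z\<close> either pass through \<open>A\<close>, where the Green function is dominated by the
  superharmonic function \<open>h\<close>, or have at least \<open>K\<close> steps.\<close>

lemma barrier:
  assumes z: "z \<in> carrier G"
    and h: "\<And>y. y \<in> carrier G \<Longrightarrow> 0 \<le> h y" "\<And>y. y \<in> carrier G \<Longrightarrow> P h y \<le> h y"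
    and A: "\<And>w. w \<in> carrier G \<Longrightarrow> w \<in> A \<Longrightarrow> green_fun w z \<le> h w"
    and x: "x \<in> carrier G"
    and path: "\<And>p q. p 0 = x \<Longrightarrow> p q = z \<Longrightarrow> (\<And>i. i < q \<Longrightarrow> \<exists>s\<in>T. p (Suc i) = p i \<otimes> s) \<Longrightarrow>
      q < K \<Longrightarrow> \<exists>i\<le>q. p i \<in> A"
  shows "green_fun x z \<le> h x + (P ^^ K) (\<lambda>y. green_fun y z) x"
  using x path
proof (induction K arbitrary: x)
  case 0
  then show ?case using h(1) by simp
next
  case (Suc K)
  have pow_nonneg: "0 \<le> (P ^^ k) (\<lambda>y. green_fun y z) y" if "y \<in> carrier G" for k y
    using that by (induction k arbitrary: y) (auto intro: P_nonneg green_fun_nonneg z)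
  show ?case
  proof (cases "x \<in> A")
    case True
    then show ?thesis using A[OF Suc.prems(1)] pow_nonneg[OF Suc.prems(1), of "Suc K"] by linarith
  next
    case False
    have "x \<noteq> z" using Suc.prems(2)[of "\<lambda>_. x" 0] False by auto
    then have "green_fun x z = P (\<lambda>y. green_fun y z) x" using green_fun_eq[OF Suc.prems(1) z] by simp
    also have "\<dots> \<le> P (\<lambda>y. h y + (P ^^ K) (\<lambda>y. green_fun y z) y) x"
    proof (rule P_mono_T)
      fix s assume s: "s \<in> T"
      show "green_fun (x \<otimes> s) z \<le> h (x \<otimes> s) + (P ^^ K) (\<lambda>y. green_fun y z) (x \<otimes> s)"
      proof (rule Suc.IH)
        show "x \<otimes> s \<in> carrier G" using s Suc.prems by simp
        fix p q assume p: "p 0 = x \<otimes> s" "p q = z" "\<And>i. i < q \<Longrightarrow> \<exists>s\<in>T. p (Suc i) = p i \<otimes> s" "q < K"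
        have "\<exists>i\<le>Suc q. case_nat x p i \<in> A"
        proof (rule Suc.prems(2))
          show "\<exists>s\<in>T. case_nat x p (Suc i) = case_nat x p i \<otimes> s" if "i < Suc q" for i
            using that p s by (cases i) auto
        qed (use p in auto)
        then obtain i where i: "i \<le> Suc q" "case_nat x p i \<in> A" by blast
        then show "\<exists>i\<le>q. p i \<in> A" using False by (cases i) auto
      qed
    qed
    also have "\<dots> = P h x + (P ^^ Suc K) (\<lambda>y. green_fun y z) x" by (simp add: P_add)
    also have "\<dots> \<le> h x + (P ^^ Suc K) (\<lambda>y. green_fun y z) x" using h(2)[OF Suc.prems(1)] by simp
    finally show ?thesis .
  qed
qed

text \<open>Paths with fewer than \<open>2 ^ K\<close> steps meet the barrier at position
  \<open>t\<close>, and the others together contribute at most the last summand. The estimate at the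
  barrier reaches \<open>x\<close> with the same factor \<open>H\<close> and an additive error only,
  so it can be iterated without compounding constants.\<close>

lemma ancona_step:
  assumes c: "x \<in> carrier G" "y \<in> carrier G" "z \<in> carrier G" and t: "0 \<le> t" "t \<le> d x z" and H: "0 \<le> H"
    and A: "\<And>w. w \<in> carrier G \<Longrightarrow> along x z t w \<le> \<rho> / 2 + real K * \<eta> + 1 \<Longrightarrow> green_fun w z \<le> H * green_fun w y * green_fun y z"
  shows "green_fun x z \<le> H * green_fun x y * green_fun y z + 2 * (1 / 2) ^ (2 ^ K)"
proof -
  let ?h = "\<lambda>w. H * green_fun y z * green_fun w y"
  have "green_fun x z \<le> ?h x + (P ^^ (2 ^ K)) (\<lambda>y. green_fun y z) x"
  proof (rule barrier[OF c(3) _ _ _ c(1)])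
    show "0 \<le> ?h w" if "w \<in> carrier G" for w using that c H green_fun_nonneg by simp
    show "P ?h w \<le> ?h w" if "w \<in> carrier G" for w
      unfolding P_cmult using that c H green_fun_nonneg by (intro mult_left_mono green_fun_super) auto
    show "green_fun w z \<le> ?h w" if "w \<in> carrier G" "w \<in> {w. along x z t w \<le> \<rho> / 2 + real K * \<eta> + 1}" for w
      using A[of w] that by (simp add: mult.commute mult.left_commute)
    show "\<exists>i\<le>q. p i \<in> {w. along x z t w \<le> \<rho> / 2 + real K * \<eta> + 1}"
      if "p 0 = x" "p q = z" "\<And>i. i < q \<Longrightarrow> \<exists>s\<in>T. p (Suc i) = p i \<otimes> s" "q < 2 ^ K" for p q
      using T_path_hits[OF c(1,3) t that(1-3)] that(4) by auto
  qed
  also have "(P ^^ (2 ^ K)) (\<lambda>y. green_fun y z) x \<le> 2 * (1 / 2) ^ (2 ^ K) * \<phi> z x"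
    using c by (intro P_pow_le green_fun_le_\<phi>) auto
  also have "\<dots> \<le> 2 * (1 / 2) ^ (2 ^ K)" using \<phi>_le_1[OF c(1,3)] by (simp add: mult_left_le)
  finally show ?thesis by (simp add: mult.commute mult.left_commute)
qed

text \<open>At bounded distance from \<open>x\<close> to \<open>y\<close> the lower bound gives
  \<open>green_fun x y\<close> a positive constant below, and \<open>green_fun_triangle\<close>
  moves \<open>x\<close> to \<open>y\<close> at the cost of another such constant.\<close>

lemma ancona_near:
  assumes c: "x \<in> carrier G" "y \<in> carrier G" "z \<in> carrier G"
    and lower: "\<And>x z. x \<in> carrier G \<Longrightarrow> z \<in> carrier G \<Longrightarrow> exp (- (c\<^sub>1 * d x z + c\<^sub>2)) \<le> green_fun x z"
    and c1: "0 \<le> c\<^sub>1" and M: "d x y \<le> M"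
  shows "green_fun x z \<le> green_fun \<one> \<one> * exp (2 * (c\<^sub>1 * M + c\<^sub>2)) * green_fun x y * green_fun y z"
proof -
  have "exp (- (c\<^sub>1 * M + c\<^sub>2)) \<le> exp (- (c\<^sub>1 * d x y + c\<^sub>2))" using M c1 by (simp add: mult_left_mono)
  also have "\<dots> \<le> green_fun x y" using lower c by blast
  finally have low: "exp (- (c\<^sub>1 * M + c\<^sub>2)) \<le> green_fun x y" .
  have E: "0 \<le> exp (c\<^sub>1 * M + c\<^sub>2)" by simp
  have l: "1 \<le> exp (c\<^sub>1 * M + c\<^sub>2) * green_fun x y"
    using mult_left_mono[OF low E] by (simp only: exp_minus_inverse)
  have p: "0 \<le> green_fun x z" "0 \<le> green_fun y z" "0 \<le> green_fun x y" using green_fun_nonneg c by auto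
  have tri: "green_fun x y * green_fun x z \<le> green_fun \<one> \<one> * green_fun y z" using green_fun_triangle[of y x z] green_fun_sym[of x y] c by simp
  have "green_fun x z \<le> exp (c\<^sub>1 * M + c\<^sub>2) * green_fun x y * green_fun x z" using mult_right_mono[OF l p(1)] by simp
  also have "\<dots> = exp (c\<^sub>1 * M + c\<^sub>2) * (green_fun x y * green_fun x z)" by simp
  also have "\<dots> \<le> exp (c\<^sub>1 * M + c\<^sub>2) * (green_fun \<one> \<one> * green_fun y z)" by (intro mult_left_mono tri E)
  also have "\<dots> \<le> exp (c\<^sub>1 * M + c\<^sub>2) * (green_fun \<one> \<one> * green_fun y z) * (exp (c\<^sub>1 * M + c\<^sub>2) * green_fun x y)"
  proof -
    have "0 \<le> exp (c\<^sub>1 * M + c\<^sub>2) * (green_fun \<one> \<one> * green_fun y z)" using p green_fun_one_ge_1 by simp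
    from mult_left_mono[OF l this] show ?thesis by simp
  qed
  also have "\<dots> = green_fun \<one> \<one> * (exp (c\<^sub>1 * M + c\<^sub>2) * exp (c\<^sub>1 * M + c\<^sub>2)) * green_fun x y * green_fun y z"
    by (simp add: mult.commute mult.left_commute)
  also have "exp (c\<^sub>1 * M + c\<^sub>2) * exp (c\<^sub>1 * M + c\<^sub>2) = exp (2 * (c\<^sub>1 * M + c\<^sub>2))"
    by (simp add: exp_add[symmetric])
  finally show ?thesis .
qed

text \<open>\<open>K\<close> is of the order of the logarithm of \<open>M\<close> plus a constant:
  enough for \<open>2 ^ K\<close> to exceed a linear function of \<open>M\<close>, while the barrier
  radius is still a small fraction of \<open>M\<close>. The second factor on the right is the square
  of the Harnack bound at distance \<open>M\<close>.\<close>

lemma ancona_scale: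
  assumes "0 \<le> c\<^sub>1" "0 \<le> c\<^sub>2"
  shows "\<exists>M0. \<forall>M\<ge>M0. \<exists>K. \<rho> / 2 + real K * \<eta> + 1 \<le> M / 32 \<and>
    (\<forall>k. real k \<le> M \<longrightarrow> 2 * (1 / 2) ^ (2 ^ K) \<le> (1 / 4) ^ k * exp (- 2 * (c\<^sub>1 * M + c\<^sub>2)))"
proof -
  \<comment> \<open>Cancels the factor 6 of \<open>rough_geodesic_const\<close> at
    \<open>D = M / 32\<close> and leaves \<open>(2 + 4 * c\<^sub>1) * M\<close>.\<close>
  define A where "A = 32 * (2 + 4 * c\<^sub>1) / 6"
  obtain D0 where D0: "\<And>D. D \<ge> D0 \<Longrightarrow> \<exists>k. A * (6 * D + 2 * \<eta>) + (1 + 4 * c\<^sub>2) \<le> 2 ^ k \<and>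
      \<rho> + 2 * real k * \<eta> + 4 * \<eta> < 2 * (D - 1)"
    using rough_geodesic_const[of A \<rho> "1 + 4 * c\<^sub>2"] rho_nonneg assms unfolding A_def by auto
  show ?thesis
  proof (intro exI[of _ "32 * D0"] allI impI)
    fix M assume "32 * D0 \<le> M"
    then obtain K where K: "A * (6 * (M / 32) + 2 * \<eta>) + (1 + 4 * c\<^sub>2) \<le> 2 ^ K"
      "\<rho> + 2 * real K * \<eta> + 4 * \<eta> < 2 * (M / 32 - 1)" using D0[of "M / 32"] by auto
    have "A * (6 * (M / 32)) \<le> A * (6 * (M / 32) + 2 * \<eta>)"
      using assms eta_nonneg unfolding A_def by (intro mult_left_mono) auto
    moreover have "A * (6 * (M / 32)) = (2 + 4 * c\<^sub>1) * M" unfolding A_def by simp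
    ultimately have "(2 + 4 * c\<^sub>1) * M + (1 + 4 * c\<^sub>2) \<le> 2 ^ K" using K(1) by linarith
    \<comment> \<open>The 1 pays for the factor 2 and \<open>2 * M\<close> for
      \<open>(1 / 4) ^ k\<close>; the coefficient is 4 rather than 2 because only
      \<open>1 / 2 \<le> ln 2\<close> is used.\<close>
    then have K1: "1 + 2 * M + 4 * (c\<^sub>1 * M + c\<^sub>2) \<le> 2 ^ K" by (simp add: algebra_simps)
    have K2: "\<rho> / 2 + real K * \<eta> + 1 \<le> M / 32" using K(2) eta_nonneg by simp
    have "2 * (1 / 2) ^ (2 ^ K) \<le> (1 / 4) ^ k * exp (- 2 * (c\<^sub>1 * M + c\<^sub>2))" if k: "real k \<le> M" for k
    proof -
      have ln4: "ln (4::real) = 2 * ln 2" using ln_realpow[of 2 2] by simp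
      have "ln (exp 1) \<le> ln (4::real)" using exp_le by (subst ln_le_cancel_iff) auto
      then have l2: "1 / 2 \<le> ln (2::real)" "ln (2::real) \<ge> 0" unfolding ln4 by auto
      have M0: "0 \<le> M" using k by linarith
      have "2 * (c\<^sub>1 * M + c\<^sub>2) \<le> ln 2 * (4 * (c\<^sub>1 * M + c\<^sub>2))"
        using mult_right_mono[OF l2(1), of "4 * (c\<^sub>1 * M + c\<^sub>2)"] assms M0 by simp
      then have "ln 2 + real k * ln 4 + 2 * (c\<^sub>1 * M + c\<^sub>2) \<le> ln 2 * (1 + 2 * real k + 4 * (c\<^sub>1 * M + c\<^sub>2))"
        unfolding ln4 by (simp add: algebra_simps)
      also have "\<dots> \<le> ln 2 * 2 ^ K" using K1 k l2 by (intro mult_left_mono) auto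
      finally have e: "ln 2 - 2 ^ K * ln 2 \<le> - real k * ln 4 - 2 * (c\<^sub>1 * M + c\<^sub>2)" by (simp add: mult.commute)
      have pow: "exp (- (real n * ln x)) = (1 / x) ^ n" if "0 < x" for n and x :: real
        using that exp_of_nat_mult[of n "ln x"] by (simp add: exp_minus power_one_over inverse_eq_divide)
      have "exp (ln 2 - 2 ^ K * ln (2::real)) = exp (ln 2) * exp (- (real (2 ^ K) * ln 2))"
        unfolding exp_add[symmetric] by simp
      also have "\<dots> = 2 * (1 / 2) ^ (2 ^ K)" by (subst pow) auto
      finally have "2 * (1 / 2) ^ (2 ^ K) = exp (ln 2 - 2 ^ K * ln (2::real))" by (rule sym)
      also have "\<dots> \<le> exp (- real k * ln 4 - 2 * (c\<^sub>1 * M + c\<^sub>2))" using e by simp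
      also have "\<dots> = exp (- (real k * ln 4)) * exp (- 2 * (c\<^sub>1 * M + c\<^sub>2))"
        unfolding exp_add[symmetric] by simp
      also have "\<dots> = (1 / 4) ^ k * exp (- 2 * (c\<^sub>1 * M + c\<^sub>2))" by (subst pow) auto
      finally show ?thesis .
    qed
    then show "\<exists>K. \<rho> / 2 + real K * \<eta> + 1 \<le> M / 32 \<and>
      (\<forall>k. real k \<le> M \<longrightarrow> 2 * (1 / 2) ^ (2 ^ K) \<le> (1 / 4) ^ k * exp (- 2 * (c\<^sub>1 * M + c\<^sub>2)))"
      using K2 by blast
  qed
qed

text \<open>The proof replaces \<open>x\<close> or \<open>z\<close>, whichever is farther from \<open>y\<close>, by the points of a barrier at
  about a quarter of the distance. The levels \<open>k\<close> and \<open>j\<close> count the remaining steps. As every step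
  can decrease the Gromov products with the original endpoints \<open>x0\<close> and \<open>z0\<close> by \<open>\<eta>\<close>, the
  bounds required of them decrease with the level.\<close>

lemma ancona:
  assumes "0 \<le> \<kappa>"
  shows "\<exists>C>0. \<forall>x\<in>carrier G. \<forall>y\<in>carrier G. \<forall>z\<in>carrier G. gp y x z \<le> \<kappa> \<longrightarrow> green_fun x z \<le> C * green_fun x y * green_fun y z"
proof -
  obtain c\<^sub>1 c\<^sub>2 where c12: "0 \<le> c\<^sub>1" "0 \<le> c\<^sub>2"
    and lower: "\<And>x z. x \<in> carrier G \<Longrightarrow> z \<in> carrier G \<Longrightarrow> exp (- (c\<^sub>1 * d x z + c\<^sub>2)) \<le> green_fun x z"
    using green_fun_lower by blast
  obtain M1 where M1: "\<And>M. M \<ge> M1 \<Longrightarrow> \<exists>K. \<rho> / 2 + real K * \<eta> + 1 \<le> M / 32 \<and>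
    (\<forall>k. real k \<le> M \<longrightarrow> 2 * (1 / 2) ^ (2 ^ K) \<le> (1 / 4) ^ k * exp (- 2 * (c\<^sub>1 * M + c\<^sub>2)))"
    using ancona_scale[OF c12] by blast
  \<comment> \<open>Exchanging both original endpoints for the current points costs
    \<open>\<eta>\<close> twice, hence \<kappa>'. As \<open>B\<close> exceeds this value, in
    \<open>gp_cases\<close> the alternative that would bound the product with the original endpoint
    is excluded.\<close>
  define \<kappa>' where "\<kappa>' = \<kappa> + 2 * \<eta>"
  define B where "B = \<kappa> + 2 * \<eta> + 1"
  have kB: "0 \<le> \<kappa>'" "1 \<le> B" unfolding \<kappa>'_def B_def using assms eta_nonneg by auto
  \<comment> \<open>Makes the geometric constants, and through \<open>k_M\<close> also
    \<open>k * \<eta>\<close>, at most \<open>M k / 32\<close> at every level.\<close>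
  define M0 where "M0 = max M1 (32 * (B + \<kappa>' + \<eta> + 1))"
  have M0: "M1 \<le> M0" "32 * (B + \<kappa>' + \<eta> + 1) \<le> M0" unfolding M0_def by auto
  have M0_pos: "1 \<le> M0" using M0(2) kB eta_nonneg by simp
  define M where "M k = M0 * 2 ^ k" for k :: nat
  have M_ge: "M0 \<le> M k" for k unfolding M_def using M0_pos by simp
  have M_mono: "M j \<le> M k" if "j \<le> k" for j k unfolding M_def using M0_pos that by simp
  have M_Suc: "M (Suc k) = 2 * M k" for k unfolding M_def by simp
  have k_M: "M0 * real k \<le> M k" for k
    unfolding M_def using M0_pos of_nat_less_two_power[of k] by (intro mult_left_mono) (auto simp: less_imp_le)
  define H0 where "H0 = green_fun \<one> \<one> * exp (2 * (c\<^sub>1 * M0 + c\<^sub>2))"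
  have H0: "0 \<le> H0" unfolding H0_def using green_fun_one_ge_1 by simp
  have near: "green_fun x z \<le> H0 * green_fun x y * green_fun y z"
    if "x \<in> carrier G" "y \<in> carrier G" "z \<in> carrier G" "d x y \<le> M0" for x y z
    unfolding H0_def by (rule ancona_near[OF that(1-3) lower c12(1) that(4)])
  \<comment> \<open>The factor starts at \<open>H0\<close> and grows by
    \<open>(1 / 2) ^ Suc n\<close> from one level to the next, so it never exceeds
    \<open>H0 + 1\<close>.\<close>
  define Hn where "Hn n = H0 + 1 - (1 / 2) ^ n" for n :: nat
  have Hn: "0 \<le> Hn n" "Hn n \<le> H0 + 1" "Hn (Suc n) = Hn n + (1 / 2) ^ Suc n" for n
    unfolding Hn_def using H0 power_le_one[of "1 / 2 :: real" n] by (auto simp del: power_Suc) (simp add: field_simps)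
  define cond where "cond y x0 z0 x z k j \<longleftrightarrow> x0 \<in> carrier G \<and> z0 \<in> carrier G \<and> x \<in> carrier G \<and> z \<in> carrier G \<and>
     gp y x0 z0 \<le> \<kappa> \<and> d x y \<le> M k \<and> d z y \<le> M j \<and> B + real k * \<eta> \<le> gp y x x0 \<and> B + real j * \<eta> \<le> gp y z z0"
    for y x0 z0 x z and k j :: nat
  have main: "\<forall>x0 z0 x z k j. k + j = n \<longrightarrow> cond y x0 z0 x z k j \<longrightarrow> green_fun x z \<le> Hn n * green_fun x y * green_fun y z"
    if y: "y \<in> carrier G" for y n
  proof (induction n)
    case 0
    have "green_fun x z \<le> Hn 0 * green_fun x y * green_fun y z" if "cond y x0 z0 x z 0 0" for x0 z0 x z
      using near[of x y z] that y unfolding cond_def Hn_def M_def by simp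
    then show ?case by simp
  next
    case (Suc n)
    have step: "green_fun x z \<le> Hn (Suc n) * green_fun x y * green_fun y z"
      if kj: "k + j = Suc n" "j \<le> k" and cnd: "cond y x0 z0 x z k j" for x0 z0 x z k j
    proof -
      have c: "x0 \<in> carrier G" "z0 \<in> carrier G" "x \<in> carrier G" "z \<in> carrier G" using cnd unfolding cond_def by auto
      have cc: "gp y x0 z0 \<le> \<kappa>" "d x y \<le> M k" "d z y \<le> M j" "B + real k * \<eta> \<le> gp y x x0" "B + real j * \<eta> \<le> gp y z z0"
        using cnd unfolding cond_def by auto
      obtain i where k: "k = Suc i" using kj by (cases k) auto
      have prods: "0 \<le> green_fun x y * green_fun y z" using c y green_fun_nonneg by simp
      have keta: "0 \<le> real k * \<eta>" "0 \<le> real j * \<eta>" using eta_nonneg by auto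
      have k2: "real k * \<eta> = real i * \<eta> + \<eta>" unfolding k by (simp add: algebra_simps)
      show ?thesis
      proof (cases "d x y \<le> M i")
        case True
        then have "cond y x0 z0 x z i j" using cnd k2 eta_nonneg unfolding cond_def by auto
        then have "green_fun x z \<le> Hn n * green_fun x y * green_fun y z" using Suc.IH kj k by simp
        also have "\<dots> \<le> Hn (Suc n) * green_fun x y * green_fun y z"
          using mult_right_mono[OF _ prods, of "Hn n" "Hn (Suc n)"] Hn(3)[of n] by (simp add: mult.assoc)
        finally show ?thesis .
      next
        case False
        define m where "m = d x y"
        have m: "M k / 2 < m" "m \<le> M k" unfolding m_def using False cc k M_Suc[of i] by auto
        have Mk: "2 * M0 \<le> M k" using M_ge[of i] M_Suc[of i] k by simp
        have xz: "gp y x z \<le> \<kappa>'"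
        proof -
          have "gp y x0 x = gp y x x0" using c y by (intro gp_sym)
          then have "gp y x z0 \<le> \<kappa> + \<eta>"
            using gp_cases[of x0 x z0 y] cc(1,4) keta c y eta_nonneg unfolding B_def by auto
          then show ?thesis
            using gp_cases[of x z z0 y] cc(5) keta c y eta_nonneg unfolding B_def \<kappa>'_def by auto
        qed
        have dxz: "d x z = m + d z y - 2 * gp y x z"
          unfolding gromov_product_def m_def using d_sym[of y z] c y by (simp add: field_simps)
        have dzy: "0 \<le> d z y" using c y d_nonneg by simp
        \<comment> \<open>A barrier three quarters of the way from \<open>x\<close> to
          \<open>y\<close>: its points are at distance about \<open>m / 4\<close> from
          \<open>y\<close>, which fits below \<open>M i = M k / 2\<close>, and their product with
          \<open>x\<close> is also about \<open>m / 4\<close> or more, enough for the bound at level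
          \<open>i\<close>.\<close>
        define t where "t = 3 / 4 * m"
        have t: "0 \<le> t" "t \<le> d x z" using m dxz dzy xz M0(2) Mk kB eta_nonneg unfolding t_def by auto
        obtain K where K: "\<rho> / 2 + real K * \<eta> + 1 \<le> M k / 32"
          "\<And>k'. real k' \<le> M k \<Longrightarrow> 2 * (1 / 2) ^ (2 ^ K) \<le> (1 / 4) ^ k' * exp (- 2 * (c\<^sub>1 * M k + c\<^sub>2))"
          using M1[of "M k"] M0(1) M_ge[of k] by force
        have small: "real k * \<eta> \<le> M k / 32"
        proof -
          have "32 * \<eta> * real k \<le> M0 * real k" using M0(2) kB by (intro mult_right_mono) auto
          moreover have "32 * \<eta> * real k = 32 * (real k * \<eta>)" by simp
          ultimately show ?thesis using k_M[of k] by linarith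
        qed
        have bound: "green_fun w z \<le> Hn n * green_fun w y * green_fun y z"
          if w: "w \<in> carrier G" "along x z t w \<le> \<rho> / 2 + real K * \<eta> + 1" for w
        proof -
          have b: "d x w \<le> t + M k / 32" "d w z \<le> d x z - t + M k / 32"
            using w(2) K(1) unfolding along_def by auto
          have "d x z + d w y \<le> max (d x w + d z y) (d w z + d x y) + 2 * \<eta>"
            using four_point[of x w z y] w c y by simp
          then have "d w y \<le> m / 4 + M k / 32 + 2 * \<kappa>' + 2 * \<eta>"
            using b dxz xz kB m t unfolding m_def[symmetric] t_def by (auto simp: max_def split: if_splits)
          then have dwy: "d w y \<le> M i" using m Mk M0(2) kB M_Suc[of i] k by simp
          have "gp y w x = gp y x w" using w c y by (intro gp_sym)
          then have "m - d x w \<le> gp y w x"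
            using gp_compl[of x w y] gp_le[of w y x] gp_sym[of y w x] w c y d_sym[of x y] unfolding m_def by simp
          then have wx: "B + real k * \<eta> \<le> gp y w x"
            using b(1) small m Mk M0(2) kB eta_nonneg unfolding t_def by simp
          have "B + real i * \<eta> \<le> gp y w x0"
            using gp_cases[of w x x0 y] wx cc(4) w c y k2 by auto
          then have "cond y x0 z0 w z i j" unfolding cond_def using c w cc dwy by simp
          then show ?thesis using Suc.IH kj k by simp
        qed
        have "green_fun x z \<le> Hn n * green_fun x y * green_fun y z + 2 * (1 / 2) ^ (2 ^ K)"
          by (rule ancona_step[OF c(3) y c(4) t Hn(1) bound])
        \<comment> \<open>The error is absorbed into the factor: both Green functions are at least
          the Harnack bound at distance \<open>M k\<close>, and \<open>k + j = Suc n\<close> with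
          \<open>j \<le> k\<close> gives \<open>Suc n \<le> 2 * k\<close>.\<close>
        also have "2 * (1 / 2) ^ (2 ^ K) \<le> (1 / 2) ^ Suc n * (green_fun x y * green_fun y z)"
        proof -
          have kM: "real k \<le> M k" using k_M[of k] M0_pos mult_right_mono[of 1 M0 "real k"] by simp
          have "exp (- (c\<^sub>1 * M k + c\<^sub>2)) \<le> exp (- (c\<^sub>1 * d x y + c\<^sub>2))" using cc c12 by (simp add: mult_left_mono)
          then have g1: "exp (- (c\<^sub>1 * M k + c\<^sub>2)) \<le> green_fun x y" using lower[OF c(3) y] by (rule order_trans)
          have "d y z \<le> M k" using cc(3) M_mono[OF kj(2)] d_sym[of y z] c y by simp
          then have "exp (- (c\<^sub>1 * M k + c\<^sub>2)) \<le> exp (- (c\<^sub>1 * d y z + c\<^sub>2))" using c12 by (simp add: mult_left_mono)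
          then have g2: "exp (- (c\<^sub>1 * M k + c\<^sub>2)) \<le> green_fun y z" using lower[OF y c(4)] by (rule order_trans)
          have "exp (- 2 * (c\<^sub>1 * M k + c\<^sub>2)) = exp (- (c\<^sub>1 * M k + c\<^sub>2)) * exp (- (c\<^sub>1 * M k + c\<^sub>2))"
            by (simp add: exp_add[symmetric])
          also have "\<dots> \<le> green_fun x y * green_fun y z" using g1 g2 c y green_fun_nonneg by (intro mult_mono) auto
          finally have g: "exp (- 2 * (c\<^sub>1 * M k + c\<^sub>2)) \<le> green_fun x y * green_fun y z" .
          have "2 * (1 / 2) ^ (2 ^ K) \<le> (1 / 4) ^ k * exp (- 2 * (c\<^sub>1 * M k + c\<^sub>2))" by (rule K(2)[OF kM])
          also have "(1 / 4 :: real) ^ k = (1 / 2) ^ (2 * k)" by (simp add: power_mult power2_eq_square)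
          also have "(1 / 2 :: real) ^ (2 * k) \<le> (1 / 2) ^ Suc n" using kj by (intro power_decreasing) auto
          finally show ?thesis using g by (meson mult_left_mono mult_right_mono exp_ge_zero order_trans zero_le_power zero_le_divide_1_iff zero_le_numeral)
        qed
        finally show ?thesis unfolding Hn(3) by (simp add: algebra_simps)
      qed
    qed
    show ?case
    proof (intro allI impI)
      fix x0 z0 x z k j assume kj: "k + j = Suc n" and cnd: "cond y x0 z0 x z k j"
      show "green_fun x z \<le> Hn (Suc n) * green_fun x y * green_fun y z"
      proof (cases "j \<le> k")
        case True
        then show ?thesis using step[OF kj True cnd] by simp
      next
        case False
        have c: "x0 \<in> carrier G" "z0 \<in> carrier G" "x \<in> carrier G" "z \<in> carrier G" using cnd unfolding cond_def by auto
        have "cond y z0 x0 z x j k" using cnd gp_sym[of x0 z0 y] y unfolding cond_def by auto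
        then have "green_fun z x \<le> Hn (Suc n) * green_fun z y * green_fun y x" using kj False by (intro step) auto
        then show ?thesis using green_fun_sym[of x z] green_fun_sym[of x y] green_fun_sym[of y z] c y by (simp add: mult.commute mult.left_commute)
      qed
    qed
  qed
  have level: "\<exists>k. d x y \<le> M k \<and> B + real k * \<eta> \<le> gp y x x" if c: "x \<in> carrier G" "y \<in> carrier G" and far: "M0 < d x y" for x y
  proof -
    obtain n :: nat where "d x y \<le> real n" using real_arch_simple by blast
    also have "real n \<le> M0 * real n" using M0_pos mult_right_mono[of 1 M0 "real n"] by simp
    also have "\<dots> \<le> M n" by (rule k_M)
    finally have ex: "\<exists>n. d x y \<le> M n" by blast
    \<comment> \<open>With the least level, \<open>d x y\<close> still exceeds half of
      \<open>M k\<close>, which leaves room for the required product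
      \<open>B + k * \<eta>\<close>.\<close>
    define k where "k = (LEAST n. d x y \<le> M n)"
    have k: "d x y \<le> M k" unfolding k_def using LeastI_ex[OF ex] .
    then obtain i where i: "k = Suc i" using far unfolding M_def by (cases k) auto
    then have "M i < d x y" using not_less_Least[of i "\<lambda>n. d x y \<le> M n"] unfolding k_def by simp
    moreover have "B + real k * \<eta> \<le> M i"
    proof -
      have p: "1 + real i \<le> 2 ^ i" using of_nat_less_two_power[of i] by (metis add.commute less_eq_Suc_le of_nat_Suc of_nat_le_iff of_nat_numeral of_nat_power of_nat_less_iff)
      have "B + real k * \<eta> \<le> B * (1 + real i) + \<eta> * (1 + real i)" unfolding i using kB by (simp add: algebra_simps)
      also have "\<dots> = (B + \<eta>) * (1 + real i)" by (simp add: algebra_simps)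
      also have "\<dots> \<le> M0 * 2 ^ i" using p M0(2) kB eta_nonneg by (intro mult_mono) auto
      finally show ?thesis unfolding M_def .
    qed
    ultimately show ?thesis using k gp_self[of x y] d_sym[of x y] c by (intro exI[of _ k]) auto
  qed
  show ?thesis
  proof (intro exI[of _ "H0 + 1"] conjI ballI impI)
    show "0 < H0 + 1" using H0 by simp
    fix x y z assume c: "x \<in> carrier G" "y \<in> carrier G" "z \<in> carrier G" and xz: "gp y x z \<le> \<kappa>"
    have prods: "0 \<le> green_fun x y * green_fun y z" using c green_fun_nonneg by simp
    have le: "green_fun x z \<le> (H0 + 1) * green_fun x y * green_fun y z" if "green_fun x z \<le> H * green_fun x y * green_fun y z" "H \<le> H0 + 1" for H
      using mult_right_mono[OF that(2) prods] that(1) by (simp add: mult.assoc)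
    show "green_fun x z \<le> (H0 + 1) * green_fun x y * green_fun y z"
    proof (cases "d x y \<le> M0 \<or> d z y \<le> M0")
      case True
      then have "green_fun x z \<le> H0 * green_fun x y * green_fun y z"
        using near[of x y z] near[of z y x] green_fun_sym[of x z] green_fun_sym[of x y] green_fun_sym[of y z] c
        by (auto simp: mult.commute mult.left_commute)
      then show ?thesis by (intro le) auto
    next
      case False
      obtain k where k: "d x y \<le> M k" "B + real k * \<eta> \<le> gp y x x" using level[of x y] False c by auto
      obtain j where j: "d z y \<le> M j" "B + real j * \<eta> \<le> gp y z z" using level[of z y] False c by auto
      have "cond y x z x z k j" unfolding cond_def using c xz k j by simp
      then have "green_fun x z \<le> Hn (k + j) * green_fun x y * green_fun y z" using main[OF c(2)] by blast
      then show ?thesis using Hn(2) by (rule le)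
    qed
  qed
qed

end

section \<open>Hyperbolicity of the Green metric\<close>

lemma (in hyp_space) gp_eq_of_triangle: "d p x + d p y \<le> d x y + 2 * c \<Longrightarrow> x \<in> X \<Longrightarrow> p \<in> X \<Longrightarrow> gp p x y \<le> c"
  unfolding gromov_product_def using d_sym[of x p] by (simp add: field_simps)

context hyp_group begin

text \<open>In a tree \<open>le\<close> says that the segments from \<open>x\<close> to
  \<open>y\<close> and from \<open>z\<close> to \<open>w\<close> meet, and the branch point of
  \<open>x\<close>, \<open>y\<close>, \<open>z\<close> lies on both. \<open>p\<close> is its
  analogue, at position \<open>gp x y z\<close> on a rough geodesic from \<open>x\<close> to
  \<open>y\<close>.\<close>

lemma crossing_point_aux:
  assumes c: "x \<in> carrier G" "y \<in> carrier G" "z \<in> carrier G" "w \<in> carrier G"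
    and le: "d x w + d y z \<le> d x y + d z w"
  shows "\<exists>p\<in>carrier G. gp p x y \<le> rg + 3 * \<eta> \<and> gp p z w \<le> rg + 3 * \<eta>"
proof -
  define t where "t = gp x y z"
  have t: "0 \<le> t" "t \<le> d x y" unfolding t_def using gp_nonneg gp_le c by auto
  have t2: "2 * t = d x y + d x z - d y z" unfolding t_def gromov_product_def using d_sym[of y x] c by simp
  obtain p where p: "p \<in> carrier G" "d x p \<le> t + rg" "d p y \<le> d x y - t + rg"
    using rg_point[OF c(1,2) t] by blast
  have s: "d p x = d x p" "d y p = d p y" "d z y = d y z" "d z p = d p z" "d w p = d p w" "d w y = d y w"
    using d_sym c p by auto
  have 1: "d x y + d z p \<le> max (d x z + d y p) (d z y + d x p) + 2 * \<eta>"
    using four_point[of x z y p] c p by simp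
  have 2: "d x y + d w p \<le> max (d x w + d y p) (d w y + d x p) + 2 * \<eta>"
    using four_point[of x w y p] c p by simp
  have 3: "d x z + d y w \<le> max (d x y + d z w) (d y z + d x w) + 2 * \<eta>"
    using four_point[of x y z w] c by simp
  have 4: "d x z + d y w \<le> d x y + d z w + 2 * \<eta>" using 3 le eta_nonneg by (simp add: max_def split: if_splits)
  have "d p x + d p y \<le> d x y + 2 * (rg + 3 * \<eta>)" using p s eta_nonneg by simp
  moreover have "d p z + d p w \<le> d z w + 2 * (rg + 3 * \<eta>)"
    using 1 2 4 le p t2 s eta_nonneg by (simp add: max_def split: if_splits)
  ultimately show ?thesis using gp_eq_of_triangle p c by blast
qed

lemma crossing_point:
  assumes c: "x \<in> carrier G" "y \<in> carrier G" "z \<in> carrier G" "w \<in> carrier G"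
  shows "\<exists>p\<in>carrier G. gp p x y \<le> rg + 3 * \<eta> \<and> gp p z w \<le> rg + 3 * \<eta> \<or>
    gp p x w \<le> rg + 3 * \<eta> \<and> gp p y z \<le> rg + 3 * \<eta>"
proof (cases "d x w + d y z \<le> d x y + d z w")
  case True
  then show ?thesis using crossing_point_aux[OF c] by blast
next
  case False
  then have "d x y + d w z \<le> d x w + d z y" using d_sym[of z w] d_sym[of y z] c by simp
  then obtain p where "p \<in> carrier G" "gp p x w \<le> rg + 3 * \<eta>" "gp p z y \<le> rg + 3 * \<eta>"
    using crossing_point_aux[OF c(1,4,3,2)] by blast
  then show ?thesis using gp_sym[of z y p] c by auto
qed

end

context green_group begin

text \<open>Division by \<open>green_fun \<one> \<one>\<close> makes the distance vanish on the
  diagonal and turns the Green function into a hitting probability; see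
  \<open>green_metric_eq\<close>.\<close>

definition green_dist :: "'a \<Rightarrow> 'a \<Rightarrow> real" where "green_dist x y = - ln (green_fun x y / green_fun \<one> \<one>)"

lemma green_fun_eq_green_dist: "x \<in> carrier G \<Longrightarrow> y \<in> carrier G \<Longrightarrow> green_fun x y = green_fun \<one> \<one> * exp (- green_dist x y)"
  unfolding green_dist_def using green_fun_pos[of x y] green_fun_one_ge_1 by simp

lemma green_dist_nonneg: "x \<in> carrier G \<Longrightarrow> y \<in> carrier G \<Longrightarrow> 0 \<le> green_dist x y"
  unfolding green_dist_def using green_fun_pos[of x y] green_fun_le_diag[of x y] green_fun_one_ge_1 by simp

lemma green_dist_refl: "x \<in> carrier G \<Longrightarrow> green_dist x x = 0"
  unfolding green_dist_def using green_fun_diag[of x] green_fun_one_ge_1 by simp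

lemma green_dist_sym: "x \<in> carrier G \<Longrightarrow> y \<in> carrier G \<Longrightarrow> green_dist x y = green_dist y x"
  unfolding green_dist_def by (simp add: green_fun_sym)

lemma green_dist_left: "g \<in> carrier G \<Longrightarrow> x \<in> carrier G \<Longrightarrow> y \<in> carrier G \<Longrightarrow> green_dist (g \<otimes> x) (g \<otimes> y) = green_dist x y"
  unfolding green_dist_def by (simp add: green_fun_left)

lemma green_dist_tri:
  assumes "x \<in> carrier G" "y \<in> carrier G" "z \<in> carrier G"
  shows "green_dist x z \<le> green_dist x y + green_dist y z"
proof -
  have g: "0 < green_fun \<one> \<one>" using green_fun_one_ge_1 by simp
  have "(green_fun \<one> \<one> * exp (- green_dist x y)) * (green_fun \<one> \<one> * exp (- green_dist y z)) \<le> green_fun \<one> \<one> * (green_fun \<one> \<one> * exp (- green_dist x z))"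
    using green_fun_triangle[OF assms]
    unfolding green_fun_eq_green_dist[OF assms(1,2)] green_fun_eq_green_dist[OF assms(2,3)] green_fun_eq_green_dist[OF assms(1,3)] .
  then have "(green_fun \<one> \<one> * green_fun \<one> \<one>) * exp (- green_dist x y - green_dist y z) \<le> (green_fun \<one> \<one> * green_fun \<one> \<one>) * exp (- green_dist x z)"
    by (simp add: exp_add[symmetric] exp_diff exp_minus divide_inverse ac_simps)
  then show ?thesis using g by simp
qed

lemma green_dist_ancona: "\<exists>C\<ge>0. \<forall>x\<in>carrier G. \<forall>y\<in>carrier G. \<forall>z\<in>carrier G.
   gp y x z \<le> rg + 3 * \<eta> \<longrightarrow> green_dist x y + green_dist y z \<le> green_dist x z + C"
proof -
  obtain C where C: "C > 0" "\<And>x y z. x \<in> carrier G \<Longrightarrow> y \<in> carrier G \<Longrightarrow> z \<in> carrier G \<Longrightarrow>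
    gp y x z \<le> rg + 3 * \<eta> \<Longrightarrow> green_fun x z \<le> C * green_fun x y * green_fun y z"
    using ancona[of "rg + 3 * \<eta>"] rg_nonneg eta_nonneg by auto
  define B where "B = C * green_fun \<one> \<one>"
  have B: "B > 0" unfolding B_def using C green_fun_one_ge_1 by simp
  have g: "0 < green_fun \<one> \<one>" using green_fun_one_ge_1 by simp
  have "green_dist x y + green_dist y z \<le> green_dist x z + max 0 (ln B)"
    if c: "x \<in> carrier G" "y \<in> carrier G" "z \<in> carrier G" and gp: "gp y x z \<le> rg + 3 * \<eta>" for x y z
  proof -
    have "green_fun \<one> \<one> * exp (- green_dist x z) \<le> C * (green_fun \<one> \<one> * exp (- green_dist x y)) * (green_fun \<one> \<one> * exp (- green_dist y z))"
      using C(2)[OF c gp] unfolding green_fun_eq_green_dist[OF c(1,2)] green_fun_eq_green_dist[OF c(2,3)] green_fun_eq_green_dist[OF c(1,3)] .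
    also have "\<dots> = green_fun \<one> \<one> * (B * exp (- green_dist x y - green_dist y z))"
      unfolding B_def by (simp add: exp_diff exp_minus divide_inverse ac_simps)
    also have "B * exp (- green_dist x y - green_dist y z) = exp (ln B - green_dist x y - green_dist y z)"
      using B by (simp add: exp_diff exp_minus divide_inverse ac_simps)
    finally have "- green_dist x z \<le> ln B - green_dist x y - green_dist y z" using g by simp
    then show ?thesis by simp
  qed
  then show ?thesis by (intro exI[of _ "max 0 (ln B)"]) auto
qed

text \<open>At the crossing point \<open>p\<close> two disjoint pairs are additive up to
  \<open>C\<close> by Ancona's inequality, while the triangle inequality through \<open>p\<close>
  bounds the sum for \<open>x\<close>, \<open>z\<close> and \<open>y\<close>, \<open>w\<close>. This
  is the four-point inequality.\<close>

lemma green_dist_hyperbolic: "gromov_hyperbolic (carrier G) green_dist"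
proof -
  obtain C where C: "C \<ge> 0" "\<And>x y z. x \<in> carrier G \<Longrightarrow> y \<in> carrier G \<Longrightarrow> z \<in> carrier G \<Longrightarrow>
     gp y x z \<le> rg + 3 * \<eta> \<Longrightarrow> green_dist x y + green_dist y z \<le> green_dist x z + C"
    using green_dist_ancona by blast
  have "gromov_product green_dist w x z \<ge> min (gromov_product green_dist w x y) (gromov_product green_dist w y z) - C"
    if c: "x \<in> carrier G" "y \<in> carrier G" "z \<in> carrier G" "w \<in> carrier G" for x y z w
  proof -
    obtain p where p: "p \<in> carrier G" "gp p x y \<le> rg + 3 * \<eta> \<and> gp p z w \<le> rg + 3 * \<eta> \<or>
      gp p x w \<le> rg + 3 * \<eta> \<and> gp p y z \<le> rg + 3 * \<eta>" using crossing_point[OF c] by blast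
    have tri: "green_dist x z \<le> green_dist x p + green_dist p z" "green_dist y w \<le> green_dist y p + green_dist p w" using green_dist_tri c p by auto
    have s: "green_dist w y = green_dist y w" "green_dist w z = green_dist z w" "green_dist w x = green_dist x w" "green_dist p y = green_dist y p" "green_dist p z = green_dist z p"
      using green_dist_sym c p by auto
    from p(2) have "green_dist x z + green_dist y w \<le> green_dist x y + green_dist z w + 2 * C \<or> green_dist x z + green_dist y w \<le> green_dist x w + green_dist y z + 2 * C"
      using C(2)[of x p y] C(2)[of z p w] C(2)[of x p w] C(2)[of y p z] c p(1) tri s by auto
    then show ?thesis unfolding gromov_product_def min_def using s C(1) by (auto simp: field_simps)
  qed
  then show ?thesis unfolding gromov_hyperbolic_def using C(1) by blast
qed

lemma green_dist_lower:
  assumes "x \<in> carrier G" "y \<in> carrier G"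
  shows "\<alpha> * d x y - ln 2 \<le> green_dist x y"
proof -
  have "green_fun \<one> \<one> * exp (- green_dist x y) \<le> 2 * exp (- \<alpha> * d x y)"
    using green_fun_le_\<phi>[OF assms] green_fun_eq_green_dist[OF assms] unfolding \<phi>_def by simp
  moreover have "1 * exp (- green_dist x y) \<le> green_fun \<one> \<one> * exp (- green_dist x y)" using green_fun_one_ge_1 by (intro mult_right_mono) auto
  ultimately have "exp (- green_dist x y) \<le> 2 * exp (- \<alpha> * d x y)" by linarith
  also have "\<dots> = exp (ln 2 - \<alpha> * d x y)" by (simp add: exp_diff exp_minus divide_inverse)
  finally have "exp (- green_dist x y) \<le> exp (ln 2 - \<alpha> * d x y)" .
  then show ?thesis by simp
qed

lemma green_dist_word_le:
  assumes "x \<in> carrier G" "set ws \<subseteq> T"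
  shows "green_dist x (x \<otimes> wprod ws) \<le> real (length ws) * ln N"
proof -
  have g: "0 < green_fun \<one> \<one>" using green_fun_one_ge_1 by simp
  have "set ws \<subseteq> carrier G" using assms T_carrier by auto
  then have "green_fun \<one> \<one> * (1 / N ^ length ws) \<le> green_fun \<one> \<one> * exp (- green_dist x (x \<otimes> wprod ws))"
    using green_fun_word_lower[OF assms] green_fun_eq_green_dist[of x "x \<otimes> wprod ws"] assms by simp
  then have "1 / N ^ length ws \<le> exp (- green_dist x (x \<otimes> wprod ws))"
    unfolding mult_le_cancel_left_pos[OF g] .
  then have "ln (1 / N ^ length ws) \<le> ln (exp (- green_dist x (x \<otimes> wprod ws)))"
    using N_ge_1 by (subst ln_le_cancel_iff) auto
  then show ?thesis using N_ge_1 by (simp add: ln_div ln_realpow)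
qed

lemma green_dist_upper:
  assumes "x \<in> carrier G" "y \<in> carrier G"
  shows "green_dist x y \<le> ln N * word_metric G T x y"
proof -
  obtain ws where ws: "set ws \<subseteq> T" "length ws = word_length G T (inv x \<otimes> y)" "wprod ws = inv x \<otimes> y"
    using word_length_word[OF T_gen, of "inv x \<otimes> y"] assms by auto
  have "x \<otimes> wprod ws = y" using assms ws(3) by (simp add: m_assoc[symmetric])
  then show ?thesis using green_dist_word_le[OF assms(1) ws(1)] unfolding word_metric_def ws(2)[symmetric]
    by (simp add: mult.commute)
qed

lemma green_dist_quasi_isometric: "quasi_isometric_id (carrier G) green_dist (word_metric G T)"
proof -
  obtain M where M: "M \<ge> 0" "\<And>x y. x \<in> carrier G \<Longrightarrow> y \<in> carrier G \<Longrightarrow>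
    word_metric G T x y \<le> M * word_metric G S x y" using T_S_compare by blast
  define L where "L = (M + 1) * a / \<alpha>"
  have L: "L > 0" unfolding L_def using M a_ge_1 \<alpha>_pos by simp
  define A where "A = max 1 (max (ln N) L)"
  define B where "B = \<alpha> * b + ln 2"
  have B: "0 \<le> B" unfolding B_def using \<alpha>_pos b_nonneg by simp
  have "word_metric G T x y / A - B \<le> green_dist x y \<and> green_dist x y \<le> A * word_metric G T x y + B"
    if c: "x \<in> carrier G" "y \<in> carrier G" for x y
  proof
    have wm: "0 \<le> word_metric G T x y" "0 \<le> word_metric G S x y" unfolding word_metric_def by auto
    have "word_metric G S x y \<le> a * (d x y + b)" using qi_lower[OF c] a_ge_1 by (simp add: field_simps)
    then have "M * word_metric G S x y \<le> M * (a * (d x y + b))" using M(1) by (intro mult_left_mono)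
    also have "\<dots> \<le> (M + 1) * (a * (d x y + b))"
      using a_ge_1 b_nonneg d_nonneg[OF c] by (intro mult_right_mono) auto
    also have "\<dots> = L * (\<alpha> * (d x y + b))" using \<alpha>_pos unfolding L_def by simp
    finally have "word_metric G T x y \<le> L * (\<alpha> * (d x y + b))" using M(2)[OF c] by simp
    then have "word_metric G T x y / L \<le> \<alpha> * (d x y + b)" using L by (simp add: field_simps)
    moreover have "word_metric G T x y / A \<le> word_metric G T x y / L"
      unfolding A_def using L wm by (intro divide_left_mono) auto
    ultimately show "word_metric G T x y / A - B \<le> green_dist x y"
      using green_dist_lower[OF c] unfolding B_def by (simp add: algebra_simps)
    have "ln N * word_metric G T x y \<le> A * word_metric G T x y" unfolding A_def using wm by (intro mult_right_mono) auto
    then show "green_dist x y \<le> A * word_metric G T x y + B" using green_dist_upper[OF c] B by simp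
  qed
  then show ?thesis unfolding quasi_isometric_id_def using B
    by (intro exI[of _ A] exI[of _ B] conjI) (auto simp: A_def)
qed

lemma hyp_metrics_green_dist:
  assumes "\<And>x y. x \<in> carrier G \<Longrightarrow> y \<in> carrier G \<Longrightarrow> D x y = green_dist x y"
  shows "D \<in> hyp_metrics G"
proof -
  have "gromov_hyperbolic (carrier G) D"
    using green_dist_hyperbolic unfolding gromov_hyperbolic_def gromov_product_def by (simp add: assms)
  moreover have "quasi_isometric_id (carrier G) D (word_metric G T)"
    using green_dist_quasi_isometric unfolding quasi_isometric_id_def by (simp add: assms)
  ultimately show ?thesis
    unfolding hyp_metrics_def using T_gen green_dist_nonneg green_dist_refl green_dist_sym green_dist_tri green_dist_left by (auto simp: assms)
qed

end

section \<open>Hitting probabilities\<close>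

text \<open>Conditioning on the first coordinate: \<open>PiM_iter\<close> presents the sequence
  space as the image of one coordinate times a fresh sequence under \<open>case_nat\<close>.\<close>

lemma PiM_pmf_of_set_shift:
  fixes T :: "'a set"
  defines "S \<equiv> \<Pi>\<^sub>M i\<in>(UNIV :: nat set). measure_pmf (pmf_of_set T)"
  assumes T: "finite T" "T \<noteq> {}" and A: "A \<in> sets S"
  shows "measure S A = (\<Sum>s\<in>T. measure S {\<omega>. case_nat s \<omega> \<in> A}) / real (card T)"
proof -
  let ?M = "measure_pmf (pmf_of_set T)"
  interpret sequence_space ?M
    by (intro sequence_space.intro product_prob_spaceI measure_pmf.prob_space_axioms)
  have S: "S = PiM UNIV (\<lambda>i. ?M)" unfolding S_def ..
  interpret PS: prob_space S unfolding S by (rule P.prob_space_axioms)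
  have sp: "space S = UNIV" unfolding S by (simp add: space_PiM)
  have meas: "(\<lambda>(s, \<omega>). case_nat s \<omega>) \<in> measurable (?M \<Otimes>\<^sub>M S) S" unfolding S by measurable
  have pre: "(\<lambda>(s, \<omega>). case_nat s \<omega>) -` A \<inter> space (?M \<Otimes>\<^sub>M S) \<in> sets (?M \<Otimes>\<^sub>M S)"
    using measurable_sets[OF meas A] .
  have "emeasure S A = emeasure (distr (?M \<Otimes>\<^sub>M S) S (\<lambda>(s, \<omega>). case_nat s \<omega>)) A"
    using PiM_iter unfolding S by simp
  also have "\<dots> = emeasure (?M \<Otimes>\<^sub>M S) ((\<lambda>(s, \<omega>). case_nat s \<omega>) -` A \<inter> space (?M \<Otimes>\<^sub>M S))"
    using meas A by (rule emeasure_distr)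
  also have "\<dots> = (\<integral>\<^sup>+s. emeasure S (Pair s -` ((\<lambda>(s, \<omega>). case_nat s \<omega>) -` A \<inter> space (?M \<Otimes>\<^sub>M S))) \<partial>?M)"
    using pre by (rule PS.emeasure_pair_measure_alt)
  also have "\<dots> = (\<integral>\<^sup>+s. emeasure S {\<omega>. case_nat s \<omega> \<in> A} \<partial>?M)"
    by (intro nn_integral_cong arg_cong2[of _ _ _ _ emeasure]) (auto simp: space_pair_measure sp)
  also have "\<dots> = (\<Sum>s\<in>T. emeasure S {\<omega>. case_nat s \<omega> \<in> A}) / real (card T)"
    using nn_integral_pmf_of_set[OF T(2,1)] by (simp add: ennreal_of_nat_eq_real_of_nat)
  also have "\<dots> = ennreal ((\<Sum>s\<in>T. measure S {\<omega>. case_nat s \<omega> \<in> A}) / real (card T))"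
    using T by (simp add: PS.emeasure_eq_measure sum_ennreal divide_ennreal sum_nonneg card_gt_0_iff)
  finally show ?thesis
    unfolding PS.emeasure_eq_measure by (subst (asm) ennreal_inj) (auto intro!: divide_nonneg_nonneg sum_nonneg)
qed

context group begin

lemma walk_closed: "(\<And>i. \<omega> i \<in> carrier G) \<Longrightarrow> walk G \<omega> k \<in> carrier G"
  by (induction k) auto

lemma walk_shift:
  assumes "\<And>i. \<omega> i \<in> carrier G" "s \<in> carrier G"
  shows "walk G (case_nat s \<omega>) (Suc k) = s \<otimes> walk G \<omega> k"
proof (induction k)
  case (Suc k)
  have "walk G (case_nat s \<omega>) (Suc (Suc k)) = walk G (case_nat s \<omega>) (Suc k) \<otimes> \<omega> k" by simp
  also have "\<dots> = s \<otimes> walk G \<omega> (Suc k)" unfolding Suc using assms walk_closed[of \<omega> k] by (simp add: m_assoc)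
  finally show ?case .
qed (use assms in simp)

end

section \<open>Hitting events and the identification of the Green metric\<close>

context green_group begin

abbreviation "\<Omega> \<equiv> \<Pi>\<^sub>M i\<in>(UNIV :: nat set). measure_pmf (pmf_of_set T)"

definition hit_at :: "nat \<Rightarrow> 'a \<Rightarrow> 'a \<Rightarrow> (nat \<Rightarrow> 'a) set" where
  "hit_at k z x = {\<omega>. (\<forall>i. \<omega> i \<in> T) \<and> x \<otimes> walk G \<omega> k = z}"

definition hit :: "'a \<Rightarrow> 'a \<Rightarrow> (nat \<Rightarrow> 'a) set" where
  "hit z x = {\<omega>. (\<forall>i. \<omega> i \<in> T) \<and> (\<exists>k. x \<otimes> walk G \<omega> k = z)}"

lemma hitting_prob_hit: "hitting_prob G (pmf_of_set T) x z = measure \<Omega> (hit z x)"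
  unfolding hitting_prob_def hit_def using T_finite T_nonempty by simp

lemma prob_space_\<Omega>: "prob_space \<Omega>"
  by (intro prob_space_PiM measure_pmf.prob_space_axioms)

lemma space_\<Omega>: "space \<Omega> = UNIV"
  by (simp add: space_PiM)

lemma coord_sets: "{\<omega>. \<omega> k \<in> A} \<in> sets \<Omega>"
proof -
  have "(\<lambda>\<omega>. \<omega> k) \<in> measurable \<Omega> (measure_pmf (pmf_of_set T))"
    by (rule measurable_component_singleton) simp
  from measurable_sets[OF this, of A] show ?thesis by (simp add: space_\<Omega> vimage_def)
qed

lemma good_sets: "{\<omega>. \<forall>i. \<omega> i \<in> T} \<in> sets \<Omega>"
proof -
  have "{\<omega>. \<forall>i. \<omega> i \<in> T} = (\<Inter>i. {\<omega>. \<omega> i \<in> T})" by auto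
  also have "\<dots> \<in> sets \<Omega>" by (intro sets.countable_INT) (auto intro: coord_sets)
  finally show ?thesis .
qed

text \<open>Splitting over the finitely many values of the last step reduces the event to conditions
  on single coordinates, so no joint measurability of the multiplication is required.\<close>

lemma walk_sets: "{\<omega>. (\<forall>i. \<omega> i \<in> T) \<and> walk G \<omega> k \<in> A} \<in> sets \<Omega>"
proof (induction k arbitrary: A)
  case 0
  then show ?case using good_sets by (cases "\<one> \<in> A") auto
next
  case (Suc k)
  have "{\<omega>. (\<forall>i. \<omega> i \<in> T) \<and> walk G \<omega> (Suc k) \<in> A} =
    (\<Union>s\<in>T. {\<omega>. (\<forall>i. \<omega> i \<in> T) \<and> walk G \<omega> k \<in> {t. t \<otimes> s \<in> A}} \<inter> {\<omega>. \<omega> k \<in> {s}})" by auto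
  also have "\<dots> \<in> sets \<Omega>" by (intro sets.finite_UN T_finite sets.Int Suc coord_sets)
  finally show ?case .
qed

lemma hit_at_sets: "hit_at k z x \<in> sets \<Omega>"
  using walk_sets[of k "{y. x \<otimes> y = z}"] unfolding hit_at_def by simp

lemma hit_Union: "hit z x = (\<Union>k. hit_at k z x)"
  unfolding hit_def hit_at_def by auto

lemma hit_sets: "hit z x \<in> sets \<Omega>"
  unfolding hit_Union by (intro sets.countable_UN) (auto intro: hit_at_sets)

lemma good_prob: "measure \<Omega> {\<omega>. \<forall>i. \<omega> i \<in> T} = 1"
proof -
  interpret prob_space \<Omega> by (rule prob_space_\<Omega>)
  have "AE \<omega> in \<Omega>. \<omega> i \<in> T" for i
    using T_finite T_nonempty
    by (intro AE_PiM_component measure_pmf.prob_space_axioms) (auto simp: AE_measure_pmf_iff)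
  then have "AE \<omega> in \<Omega>. \<forall>i. \<omega> i \<in> T" by (simp add: AE_all_countable)
  then show ?thesis using prob_eq_1[OF good_sets] by simp
qed

lemma hit_at_shift:
  assumes "s \<in> T" "x \<in> carrier G"
  shows "{\<omega>. case_nat s \<omega> \<in> hit_at (Suc k) z x} = hit_at k z (x \<otimes> s)"
proof -
  have "(\<forall>i. case_nat s \<omega> i \<in> T) \<longleftrightarrow> (\<forall>i. \<omega> i \<in> T)" for \<omega>
    using assms by (auto split: nat.splits)
  moreover have "x \<otimes> walk G (case_nat s \<omega>) (Suc k) = x \<otimes> s \<otimes> walk G \<omega> k" if "\<forall>i. \<omega> i \<in> T" for \<omega>
    using that assms walk_shift[of \<omega> s k] walk_closed[of \<omega> k] by (simp add: m_assoc del: walk.simps)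
  ultimately show ?thesis unfolding hit_at_def by (auto simp del: walk.simps)
qed

lemma hit_shift:
  assumes "s \<in> T" "x \<in> carrier G" "x \<noteq> z"
  shows "{\<omega>. case_nat s \<omega> \<in> hit z x} = hit z (x \<otimes> s)"
proof -
  have 0: "hit_at 0 z x = {}" unfolding hit_at_def using assms by auto
  have "hit z x = (\<Union>k. hit_at (Suc k) z x)"
    unfolding hit_Union using 0 by (auto, metis emptyE not0_implies_Suc)
  then have "{\<omega>. case_nat s \<omega> \<in> hit z x} = (\<Union>k. {\<omega>. case_nat s \<omega> \<in> hit_at (Suc k) z x})" by auto
  then show ?thesis unfolding hit_at_shift[OF assms(1,2)] hit_Union .
qed

lemma measure_hit_at: "x \<in> carrier G \<Longrightarrow> z \<in> carrier G \<Longrightarrow> measure \<Omega> (hit_at k z x) = step_prob k z x"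
proof (induction k arbitrary: x)
  case 0
  then show ?case using good_prob by (cases "x = z") (auto simp: hit_at_def)
next
  case (Suc k)
  have "measure \<Omega> (hit_at (Suc k) z x) = (\<Sum>s\<in>T. measure \<Omega> {\<omega>. case_nat s \<omega> \<in> hit_at (Suc k) z x}) / real (card T)"
    using T_finite T_nonempty hit_at_sets by (rule PiM_pmf_of_set_shift)
  also have "\<dots> = step_prob (Suc k) z x"
    using Suc unfolding step_prob.simps P_def N_def
    by (intro arg_cong2[of _ _ _ _ "(/)"] sum.cong) (auto simp: hit_at_shift)
  finally show ?case .
qed

lemma measure_hit_le:
  assumes "x \<in> carrier G" "z \<in> carrier G"
  shows "measure \<Omega> (hit z x) \<le> green_fun x z"
proof -
  interpret prob_space \<Omega> by (rule prob_space_\<Omega>)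
  have "measure \<Omega> (\<Union>k. hit_at k z x) \<le> (\<Sum>k. measure \<Omega> (hit_at k z x))"
    using assms hit_at_sets step_prob_summable by (intro finite_measure_subadditive_countably) (auto simp: measure_hit_at)
  then show ?thesis unfolding green_fun_def hit_Union by (simp add: measure_hit_at assms)
qed

lemma measure_hit_step:
  assumes "x \<in> carrier G" "x \<noteq> z"
  shows "measure \<Omega> (hit z x) = P (\<lambda>y. measure \<Omega> (hit z y)) x"
proof -
  have "measure \<Omega> (hit z x) = (\<Sum>s\<in>T. measure \<Omega> {\<omega>. case_nat s \<omega> \<in> hit z x}) / real (card T)"
    using T_finite T_nonempty hit_sets by (rule PiM_pmf_of_set_shift)
  then show ?thesis unfolding P_def N_def using assms by (simp add: hit_shift)
qed

lemma measure_hit_diag: "x \<in> carrier G \<Longrightarrow> measure \<Omega> (hit x x) = 1"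
proof -
  assume "x \<in> carrier G"
  then have "hit x x = {\<omega>. \<forall>i. \<omega> i \<in> T}" unfolding hit_def by (auto intro: exI[of _ 0])
  then show ?thesis using good_prob by simp
qed

text \<open>Both sides are 1 at \<open>z\<close>, harmonic elsewhere and bounded by a multiple of
  \<open>\<phi> z\<close>. The absolute value of their difference is therefore subharmonic, and zero
  by the maximum principle.\<close>

lemma hitting_prob_eq:
  assumes x: "x \<in> carrier G" and z: "z \<in> carrier G"
  shows "hitting_prob G (pmf_of_set T) x z = green_fun x z / green_fun \<one> \<one>"
proof -
  define h where "h y = measure \<Omega> (hit z y) - 1 / green_fun \<one> \<one> * green_fun y z" for y
  have g: "1 \<le> green_fun \<one> \<one>" by (rule green_fun_one_ge_1)
  have "\<bar>h x\<bar> \<le> 0"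
  proof (rule subharmonic_nonpos[OF z _ _ x, where C = 2])
    fix y assume y: "y \<in> carrier G"
    have "0 \<le> measure \<Omega> (hit z y)" by simp
    moreover have "0 \<le> 1 / green_fun \<one> \<one> * green_fun y z" "1 / green_fun \<one> \<one> * green_fun y z \<le> green_fun y z"
      using g green_fun_nonneg[OF y z] mult_right_mono[of "1 / green_fun \<one> \<one>" 1 "green_fun y z"] by auto
    ultimately have "\<bar>h y\<bar> \<le> green_fun y z" using measure_hit_le[OF y z] unfolding h_def by linarith
    then show "\<bar>h y\<bar> \<le> 2 * \<phi> z y" using green_fun_le_\<phi>[OF y z] by simp
    show "\<bar>h y\<bar> \<le> P (\<lambda>y. \<bar>h y\<bar>) y"
    proof (cases "y = z")
      case True
      have "h z = 0" unfolding h_def using measure_hit_diag[OF z] green_fun_diag[OF z] g by simp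
      then show ?thesis using True P_nonneg[OF z, of "\<lambda>y. \<bar>h y\<bar>"] by simp
    next
      case False
      have "h y = P (\<lambda>y. measure \<Omega> (hit z y)) y - 1 / green_fun \<one> \<one> * P (\<lambda>y. green_fun y z) y"
        unfolding h_def measure_hit_step[OF y False] using green_fun_eq[OF y z] False by simp
      also have "\<dots> = P h y" unfolding h_def P_diff P_cmult ..
      finally have "\<bar>h y\<bar> = \<bar>P h y\<bar>" by simp
      also have "\<dots> \<le> P (\<lambda>y. \<bar>h y\<bar>) y"
        unfolding P_def using N_ge_1 by (simp add: divide_right_mono)
      finally show ?thesis .
    qed
  qed
  then show ?thesis unfolding hitting_prob_hit h_def by simp
qed

lemma green_metric_eq: "x \<in> carrier G \<Longrightarrow> y \<in> carrier G \<Longrightarrow> green_metric G (pmf_of_set T) x y = green_dist x y"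
  unfolding green_metric_def green_dist_def by (simp add: hitting_prob_eq)

lemma green_metric_hyp: "green_metric G (pmf_of_set T) \<in> hyp_metrics G"
  by (intro hyp_metrics_green_dist green_metric_eq)

end

section \<open>Stable lengths and convergence\<close>

text \<open>Fekete's lemma, by division of \<open>n\<close> by a fixed \<open>m\<close> whose
  quotient \<open>x m / m\<close> almost attains the infimum.\<close>

lemma subadditive_convergent:
  fixes x :: "nat \<Rightarrow> real"
  assumes sub: "\<And>m n. x (m + n) \<le> x m + x n" and nonneg: "\<And>n. 0 \<le> x n"
  shows "convergent (\<lambda>n. x n / real n)"
proof -
  define L where "L = (INF n\<in>{1..}. x n / real n)"
  have bdd: "bdd_below ((\<lambda>n. x n / real n) ` {1..})" using nonneg by (intro bdd_belowI[of _ 0]) auto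
  have lower: "L \<le> x n / real n" if "n \<ge> 1" for n
    unfolding L_def using that by (intro cINF_lower bdd) auto
  have mult: "x (q * m) \<le> real q * x m" if "q \<ge> 1" for q m
    using that
  proof (induction q rule: nat_induct_at_least)
    case (Suc q)
    then show ?case using sub[of m "q * m"] by (simp add: algebra_simps)
  qed simp
  have "(\<lambda>n. x n / real n) \<longlonglongrightarrow> L"
  proof (rule LIMSEQ_I)
    fix e :: real assume e: "0 < e"
    have "\<exists>m\<in>{1..}. x m / real m < L + e / 2"
      using cInf_lessD[of "(\<lambda>n. x n / real n) ` {1..}" "L + e / 2"] e unfolding L_def by auto
    then obtain m where m: "m \<ge> 1" "x m / real m < L + e / 2" by auto
    define B where "B = Max (x ` {..<m})"
    have B: "x r \<le> B" if "r < m" for r unfolding B_def using that by (intro Max_ge) auto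
    have B0: "0 \<le> B" using B[of 0] m nonneg[of 0] by simp
    obtain n0 :: nat where n0: "2 * B / e < real n0" using reals_Archimedean2 by blast
    have "norm (x n / real n - L) < e" if n: "n \<ge> max n0 m" for n
    proof -
      have n1: "n \<ge> 1" using n m by simp
      have q: "n div m \<ge> 1" using n m by (simp add: div_greater_zero_iff Suc_leI)
      have "x n = x (n div m * m + n mod m)" by simp
      also have "\<dots> \<le> real (n div m) * x m + B"
        using sub[of "n div m * m" "n mod m"] mult[OF q, of m] B[of "n mod m"] m by simp
      also have "real (n div m) * x m \<le> real n / real m * x m"
      proof (intro mult_right_mono nonneg)
        have "real (n div m) * real m \<le> real n"
          by (metis div_times_less_eq_dividend of_nat_le_iff of_nat_mult)
        then show "real (n div m) \<le> real n / real m" using m(1) by (simp add: field_simps)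
      qed
      finally have "x n \<le> real n * (x m / real m) + B" by simp
      then have "x n / real n \<le> (real n * (x m / real m) + B) / real n" by (intro divide_right_mono) auto
      also have "\<dots> = x m / real m + B / real n" using n1 by (simp add: add_divide_distrib)
      also have "B / real n < e / 2"
      proof -
        have "2 * B / e < real n" using n0 n by simp
        then show ?thesis using e n1 by (simp add: field_simps)
      qed
      finally have "x n / real n < L + e" using m by simp
      then show ?thesis using lower[OF n1] by (simp add: abs_if)
    qed
    then show "\<exists>no. \<forall>n\<ge>no. norm (x n / real n - L) < e" by blast
  qed
  then show ?thesis by (rule convergentI)
qed

section \<open>Stable lengths\<close>

context group begin

lemma stable_length_limit:
  assumes d: "d \<in> hyp_metrics G" and g: "g \<in> carrier G"
  shows "(\<lambda>k. d \<one> (g [^] (k::nat)) / real k) \<longlonglongrightarrow> stable_length G d g"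
proof -
  have m: "\<And>x y. x \<in> carrier G \<Longrightarrow> y \<in> carrier G \<Longrightarrow> 0 \<le> d x y"
    "\<And>x y z. x \<in> carrier G \<Longrightarrow> y \<in> carrier G \<Longrightarrow> z \<in> carrier G \<Longrightarrow> d x z \<le> d x y + d y z"
    "\<And>g x y. g \<in> carrier G \<Longrightarrow> x \<in> carrier G \<Longrightarrow> y \<in> carrier G \<Longrightarrow> d (g \<otimes> x) (g \<otimes> y) = d x y"
    using d unfolding hyp_metrics_def by auto
  have "convergent (\<lambda>k. d \<one> (g [^] (k::nat)) / real k)"
  proof (rule subadditive_convergent)
    fix i j :: nat
    have "d (g [^] i) (g [^] i \<otimes> g [^] j) = d \<one> (g [^] j)" using m(3)[of "g [^] i" \<one> "g [^] j"] g by simp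
    then show "d \<one> (g [^] (i + j)) \<le> d \<one> (g [^] i) + d \<one> (g [^] j)"
      using m(2)[of \<one> "g [^] i" "g [^] i \<otimes> g [^] j"] g by (simp add: nat_pow_mult)
  qed (use m(1) g in auto)
  then show ?thesis unfolding stable_length_def by (simp add: convergent_LIMSEQ_iff)
qed

lemma stable_length_nonneg: "d \<in> hyp_metrics G \<Longrightarrow> g \<in> carrier G \<Longrightarrow> 0 \<le> stable_length G d g"
  by (rule LIMSEQ_le_const[OF stable_length_limit]) (auto simp: hyp_metrics_def)

lemma stable_length_le:
  assumes d: "d \<in> hyp_metrics G" "d' \<in> hyp_metrics G" and g: "g \<in> carrier G"
    and le: "\<And>x. x \<in> carrier G \<Longrightarrow> d \<one> x \<le> p * d' \<one> x + C"
  shows "stable_length G d g \<le> p * stable_length G d' g"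
proof -
  have "(\<lambda>k. p * (d' \<one> (g [^] (k::nat)) / real k) + C / real k) \<longlonglongrightarrow> p * stable_length G d' g + 0"
    using stable_length_limit[OF d(2) g] by (intro tendsto_intros lim_const_over_n)
  then have "(\<lambda>k. p * (d' \<one> (g [^] (k::nat)) / real k) + C / real k) \<longlonglongrightarrow> p * stable_length G d' g" by simp
  moreover have "d \<one> (g [^] k) / real k \<le> p * (d' \<one> (g [^] k) / real k) + C / real k" for k :: nat
  proof -
    have "d \<one> (g [^] k) / real k \<le> (p * d' \<one> (g [^] k) + C) / real k" using le g by (intro divide_right_mono) auto
    then show ?thesis by (simp add: add_divide_distrib)
  qed
  ultimately show ?thesis using stable_length_limit[OF d(1) g] by (intro LIMSEQ_le) auto
qed

lemma conj_class_SOME: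
  assumes "g \<in> carrier G"
  shows "\<exists>x\<in>carrier G. (SOME h. h \<in> conj_class G g) = x \<otimes> g \<otimes> inv x"
proof -
  have "\<one> \<otimes> g \<otimes> inv \<one> \<in> conj_class G g" unfolding conj_class_def by blast
  then have "(SOME h. h \<in> conj_class G g) \<in> conj_class G g" by (rule someI)
  then show ?thesis unfolding conj_class_def by blast
qed

lemma conj_pow:
  assumes "x \<in> carrier G" "g \<in> carrier G"
  shows "(x \<otimes> g \<otimes> inv x) [^] (n::nat) = x \<otimes> g [^] n \<otimes> inv x"
proof (induction n)
  case (Suc n)
  have "inv x \<otimes> (x \<otimes> (g \<otimes> inv x)) = g \<otimes> inv x" using assms by (simp add: m_assoc[symmetric])
  then show ?case using Suc assms by (simp add: m_assoc)
qed (use assms in simp)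

end

lemma SUP_ratio_bounds:
  fixes f h :: "'c \<Rightarrow> real"
  assumes ab: "0 < \<alpha>" "\<alpha> \<le> \<beta>" and h: "\<And>c. c \<in> A \<Longrightarrow> 0 \<le> h c"
    and fh: "\<And>c. c \<in> A \<Longrightarrow> \<alpha> * h c \<le> f c" "\<And>c. c \<in> A \<Longrightarrow> f c \<le> \<beta> * h c"
    and c0: "c0 \<in> A" "0 < h c0"
  shows "\<alpha> \<le> (SUP c\<in>A. f c / h c)" "(SUP c\<in>A. f c / h c) \<le> \<beta>"
proof -
  \<comment> \<open>For \<open>h c = 0\<close> the quotient is 0 by convention, which does not
    violate the upper bound. The lower bound needs only the single index \<open>c0\<close>.\<close>
  have le: "f c / h c \<le> \<beta>" if "c \<in> A" for c
    using fh(2)[OF that] h[OF that] ab by (cases "h c = 0") (auto simp: field_simps)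
  show "(SUP c\<in>A. f c / h c) \<le> \<beta>" using c0(1) le by (intro cSUP_least) auto
  have "\<alpha> \<le> f c0 / h c0" using fh(1)[OF c0(1)] c0(2) by (simp add: field_simps)
  also have "\<dots> \<le> (SUP c\<in>A. f c / h c)" using c0(1) le by (intro cSUP_upper bdd_aboveI2) auto
  finally show "\<alpha> \<le> (SUP c\<in>A. f c / h c)" .
qed

context green_group begin

text \<open>Stripping off an element of \<open>T\<close> gains at least \<open>m\<close> in length
  and costs at most \<open>ln N\<close> in the Green metric. The finitely many elements of length at
  most \<open>r\<close> are covered by the constant.\<close>

lemma green_dist_upper_slope:
  assumes R: "0 < m" and dec: "\<And>g. g \<in> carrier G \<Longrightarrow> r < len g \<Longrightarrow> \<exists>s\<in>T. len (inv s \<otimes> g) \<le> len g - m"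
  shows "\<exists>C. \<forall>g\<in>carrier G. green_dist \<one> g \<le> ln N / m * len g + C"
proof -
  define C where "C = Max (insert 0 (green_dist \<one> ` {g \<in> carrier G. len g \<le> r}))"
  have C: "green_dist \<one> g \<le> C" if "g \<in> carrier G" "len g \<le> r" for g
    unfolding C_def using that finite_ball by (intro Max_ge) auto
  have "\<forall>g\<in>carrier G. len g \<le> real n * m \<longrightarrow> green_dist \<one> g \<le> ln N / m * len g + C" for n
  proof (induction n)
    case 0
    show ?case
    proof (intro ballI impI)
      fix g assume g: "g \<in> carrier G" "len g \<le> real 0 * m"
      then have "len g = 0" using len_nonneg[of g] by simp
      show "green_dist \<one> g \<le> ln N / m * len g + C"
      proof (cases "r < len g")
        case True
        then obtain s where s: "s \<in> T" "len (inv s \<otimes> g) \<le> len g - m" using dec g by blast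
        then have "len (inv s \<otimes> g) < 0" using \<open>len g = 0\<close> R by simp
        then show ?thesis using len_nonneg[of "inv s \<otimes> g"] s g by simp
      next
        case False
        then show ?thesis using C[of g] g \<open>len g = 0\<close> by simp
      qed
    qed
  next
    case (Suc n)
    show ?case
    proof (intro ballI impI)
      fix g assume g: "g \<in> carrier G" "len g \<le> real (Suc n) * m"
      have slope: "0 \<le> ln N / m" using N_ge_1 R by simp
      show "green_dist \<one> g \<le> ln N / m * len g + C"
      proof (cases "r < len g")
        case True
        then obtain s where s: "s \<in> T" "len (inv s \<otimes> g) \<le> len g - m" using dec g by blast
        then have "green_dist \<one> (inv s \<otimes> g) \<le> ln N / m * len (inv s \<otimes> g) + C"
          using Suc g by (simp add: algebra_simps)
        also have "\<dots> \<le> ln N / m * (len g - m) + C" using s(2) slope by (intro add_right_mono mult_left_mono)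
        also have "\<dots> = ln N / m * len g - ln N + C" using R by (simp add: right_diff_distrib)
        finally have 1: "green_dist \<one> (inv s \<otimes> g) \<le> ln N / m * len g - ln N + C" .
        have "green_dist (s \<otimes> \<one>) (s \<otimes> (inv s \<otimes> g)) = green_dist \<one> (inv s \<otimes> g)" using s g by (intro green_dist_left) auto
        moreover have "s \<otimes> (inv s \<otimes> g) = g" using s g by (simp add: m_assoc[symmetric])
        ultimately have "green_dist s g = green_dist \<one> (inv s \<otimes> g)" using s by simp
        moreover have "green_dist \<one> s \<le> ln N" using green_dist_word_le[of \<one> "[s]"] s by simp
        moreover have "green_dist \<one> g \<le> green_dist \<one> s + green_dist s g" using s g by (intro green_dist_tri) auto
        ultimately show ?thesis using 1 by linarith
      next
        case False
        then have "green_dist \<one> g \<le> C" using C g by simp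
        moreover have "0 \<le> ln N / m * len g" by (intro mult_nonneg_nonneg slope len_nonneg g(1))
        ultimately show ?thesis by linarith
      qed
    qed
  qed
  moreover have "\<exists>n. len g \<le> real n * m" for g
    using reals_Archimedean3[OF R] by (meson less_imp_le)
  ultimately show ?thesis by blast
qed

end

section \<open>Annuli as generating sets and the limit of the Green metrics\<close>

context nonelem_hyp_group begin

text \<open>The constant \<open>\<delta>\<^sub>1\<close> of the theorem. \<open>2 * rg\<close> is
  required by \<open>ann_decompose\<close>; \<open>3 * (a + b)\<close> leaves room in the annulus
  for some \<open>x\<close> together with all its neighbours \<open>x \<otimes> s\<close>.\<close>

definition min_width :: real where "min_width = max (2 * rg) (3 * (a + b)) + 1"

lemma min_width_pos: "0 < min_width"
  unfolding min_width_def using rg_nonneg by simp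

text \<open>A path with steps at most \<open>a + b\<close> leads from the identity to an element
  longer than \<open>l\<close>; its last point before the length first exceeds
  \<open>l - (a + b)\<close> is the witness.\<close>

lemma intermediate_len:
  assumes "a + b \<le> l"
  shows "\<exists>x\<in>carrier G. l - 2 * (a + b) < len x \<and> len x \<le> l - (a + b)"
proof -
  obtain g where g: "g \<in> carrier G" "l < len g" using unbounded_len[OF infinite_carrier[OF not_virtually_cyclic]] by blast
  obtain n x where x: "\<forall>i. x i \<in> carrier G" "x 0 = \<one>" "x n = g" "\<forall>i<n. d (x i) (x (Suc i)) \<le> a + b"
    using word_path[OF g(1)] by blast
  have pos: "0 < a + b" using a_ge_1 b_nonneg by simp
  have ex: "l - (a + b) < len (x n)" using x g pos by simp
  define j where "j = (LEAST i. l - (a + b) < len (x i))"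
  have j: "l - (a + b) < len (x j)" "j \<le> n" unfolding j_def by (rule LeastI, fact) (rule Least_le, fact)
  obtain i where i: "j = Suc i" using j x(2) assms len_one by (cases j) auto
  have "len (x i) \<le> l - (a + b)" using not_less_Least[of i "\<lambda>i. l - (a + b) < len (x i)"] i unfolding j_def by simp
  moreover have "len (x j) \<le> len (x i) + d (x i) (x j)" using x by (intro d_tri) auto
  moreover have "d (x i) (x j) \<le> a + b" using x i j by simp
  ultimately show ?thesis using j x by (intro bexI[of _ "x i"]) auto
qed

text \<open>For \<open>x\<close> in the middle of the annulus both \<open>x\<close> and
  \<open>x \<otimes> s\<close> belong to it, and their quotient is the generator
  \<open>s\<close>.\<close>

lemma ann_generates:
  assumes "min_width < \<delta>" "a + b \<le> l"
  shows "generate G (ann \<delta> l) = carrier G"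
proof
  have sg: "subgroup (generate G (ann \<delta> l)) G" using ann_carrier by (rule generate_is_subgroup)
  show "generate G (ann \<delta> l) \<subseteq> carrier G" using generate_in_carrier[OF ann_carrier] by blast
  have \<delta>: "3 * (a + b) < \<delta>" using assms unfolding min_width_def by simp
  obtain x where x: "x \<in> carrier G" "l - 2 * (a + b) < len x" "len x \<le> l - (a + b)"
    using intermediate_len[OF assms(2)] by blast
  have pos: "0 < a + b" using a_ge_1 b_nonneg by simp
  have xa: "x \<in> ann \<delta> l" unfolding annulus_def using x \<delta> pos by simp
  have "s \<in> generate G (ann \<delta> l)" if "s \<in> S" for s
  proof -
    have s: "s \<in> carrier G" "len s \<le> a + b" using that S_carrier len_gen by auto
    have up: "len (x \<otimes> s) \<le> len x + len s" using x s by (intro len_mult)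
    have "len x \<le> len (x \<otimes> s) + d (x \<otimes> s) x" using x s by (intro d_tri) auto
    moreover have "d (x \<otimes> s) x = len s" using d_mult_right[of x s] d_sym[of "x \<otimes> s" x] x s by simp
    ultimately have "x \<otimes> s \<in> ann \<delta> l" unfolding annulus_def using x s up \<delta> by simp
    then have "inv x \<otimes> (x \<otimes> s) \<in> generate G (ann \<delta> l)"
      using xa by (intro generate.eng generate.incl generate.inv)
    then show ?thesis using x s by (simp add: m_assoc[symmetric])
  qed
  then have "generate G S \<subseteq> generate G (ann \<delta> l)" using sg by (intro generate_subgroup_incl) auto
  then show "carrier G \<subseteq> generate G (ann \<delta> l)" using S_generate by simp
qed

lemma ann_sym_generating: "min_width < \<delta> \<Longrightarrow> a + b \<le> l \<Longrightarrow> sym_generating G (ann \<delta> l)"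
  unfolding sym_generating_def using ann_carrier ann_finite ann_inv ann_generates by blast

lemma ann_nonempty:
  assumes "min_width < \<delta>" "a + b \<le> l"
  shows "ann \<delta> l \<noteq> {}"
proof -
  obtain x where "x \<in> carrier G" "l - 2 * (a + b) < len x" "len x \<le> l - (a + b)"
    using intermediate_len[OF assms(2)] by blast
  moreover have "3 * (a + b) < \<delta>" "0 < a + b" using assms a_ge_1 b_nonneg unfolding min_width_def by auto
  ultimately have "x \<in> ann \<delta> l" unfolding annulus_def by simp
  then show ?thesis by blast
qed

text \<open>An exponent strictly between \<open>v\<close> and \<beta> leaves a margin linear in
  \<open>l\<close>, which absorbs the constant and the shift by \<open>2 * rg\<close>.\<close>

lemma slope_upper:
  assumes "v < \<beta>"
  shows "\<forall>\<^sub>F l in at_top. ln (real (card (ann \<delta> l))) / (l - 2 * rg) \<le> \<beta>"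
proof -
  define u where "u = (v + \<beta>) / 2"
  have u: "v < u" "u < \<beta>" unfolding u_def using assms by auto
  obtain C where C: "0 \<le> C" "\<And>r. 0 \<le> r \<Longrightarrow> real (card (lball r)) \<le> C * exp (u * r)"
    using card_ball_upper[OF u(1)] by blast
  define c where "c = \<beta> - u"
  have "c > 0" unfolding c_def using u by simp
  have "\<forall>\<^sub>F l in at_top. ln (C + 1) + 2 * rg * \<beta> \<le> c * l"
    using eventually_ge_at_top[of "(ln (C + 1) + 2 * rg * \<beta>) / c"]
    by eventually_elim (use \<open>c > 0\<close> in \<open>simp add: field_simps\<close>)
  moreover have "\<forall>\<^sub>F l in at_top. max 0 (2 * rg) < l" by (rule eventually_gt_at_top)
  ultimately show ?thesis
  proof eventually_elim
    case (elim l)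
    have b0: "0 \<le> \<beta> * (l - 2 * rg)" using elim v_pos assms by simp
    have "ln (real (card (ann \<delta> l))) \<le> \<beta> * (l - 2 * rg)"
    proof (cases "card (ann \<delta> l) = 0")
      case False
      have "real (card (ann \<delta> l)) \<le> real (card (lball l))"
        using card_mono[OF ball_finite ann_ball] by simp
      also have "\<dots> \<le> C * exp (u * l)" using elim by (intro C(2)) simp
      also have "\<dots> \<le> (C + 1) * exp (u * l)" by (intro mult_right_mono) auto
      finally have "ln (real (card (ann \<delta> l))) \<le> ln ((C + 1) * exp (u * l))"
        using False C(1) by (subst ln_le_cancel_iff) auto
      also have "\<dots> = ln (C + 1) + u * l" using C(1) by (simp add: ln_mult)
      also have "\<dots> \<le> \<beta> * (l - 2 * rg)" using elim unfolding c_def by (simp add: algebra_simps)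
      finally show ?thesis .
    qed (use b0 in simp)
    then show ?case using elim by (simp add: field_simps)
  qed
qed

lemma green_sandwich:
  assumes \<delta>: "min_width < \<delta>" and \<alpha>: "v / 2 < \<alpha>" "\<alpha> < v" and \<beta>: "v < \<beta>"
  shows "\<forall>\<^sub>F l in at_top. green_metric G (pmf_of_set (ann \<delta> l)) \<in> hyp_metrics G \<and>
    (\<exists>C. \<forall>g\<in>carrier G. \<alpha> * len g \<le> green_metric G (pmf_of_set (ann \<delta> l)) \<one> g + C \<and>
      green_metric G (pmf_of_set (ann \<delta> l)) \<one> g \<le> \<beta> * len g + C)"
proof -
  have \<delta>2: "2 * rg < \<delta>" using \<delta> unfolding min_width_def by simp
  have "\<forall>\<^sub>F l in at_top. max (2 * rg) (a + b) < l" by (rule eventually_gt_at_top)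
  then show ?thesis using contraction[OF \<delta>2 \<alpha>] slope_upper[OF \<beta>, of \<delta>]
  proof eventually_elim
    case (elim l)
    \<comment> \<open>The step bound \<rho> is \<open>l\<close>, so the constants in Ancona's
      inequality depend on \<open>l\<close>. This is harmless: hyperbolicity is needed for each
      \<open>l\<close> separately, and stable lengths see only the slopes \<alpha> and
      \<beta>.\<close>
    interpret green: green_group G d \<eta> S a b "ann \<delta> l" \<alpha> l
    proof unfold_locales
      show "sym_generating G (ann \<delta> l)" "ann \<delta> l \<noteq> {}"
        using ann_sym_generating ann_nonempty \<delta> elim by auto
      show "len s \<le> l" if "s \<in> ann \<delta> l" for s using that unfolding annulus_def by simp
      show "0 < \<alpha>" using \<alpha> v_pos by simp
      show "(\<Sum>s\<in>ann \<delta> l. exp (- \<alpha> * d s g)) \<le> real (card (ann \<delta> l)) * exp (- \<alpha> * len g) / 2"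
        if "g \<in> carrier G" for g using elim that by blast
    qed
    have m: "0 < l - 2 * rg" using elim by simp
    have "\<exists>s\<in>ann \<delta> l. len (inv s \<otimes> g) \<le> len g - (l - 2 * rg)" if "g \<in> carrier G" "l < len g" for g
      using that \<delta>2 elim rg_nonneg by (intro ann_decompose) auto
    then obtain C where C: "\<And>g. g \<in> carrier G \<Longrightarrow> green.green_dist \<one> g \<le> ln green.N / (l - 2 * rg) * len g + C"
      using green.green_dist_upper_slope[OF m, of l] by blast
    have "\<alpha> * len g \<le> green_metric G (pmf_of_set (ann \<delta> l)) \<one> g + max C (ln 2) \<and>
      green_metric G (pmf_of_set (ann \<delta> l)) \<one> g \<le> \<beta> * len g + max C (ln 2)" if g: "g \<in> carrier G" for g
    proof -
      have "ln green.N / (l - 2 * rg) * len g \<le> \<beta> * len g"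
        using elim len_nonneg[OF g] unfolding green.N_def by (intro mult_right_mono) auto
      then show ?thesis using C[OF g] green.green_dist_lower[of \<one> g] green.green_metric_eq[of \<one> g] g by auto
    qed
    then show ?case using green.green_metric_hyp by blast
  qed
qed

text \<open>Supplies the class that keeps the suprema in \<open>Dil\<close> away from 0. The
  representative chosen by \<open>SOME\<close> is some conjugate of \<open>g\<close> by
  \<open>x\<close>; its powers are shorter than those of \<open>g\<close> by at most
  \<open>2 * len x\<close>, which disappears after division by \<open>n\<close>.\<close>

lemma stable_length_lox_pos:
  assumes "d \<in> hyp_metrics G"
  shows "\<exists>c\<in>nontorsion_classes G. 0 < class_stable_length G d c"
proof -
  obtain g K where gK: "lox g K" using exp_growth(2)[OF not_virtually_cyclic] by blast
  have g: "g \<in> carrier G" using gK by (rule lox_closed)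
  obtain c where c: "c > 0" "\<And>n. c * real n \<le> len (g [^] (n::nat))" using lox_pow_linear[OF gK] by blast
  have "g [^] n \<noteq> \<one>" if "n \<noteq> 0" for n :: nat
  proof
    assume "g [^] n = \<one>"
    then have "c * real n \<le> 0" using c(2)[of n] by (simp add: len_one)
    then show False using c(1) that by (simp add: mult_le_0_iff)
  qed
  then have "ord g = 0" using ord_eq_0[OF g] by blast
  then have nt: "conj_class G g \<in> nontorsion_classes G" unfolding nontorsion_classes_def using g by blast
  obtain x where x: "x \<in> carrier G" "(SOME h. h \<in> conj_class G g) = x \<otimes> g \<otimes> inv x"
    using conj_class_SOME[OF g] by blast
  define h where "h = x \<otimes> g \<otimes> inv x"
  have h: "h \<in> carrier G" unfolding h_def using x g by simp
  have lim: "(\<lambda>n. c - 2 * len x / real n) \<longlonglongrightarrow> c - 0" by (intro tendsto_intros lim_const_over_n)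
  have le: "c - 2 * len x / real n \<le> d \<one> (h [^] n) / real n" if n: "n \<ge> 1" for n :: nat
  proof -
    have "g [^] n = inv x \<otimes> (h [^] n \<otimes> x)"
      unfolding h_def conj_pow[OF x(1) g] using x g by (simp add: m_assoc[symmetric]) (simp add: m_assoc)
    then have "len (g [^] n) \<le> len x + (len (h [^] n) + len x)"
      using len_mult[of "inv x" "h [^] n \<otimes> x"] len_mult[of "h [^] n" x] x h len_inv[of x] by simp
    then have "c * real n - 2 * len x \<le> len (h [^] n)" using c(2)[of n] by simp
    then have "(c * real n - 2 * len x) / real n \<le> len (h [^] n) / real n" by (intro divide_right_mono) auto
    then show ?thesis using n by (simp add: diff_divide_distrib)
  qed
  have "c - 0 \<le> stable_length G d h"
    using le by (intro LIMSEQ_le[OF lim stable_length_limit[OF assms h]]) auto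
  then have "0 < class_stable_length G d (conj_class G g)" unfolding class_stable_length_def x(2) h_def using c by simp
  then show ?thesis using nt by blast
qed

lemma class_stable_length_eq:
  assumes "c \<in> nontorsion_classes G"
  obtains g where "g \<in> carrier G" "\<And>D. class_stable_length G D c = stable_length G D g"
proof -
  obtain g where g: "g \<in> carrier G" "c = conj_class G g" using assms unfolding nontorsion_classes_def by blast
  then obtain x where "x \<in> carrier G" "(SOME h. h \<in> c) = x \<otimes> g \<otimes> inv x" using conj_class_SOME by blast
  then show ?thesis using that[of "x \<otimes> g \<otimes> inv x"] g unfolding class_stable_length_def by simp
qed

text \<open>\<open>Delta\<close> evaluates representatives chosen by \<open>SOME\<close>. Rough
  similarity makes their stable lengths proportional to those of \<open>D\<close>, since additive
  errors vanish in the limit.\<close>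

lemma metric_class_SOME:
  assumes "D \<in> hyp_metrics G"
  shows "\<exists>c>0. (SOME D'. D' \<in> metric_class G D) \<in> hyp_metrics G \<and>
    (\<forall>g\<in>carrier G. stable_length G D g = c * stable_length G (SOME D'. D' \<in> metric_class G D) g)"
proof -
  define D' where "D' = (SOME D'. D' \<in> metric_class G D)"
  have "(D, D) \<in> rough_sim_rel G" unfolding rough_sim_rel_def using assms by (auto intro!: exI[of _ 1])
  then have "D \<in> metric_class G D" unfolding metric_class_def by simp
  then have "D' \<in> metric_class G D" unfolding D'_def
    by (rule someI[of "\<lambda>D'. D' \<in> metric_class G D"])
  then obtain c where D': "D' \<in> hyp_metrics G" "c > 0"
      "bdd_above ((\<lambda>g. \<bar>D \<one> g - c * D' \<one> g\<bar>) ` carrier G)"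
    unfolding metric_class_def rough_sim_rel_def by auto
  then obtain B where B: "\<And>g. g \<in> carrier G \<Longrightarrow> \<bar>D \<one> g - c * D' \<one> g\<bar> \<le> B"
    unfolding bdd_above_def by auto
  have "stable_length G D g = c * stable_length G D' g" if g: "g \<in> carrier G" for g
  proof (rule antisym)
    show "stable_length G D g \<le> c * stable_length G D' g"
    proof (rule stable_length_le[OF assms D'(1) g])
      show "D \<one> x \<le> c * D' \<one> x + B" if "x \<in> carrier G" for x using B[OF that] by linarith
    qed
    have "stable_length G D' g \<le> 1 / c * stable_length G D g"
    proof (rule stable_length_le[OF D'(1) assms g])
      show "D' \<one> x \<le> 1 / c * D \<one> x + B / c" if "x \<in> carrier G" for x
      proof -
        have "c * D' \<one> x \<le> D \<one> x + B" using B[OF that] by linarith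
        then show ?thesis using D'(2) by (simp add: field_simps)
      qed
    qed
    then show "c * stable_length G D' g \<le> stable_length G D g" using D'(2) by (simp add: field_simps)
  qed
  then show ?thesis using D' unfolding D'_def[symmetric] by blast
qed

lemma Delta_bound:
  assumes D: "D \<in> hyp_metrics G" and d: "d \<in> hyp_metrics G" and \<alpha>: "0 < \<alpha>" "\<alpha> \<le> \<beta>"
    and le: "\<And>g. g \<in> carrier G \<Longrightarrow> \<alpha> * d \<one> g \<le> D \<one> g + C" "\<And>g. g \<in> carrier G \<Longrightarrow> D \<one> g \<le> \<beta> * d \<one> g + C"
  shows "\<bar>Delta G (metric_class G D) (metric_class G d)\<bar> \<le> ln (\<beta> / \<alpha>)"
proof -
  define d1 where "d1 = (SOME D'. D' \<in> metric_class G D)"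
  define d2 where "d2 = (SOME D'. D' \<in> metric_class G d)"
  obtain c1 where c1: "c1 > 0" "d1 \<in> hyp_metrics G"
    "\<And>g. g \<in> carrier G \<Longrightarrow> stable_length G D g = c1 * stable_length G d1 g"
    using metric_class_SOME[OF D] unfolding d1_def by blast
  obtain c2 where c2: "c2 > 0" "d2 \<in> hyp_metrics G"
    "\<And>g. g \<in> carrier G \<Longrightarrow> stable_length G d g = c2 * stable_length G d2 g"
    using metric_class_SOME[OF d] unfolding d2_def by blast
  \<comment> \<open>The scale between the two chosen representatives. It enters one
    \<open>Dil\<close> directly and the other inversely, so it cancels in the product.\<close>
  define s where "s = c2 / c1"
  have s: "s > 0" unfolding s_def using c1 c2 by simp
  let ?f = "class_stable_length G d1" and ?h = "class_stable_length G d2"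
  have main: "0 \<le> ?f c \<and> 0 \<le> ?h c \<and> \<alpha> * s * ?h c \<le> ?f c \<and> ?f c \<le> \<beta> * s * ?h c"
    if c: "c \<in> nontorsion_classes G" for c
  proof -
    obtain g where g: "g \<in> carrier G" "\<And>D. class_stable_length G D c = stable_length G D g"
      using class_stable_length_eq[OF c] by blast
    have "stable_length G D g \<le> \<beta> * stable_length G d g"
      by (rule stable_length_le[OF D d g(1) le(2)])
    then have 1: "?f c \<le> \<beta> * s * ?h c"
      unfolding g(2) s_def c1(3)[OF g(1)] c2(3)[OF g(1)] using c1(1) by (simp add: field_simps)
    have "stable_length G d g \<le> 1 / \<alpha> * stable_length G D g"
    proof (rule stable_length_le[OF d D g(1)])
      show "d \<one> x \<le> 1 / \<alpha> * D \<one> x + C / \<alpha>" if "x \<in> carrier G" for x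
        using le(1)[OF that] \<alpha> by (simp add: field_simps)
    qed
    then have 2: "\<alpha> * s * ?h c \<le> ?f c"
      unfolding g(2) s_def c1(3)[OF g(1)] c2(3)[OF g(1)] using c1(1) \<alpha> by (simp add: field_simps)
    show ?thesis using 1 2 stable_length_nonneg[OF c1(2) g(1)] stable_length_nonneg[OF c2(2) g(1)] g(2) by simp
  qed
  obtain c0 where c0: "c0 \<in> nontorsion_classes G" "0 < class_stable_length G d c0"
    using stable_length_lox_pos[OF d] by blast
  obtain g0 where g0: "g0 \<in> carrier G" "\<And>D. class_stable_length G D c0 = stable_length G D g0"
    using class_stable_length_eq[OF c0(1)] by blast
  have h0: "0 < ?h c0" using c0(2) c2(1) unfolding g0(2) c2(3)[OF g0(1)] by (simp add: zero_less_mult_iff)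
  have \<alpha>s: "0 < \<alpha> * s" "\<alpha> * s \<le> \<beta> * s" using \<alpha> s by auto
  have f0: "0 < ?f c0" using main[OF c0(1)] h0 \<alpha>s(1) by (smt (verit) mult_pos_pos)
  have A: "\<alpha> * s \<le> Dil G d1 d2" "Dil G d1 d2 \<le> \<beta> * s"
    unfolding Dil_def
    using SUP_ratio_bounds[OF \<alpha>s, of "nontorsion_classes G" ?h ?f c0] main c0(1) h0 by auto
  have \<beta>s: "0 < \<beta> * s" using \<alpha>s by simp
  have inv: "0 < 1 / (\<beta> * s)" "1 / (\<beta> * s) \<le> 1 / (\<alpha> * s)" using \<alpha>s \<beta>s by (auto intro!: divide_left_mono)
  have B1: "1 / (\<beta> * s) * ?f c \<le> ?h c" if "c \<in> nontorsion_classes G" for c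
    using main[OF that] \<beta>s by (simp add: pos_divide_le_eq mult.commute)
  have B2: "?h c \<le> 1 / (\<alpha> * s) * ?f c" if "c \<in> nontorsion_classes G" for c
    using main[OF that] \<alpha>s(1) by (simp add: pos_le_divide_eq mult.commute)
  have B: "1 / (\<beta> * s) \<le> Dil G d2 d1" "Dil G d2 d1 \<le> 1 / (\<alpha> * s)"
    unfolding Dil_def
    using SUP_ratio_bounds[OF inv, of "nontorsion_classes G" ?f ?h c0] main B1 B2 c0(1) f0 by auto
  have Dil_pos: "0 < Dil G d1 d2" "0 < Dil G d2 d1" using A(1) B(1) \<alpha>s(1) inv(1) by linarith+
  have "\<alpha> * s * (1 / (\<beta> * s)) \<le> Dil G d1 d2 * Dil G d2 d1"
    using A B \<alpha>s(1) inv(1) \<beta>s Dil_pos by (intro mult_mono) (auto intro: less_imp_le)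
  then have lo: "\<alpha> / \<beta> \<le> Dil G d1 d2 * Dil G d2 d1" using s by simp
  have "Dil G d1 d2 * Dil G d2 d1 \<le> \<beta> * s * (1 / (\<alpha> * s))"
    using A B \<alpha>s(1) inv(1) \<beta>s Dil_pos by (intro mult_mono) (auto intro: less_imp_le)
  then have hi: "Dil G d1 d2 * Dil G d2 d1 \<le> \<beta> / \<alpha>" using s by simp
  have pos: "0 < \<alpha> / \<beta>" using \<alpha> by simp
  have "ln (\<alpha> / \<beta>) \<le> ln (Dil G d1 d2 * Dil G d2 d1)" using lo pos by (subst ln_le_cancel_iff) auto
  moreover have "ln (Dil G d1 d2 * Dil G d2 d1) \<le> ln (\<beta> / \<alpha>)" using lo hi pos by (subst ln_le_cancel_iff) auto
  moreover have "ln (\<alpha> / \<beta>) = - ln (\<beta> / \<alpha>)" using \<alpha> by (simp add: ln_div)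
  ultimately show ?thesis unfolding Delta_def Let_def d1_def[symmetric] d2_def[symmetric] by (simp add: abs_le_iff)
qed

lemma Delta_green_tendsto:
  assumes d: "d \<in> hyp_metrics G" and \<delta>: "min_width < \<delta>"
  shows "((\<lambda>l. Delta G (metric_class G (green_metric G (pmf_of_set (ann \<delta> l)))) (metric_class G d)) \<longlongrightarrow> 0) at_top"
proof (rule tendstoI)
  fix \<epsilon> :: real assume "0 < \<epsilon>"
  \<comment> \<open>\<open>ln (\<beta> / \<alpha>)\<close> becomes \<open>2 * e\<close>, below
    \<epsilon>, and \<open>e < ln 2\<close> keeps \<alpha> above \<open>v / 2\<close>.\<close>
  define e where "e = min (\<epsilon> / 4) (ln 2 / 2)"
  have e: "0 < e" "2 * e < \<epsilon>" "e < ln 2" unfolding e_def using \<open>0 < \<epsilon>\<close> by (auto simp: min_def)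
  define \<alpha> where "\<alpha> = v * exp (- e)"
  define \<beta> where "\<beta> = v * exp e"
  have "exp (- ln 2) < exp (- e)" using e by simp
  then have "1 / 2 < exp (- e)" by (simp add: exp_minus)
  then have \<alpha>: "v / 2 < \<alpha>" "\<alpha> < v" "v < \<beta>" unfolding \<alpha>_def \<beta>_def using v_pos e by auto
  have ratio: "ln (\<beta> / \<alpha>) = 2 * e" unfolding \<alpha>_def \<beta>_def using v_pos by (simp add: ln_div ln_mult)
  show "\<forall>\<^sub>F l in at_top. dist (Delta G (metric_class G (green_metric G (pmf_of_set (ann \<delta> l)))) (metric_class G d)) 0 < \<epsilon>"
    using green_sandwich[OF \<delta> \<alpha>]
  proof eventually_elim
    case (elim l)
    then obtain C where C: "\<And>g. g \<in> carrier G \<Longrightarrow> \<alpha> * len g \<le> green_metric G (pmf_of_set (ann \<delta> l)) \<one> g + C"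
      "\<And>g. g \<in> carrier G \<Longrightarrow> green_metric G (pmf_of_set (ann \<delta> l)) \<one> g \<le> \<beta> * len g + C" by blast
    have "\<bar>Delta G (metric_class G (green_metric G (pmf_of_set (ann \<delta> l)))) (metric_class G d)\<bar> \<le> ln (\<beta> / \<alpha>)"
      using elim d \<alpha> v_pos C by (intro Delta_bound) auto
    then show ?case unfolding ratio using e by simp
  qed
qed

lemma metric_class_green:
  assumes \<delta>: "min_width < \<delta>"
  shows "\<forall>\<^sub>F l in at_top. metric_class G (green_metric G (pmf_of_set (ann \<delta> l))) \<in> metric_classes G"
proof -
  have "v / 2 < 3 / 4 * v" "3 / 4 * v < v" "v < v + 1" using v_pos by auto
  from green_sandwich[OF \<delta> this] show ?thesis
    by eventually_elim (auto simp: metric_class_def metric_classes_def intro: quotientI)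
qed

end

theorem theorem5:
  fixes G :: "('a, 'b) monoid_scheme" and d :: "'a \<Rightarrow> 'a \<Rightarrow> real"
  assumes "nonelementary_hyperbolic_group G"
    and "d \<in> hyp_metrics G"
  shows "\<exists>\<delta>\<^sub>1>0. \<forall>\<delta>>\<delta>\<^sub>1.
    (\<forall>\<^sub>F l in at_top. generate G (annulus G d \<delta> l) = carrier G) \<and>
    (\<forall>\<^sub>F l in at_top.
       metric_class G (green_metric G (pmf_of_set (annulus G d \<delta> l))) \<in> metric_classes G) \<and>
    ((\<lambda>l. Delta G (metric_class G (green_metric G (pmf_of_set (annulus G d \<delta> l))))
                  (metric_class G d)) \<longlongrightarrow> 0) at_top"
proof -
  have "group G" "\<not> virtually_cyclic G"
    using assms(1) unfolding nonelementary_hyperbolic_group_def hyperbolic_group_def by auto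
  then obtain \<eta> S a b where "hyp_group G d \<eta> S a b" using hyp_group_exists[OF _ assms(2)] by blast
  then interpret nonelem_hyp_group G d \<eta> S a b
    using \<open>\<not> virtually_cyclic G\<close> by (intro nonelem_hyp_group.intro nonelem_hyp_group_axioms.intro)
  show ?thesis
  proof (intro exI[of _ min_width] conjI allI impI)
    fix \<delta> assume \<delta>: "min_width < \<delta>"
    show "\<forall>\<^sub>F l in at_top. generate G (annulus G d \<delta> l) = carrier G"
      using eventually_ge_at_top[of "a + b"] by eventually_elim (rule ann_generates[OF \<delta>])
    show "\<forall>\<^sub>F l in at_top. metric_class G (green_metric G (pmf_of_set (annulus G d \<delta> l))) \<in> metric_classes G"
      by (rule metric_class_green[OF \<delta>])
    show "((\<lambda>l. Delta G (metric_class G (green_metric G (pmf_of_set (annulus G d \<delta> l))))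
      (metric_class G d)) \<longlongrightarrow> 0) at_top"
      by (rule Delta_green_tendsto[OF assms(2) \<delta>])
  qed (rule min_width_pos)
qed

end
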